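(* Let $\gamma\ge0$ and let $\{\theta^{\nu,\alpha}\}_{\nu,\alpha>0}$ (written $\theta$ for short) be a family of statistically stationary strong solutions of $$d\theta+(u\cdot\nabla\theta-\nu\Delta\theta+\alpha\Lambda^{-2\gamma}\theta)\,dt=\sum_{n\in\mathbb N}g_n^\lambda\,dW_n(t),\qquad u=\mathcal R^\perp\theta=(-\mathcal R_2\theta,\mathcal R_1\theta),$$ with $\theta^{\nu,\alpha}$ posed on $\mathbb T^2_\lambda=\mathbb R^2/(\lambda\mathbb Z)^2$, where $\lambda=\lambda(\nu,\alpha)\ge1$ and $\lambda(\nu,\alpha)\to\infty$ as $\nu,\alpha\to0$. Assume that for some $s>1/3$, $$\sup_{\nu,\alpha}\mathbb E\|\theta\|^3_{B^s_{3,\infty}(\mathbb T^2_\lambda)}<\infty ,$$ where the Besov norm is defined with respect to the normalized $L^3_\lambda$ norm. Let $$S_E(\ell):=\mathbb E\fint_{\mathbb S^1}\fint_{\mathbb T^2_\lambda}|\delta_{\ell\hat n}\theta|^2\,(\delta_{\ell\hat n}u\cdot\hat n)\,dx\,dS(\hat n).$$ Then $$\lim_{\ell_I\to0}\ \limsup_{\nu,\alpha\to0}\ \sup_{\ell\in(0,\ell_I]}\left|\frac{S_E(\ell)}{\ell}\right|=0 .$$ Consequently, along such a uniformly Besov-regular family no non-trivial direct SPE flux law can hold: there are no constant $c\neq0$ and no scale $\ell_\nu\to0$ for which $\lim_{\ell_I\to0}\limsup_{\nu,\alpha\to0}\sup_{\ell\in[\ell_\nu,\ell_I]}|S_E(\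ell)/\ell-c|=0$.
   Context: Torus and Fourier conventions: $\mathbb T^2_\lambda=\mathbb R^2/(\lambda\mathbb Z)^2$, frequency lattice $\mathbb Z^2_\lambda=\frac{2\pi}{\lambda}\mathbb Z^2$, $\fint_A f=\frac1{|A|}\int_A f$, $\widehat f(k)=\fint_{\mathbb T^2_\lambda}f(x)e^{-ik\cdot x}dx$. $\|f\|_{L^p_\lambda}=(\fint_{\mathbb T^2_\lambda}|f|^pdx)^{1/p}$ is the averaged norm. $\Lambda^s=(-\Delta)^{s/2}$ is the multiplier $|k|^s$; $\mathcal R_j$ is the Riesz transform with multiplier $ik_j/|k|$, $k\ne0$. Negative-order multipliers act on zero-mean functions. $\delta_hf(x)=f(x+h)-f(x)$. $dS$ is arclength on the unit circle $\mathbb S^1$, and $\fint_{\mathbb S^1}$ is the normalized integral. Besov norm: fix standard smooth cutoffs $\chi$ (supported near the origin) and $\varphi$ (supported in an annulus) with $\chi(r)+\sum_{j\ge0}\varphi(2^{-j}r)=1$ for $r\ge0$. Set $\Delta_jf=\sum_{k\in\mathbb Z^2_\lambda}\varphi(2^{-j}|k|)\widehat f(k)e^{ik\cdot x}$ for $j\ge0$ and $\Delta_{-1}f=\sum_{k\in\mathbb Z_\lambda^2}\chi(|k|)\widehat f(k)e^{ik\cdot x}$. Then $$\|f\|_{B^s_{3,\infty}}=\|\Delta_{-1}f\|_{L^3_\lambda}+\sup_{j\ge0}2^{js}\|\Delta_jf\|_{L^3_\lambda}.$$ Standing assumptions: $\nu,\alpha>0$; $\{W_n\}_{n\in\mathbb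 N}$ are i.i.d. standard Brownian motions on a filtered probability space $(\Omega,\mathcal F,(\mathcal F_t),\mathbb P)$ satisfying the usual conditions; for each $\lambda$, $\{g_n^\lambda\}_n$ are smooth deterministic scalar fields on $\mathbb T^2_\lambda$ with zero spatial mean, satisfying $\sup_{\lambda\ge1}\sum_n\|\Lambda^{1+\sigma}g_n^\lambda\|^2_{L^2_\lambda}<\infty$ for all $\sigma>0$ and $\lim_{\delta\to0}\sup_{\lambda\ge1}\sum_n\|(\Lambda^{-1/2}g_n^\lambda)_{\le\delta}\|^2_{L^2_\lambda}=0$, where $f_{\le\delta}=\sum_{|k|\le\delta}\widehat f(k)e^{ik\cdot x}$; $\theta$ has zero spatial mean. Statistically stationary strong solution (for fixed $\nu,\alpha>0$, $\lambda\ge1$ and a given stochastic basis): a process $\theta$ that (i) is $\mathcal F_t$-adapted and satisfies the equation pathwise (in time-integrated form, $\mathbb P$-a.s.); (ii) satisfies $\theta\in C([0,\infty);H^1(\mathbb T^2_\lambda))\cap L^2_{\rm loc}([0,\infty);H^2(\mathbb T^2_\lambda))$ $\mathbb P$-a.s.; (iii) has law on path space invariant under time translations. Expectations of functionals of $\theta$ are taken at a fixed time $t$, and are independent of $t$ by stationarity. "SPE" is surface potential energy $\|\theta\|_{L^2}^2$. *)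

theory Defs
  imports "HOL-Probability.Probability"
begin

section \<open>Fourier analysis on the torus of side \<open>L\<close>\<close>

text \<open>Functions on the torus are \<open>L\<close>-periodic functions on the plane, and elements of \<open>L\<^sup>2\<close> are
  represented by Borel functions; nothing below depends on the choice of the representative.\<close>

definition torus_cell :: "real \<Rightarrow> (real^2) set" where
  "torus_cell L = cbox 0 (\<chi> i. L)"

definition torus_periodic :: "real \<Rightarrow> (real^2 \<Rightarrow> 'b) \<Rightarrow> bool" where
  "torus_periodic L f \<longleftrightarrow> (\<forall>x i. f (x + axis i L) = f x)"

definition torus_avg :: "real \<Rightarrow> (real^2 \<Rightarrow> 'b::{banach,second_countable_topology}) \<Rightarrow> 'b" where
  "torus_avg L f = (LINT x:torus_cell L|lborel. f x) /\<^sub>R L\<^sup>2"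

definition torus_norm ::
    "real \<Rightarrow> real \<Rightarrow> (real^2 \<Rightarrow> 'b::{banach,second_countable_topology}) \<Rightarrow> real" where
  "torus_norm L p f = torus_avg L (\<lambda>x. norm (f x) powr p) powr (1 / p)"

definition torus_inner :: "real \<Rightarrow> (real^2 \<Rightarrow> real) \<Rightarrow> (real^2 \<Rightarrow> real) \<Rightarrow> real" where
  "torus_inner L f g = torus_avg L (\<lambda>x. f x * g x)"

definition torus_L2 :: "real \<Rightarrow> (real^2 \<Rightarrow> real) set" where
  "torus_L2 L = {f. torus_periodic L f \<and> f \<in> borel_measurable borel \<and>
     set_integrable lborel (torus_cell L) (\<lambda>x. (f x)\<^sup>2)}"

definition freq :: "real \<Rightarrow> (real^2) set" where
  "freq L = {k. \<forall>i. \<exists>m::int. k $ i = 2 * pi / L * real_of_int m}"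

definition fcoeff :: "real \<Rightarrow> (real^2 \<Rightarrow> real) \<Rightarrow> real^2 \<Rightarrow> complex" where
  "fcoeff L f k = torus_avg L (\<lambda>x. complex_of_real (f x) * exp (- \<i> * complex_of_real (k \<bullet> x)))"

text \<open>The Fourier series of an \<open>L\<^sup>2\<close> function need not converge pointwise, so a multiplier operator
  is defined by selecting an \<open>L\<^sup>2\<close> function with the prescribed Fourier coefficients, which is unique
  almost everywhere. Symbols \<open>m\<close> are applied only if \<open>m (- k) = cnj (m k)\<close>, so that real functions
  are mapped to real functions.\<close>

definition fmult :: "real \<Rightarrow> (real^2 \<Rightarrow> complex) \<Rightarrow> (real^2 \<Rightarrow> real) \<Rightarrow> real^2 \<Rightarrow> real" where
  "fmult L m f = (SOME g. g \<in> torus_L2 L \<and> (\<forall>k\<in>freq L. fcoeff L g k = m k * fcoeff L f k))"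

text \<open>The symbols below vanish at \<open>k = 0\<close> because \<open>0 powr s = 0\<close> and \<open>x / 0 = 0\<close>; for
  nonpositive orders they are applied to functions of zero mean only.\<close>

definition Lam :: "real \<Rightarrow> real \<Rightarrow> (real^2 \<Rightarrow> real) \<Rightarrow> real^2 \<Rightarrow> real" where
  "Lam L s = fmult L (\<lambda>k. complex_of_real (norm k powr s))"

definition riesz :: "real \<Rightarrow> 2 \<Rightarrow> (real^2 \<Rightarrow> real) \<Rightarrow> real^2 \<Rightarrow> real" where
  "riesz L j = fmult L (\<lambda>k. \<i> * complex_of_real (k $ j / norm k))"

definition partial_deriv :: "real \<Rightarrow> 2 \<Rightarrow> (real^2 \<Rightarrow> real) \<Rightarrow> real^2 \<Rightarrow> real" where
  "partial_deriv L j = fmult L (\<lambda>k. \<i> * complex_of_real (k $ j))"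

definition laplacian :: "real \<Rightarrow> (real^2 \<Rightarrow> real) \<Rightarrow> real^2 \<Rightarrow> real" where
  "laplacian L = fmult L (\<lambda>k. - complex_of_real ((norm k)\<^sup>2))"

definition riesz_perp :: "real \<Rightarrow> (real^2 \<Rightarrow> real) \<Rightarrow> real^2 \<Rightarrow> real^2" where
  "riesz_perp L f x = vector [- riesz L 2 f x, riesz L 1 f x]"

definition torus_grad :: "real \<Rightarrow> (real^2 \<Rightarrow> real) \<Rightarrow> real^2 \<Rightarrow> real^2" where
  "torus_grad L f x = (\<chi> j. partial_deriv L j f x)"

text \<open>Multipliers with compactly supported symbol: the sum has finitely many nonzero terms.\<close>

definition freq_cut :: "real \<Rightarrow> (real^2 \<Rightarrow> real) \<Rightarrow> (real^2 \<Rightarrow> real) \<Rightarrow> real^2 \<Rightarrow> complex" where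
  "freq_cut L \<psi> f x = (\<Sum>\<^sub>\<infinity>k\<in>freq L.
     complex_of_real (\<psi> k) * fcoeff L f k * exp (\<i> * complex_of_real (k \<bullet> x)))"

definition low_pass :: "real \<Rightarrow> real \<Rightarrow> (real^2 \<Rightarrow> real) \<Rightarrow> real^2 \<Rightarrow> complex" where
  "low_pass L \<delta> f = freq_cut L (\<lambda>k. if norm k \<le> \<delta> then 1 else 0) f"


section \<open>Function spaces\<close>

primrec Ck :: "nat \<Rightarrow> ('a::real_normed_vector \<Rightarrow> real) \<Rightarrow> bool" where
  "Ck 0 f \<longleftrightarrow> continuous_on UNIV f"
| "Ck (Suc n) f \<longleftrightarrow> (\<forall>x. f differentiable at x) \<and>
     (\<forall>v. Ck n (\<lambda>x. frechet_derivative f (at x) v))"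

definition smooth :: "('a::real_normed_vector \<Rightarrow> real) \<Rightarrow> bool" where
  "smooth f \<longleftrightarrow> (\<forall>n. Ck n f)"

definition sobolev :: "real \<Rightarrow> real \<Rightarrow> (real^2 \<Rightarrow> real) set" where
  "sobolev L s = {f \<in> torus_L2 L.
     (\<lambda>k. (1 + (norm k)\<^sup>2) powr s * (cmod (fcoeff L f k))\<^sup>2) summable_on freq L}"

definition sobolev_norm :: "real \<Rightarrow> real \<Rightarrow> (real^2 \<Rightarrow> real) \<Rightarrow> real" where
  "sobolev_norm L s f =
     sqrt (\<Sum>\<^sub>\<infinity>k\<in>freq L. (1 + (norm k)\<^sup>2) powr s * (cmod (fcoeff L f k))\<^sup>2)"

definition sobolev_borel :: "real \<Rightarrow> real \<Rightarrow> (real^2 \<Rightarrow> real) measure" where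
  "sobolev_borel L s = sigma (sobolev L s)
     {U. U \<subseteq> sobolev L s \<and> (\<forall>f\<in>U. \<exists>e>0. \<forall>g\<in>sobolev L s. sobolev_norm L s (g - f) < e \<longrightarrow> g \<in> U)}"

text \<open>Littlewood--Paley cutoffs, \<open>\<eta>\<close> near the origin and \<open>\<phi>\<close> on an annulus, as
  functions of the modulus \<open>r\<close> of the frequency (\<open>\<chi>\<close> is reserved for vectors).\<close>

definition lp_cutoffs :: "(real \<Rightarrow> real) \<Rightarrow> (real \<Rightarrow> real) \<Rightarrow> bool" where
  "lp_cutoffs \<eta> \<phi> \<longleftrightarrow> smooth \<eta> \<and> smooth \<phi> \<and>
     (\<exists>R>0. \<forall>r>R. \<eta> r = 0) \<and>
     (\<exists>a b. 0 < a \<and> a < b \<and> (\<forall>r\<ge>0. r \<notin> {a..b} \<longrightarrow> \<phi> r = 0)) \<and>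
     (\<forall>r\<ge>0. \<eta> r + (\<Sum>j. \<phi> (r / 2 ^ j)) = 1)"

definition besov_norm ::
    "(real \<Rightarrow> real) \<Rightarrow> (real \<Rightarrow> real) \<Rightarrow> real \<Rightarrow> real \<Rightarrow> (real^2 \<Rightarrow> real) \<Rightarrow> ennreal" where
  "besov_norm \<eta> \<phi> L s f =
     ennreal (torus_norm L 3 (freq_cut L (\<lambda>k. \<eta> (norm k)) f)) +
     (SUP j::nat. ennreal (2 powr (real j * s) *
        torus_norm L 3 (freq_cut L (\<lambda>k. \<phi> (norm k / 2 ^ j)) f)))"


section \<open>Stochastic basis and forcing\<close>

definition stochastic_basis :: "'w measure \<Rightarrow> (real \<Rightarrow> 'w measure) \<Rightarrow> bool" where
  "stochastic_basis M F \<longleftrightarrow> prob_space M \<and>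
     filtration (space M) (\<lambda>t. F (max 0 t)) \<and>
     (\<forall>t\<ge>0. sets (F t) \<subseteq> sets M) \<and>
     (\<forall>N\<in>null_sets M. \<forall>A\<subseteq>N. A \<in> sets (F 0)) \<and>
     (\<forall>t\<ge>0. sets (F t) = (\<Inter>r\<in>{t<..}. sets (F r)))"

definition brownian_motion ::
    "'w measure \<Rightarrow> (real \<Rightarrow> 'w measure) \<Rightarrow> (real \<Rightarrow> 'w \<Rightarrow> real) \<Rightarrow> bool" where
  "brownian_motion M F W \<longleftrightarrow>
     (\<forall>t\<ge>0. W t \<in> borel_measurable (F t)) \<and>
     (AE \<omega> in M. W 0 \<omega> = 0) \<and>
     (AE \<omega> in M. continuous_on {0..} (\<lambda>t. W t \<omega>)) \<and>
     (\<forall>r t. 0 \<le> r \<and> r < t \<longrightarrow>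
        distributed M lborel (\<lambda>\<omega>. W t \<omega> - W r \<omega>) (\<lambda>x. ennreal (normal_density 0 (sqrt (t - r)) x)) \<and>
        prob_space.indep_set M (sets (F r))
          {(\<lambda>\<omega>. W t \<omega> - W r \<omega>) -` A \<inter> space M | A. A \<in> sets borel})"

definition iid_brownian_motions ::
    "'w measure \<Rightarrow> (real \<Rightarrow> 'w measure) \<Rightarrow> (nat \<Rightarrow> real \<Rightarrow> 'w \<Rightarrow> real) \<Rightarrow> bool" where
  "iid_brownian_motions M F W \<longleftrightarrow> (\<forall>n. brownian_motion M F (W n)) \<and>
     prob_space.indep_vars M (\<lambda>_. PiM {0..} (\<lambda>_. borel)) (\<lambda>n \<omega>. \<lambda>t\<in>{0..}. W n t \<omega>) UNIV"

definition admissible_forcing :: "(real \<Rightarrow> nat \<Rightarrow> real^2 \<Rightarrow> real) \<Rightarrow> bool" where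
  "admissible_forcing g \<longleftrightarrow>
     (\<forall>L\<ge>1. \<forall>n. smooth (g L n) \<and> torus_periodic L (g L n) \<and> torus_avg L (g L n) = 0) \<and>
     (\<forall>\<sigma>>0. (SUP L\<in>{1..}. \<Sum>n. ennreal ((torus_norm L 2 (Lam L (1 + \<sigma>) (g L n)))\<^sup>2)) < \<infinity>) \<and>
     ((\<lambda>\<delta>. SUP L\<in>{1..}. \<Sum>n. ennreal ((torus_norm L 2 (low_pass L \<delta> (Lam L (- 1 / 2) (g L n))))\<^sup>2))
        \<longlongrightarrow> 0) (at_right 0)"


section \<open>Statistically stationary strong solutions\<close>

text \<open>\<open>I\<close> is the Bochner integral of \<open>G\<close> over \<open>[0,T]\<close> in \<open>L\<^sup>2\<close> of the torus: since this Hilbert space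
  is separable, weak measurability suffices and the integral is determined by duality.\<close>

definition has_L2_time_integral ::
    "real \<Rightarrow> (real \<Rightarrow> real^2 \<Rightarrow> real) \<Rightarrow> real \<Rightarrow> (real^2 \<Rightarrow> real) \<Rightarrow> bool" where
  "has_L2_time_integral L G T I \<longleftrightarrow> I \<in> torus_L2 L \<and>
     (AE r in lebesgue. r \<in> {0..T} \<longrightarrow> G r \<in> torus_L2 L) \<and>
     set_integrable lebesgue {0..T} (\<lambda>r. torus_norm L 2 (G r)) \<and>
     (\<forall>h\<in>torus_L2 L. set_integrable lebesgue {0..T} (\<lambda>r. torus_inner L (G r) h) \<and>
        torus_inner L I h = (LINT r:{0..T}|lebesgue. torus_inner L (G r) h))"

definition sqg_drift :: "real \<Rightarrow> real \<Rightarrow> real \<Rightarrow> real \<Rightarrow> (real^2 \<Rightarrow> real) \<Rightarrow> real^2 \<Rightarrow> real" where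
  "sqg_drift \<nu> \<alpha> \<gamma> L f x =
     riesz_perp L f x \<bullet> torus_grad L f x - \<nu> * laplacian L f x + \<alpha> * Lam L (- 2 * \<gamma>) f x"

definition C_H1 :: "real \<Rightarrow> (real \<Rightarrow> real^2 \<Rightarrow> real) set" where
  "C_H1 L = {v. (\<forall>t\<ge>0. v t \<in> sobolev L 1 \<and>
     ((\<lambda>r. sobolev_norm L 1 (v r - v t)) \<longlongrightarrow> 0) (at t within {0..}))}"

text \<open>Used for paths in \<^term>\<open>C_H1 L\<close> only, for which measurability into \<open>H\<^sup>2\<close> is automatic.\<close>

definition L2loc_H2 :: "real \<Rightarrow> (real \<Rightarrow> real^2 \<Rightarrow> real) set" where
  "L2loc_H2 L = {v. \<forall>T>0. (AE r in lebesgue. r \<in> {0..T} \<longrightarrow> v r \<in> sobolev L 2) \<and>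
     set_integrable lebesgue {0..T} (\<lambda>r. (sobolev_norm L 2 (v r))\<^sup>2)}"

text \<open>In \<open>stationary_strong_solution\<close> the law is taken on the cylinder \<open>\<sigma>\<close>-algebra, whose trace on
  continuous paths is the Borel \<open>\<sigma>\<close>-algebra of \<open>C([0,\<infinity>);H\<^sup>1)\<close>. The noise series is the \<open>L\<^sup>2\<close> limit
  of its partial sums.\<close>

definition stationary_strong_solution ::
    "'w measure \<Rightarrow> (real \<Rightarrow> 'w measure) \<Rightarrow> (nat \<Rightarrow> real \<Rightarrow> 'w \<Rightarrow> real) \<Rightarrow> (nat \<Rightarrow> real^2 \<Rightarrow> real) \<Rightarrow>
     real \<Rightarrow> real \<Rightarrow> real \<Rightarrow> real \<Rightarrow> (real \<Rightarrow> 'w \<Rightarrow> real^2 \<Rightarrow> real) \<Rightarrow> bool" where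
  "stationary_strong_solution M F W g \<nu> \<alpha> \<gamma> L \<theta> \<longleftrightarrow>
     (\<forall>t\<ge>0. \<theta> t \<in> measurable (F t) (sobolev_borel L 1)) \<and>
     (AE \<omega> in M. \<forall>t\<ge>0. \<exists>I. has_L2_time_integral L (\<lambda>r. sqg_drift \<nu> \<alpha> \<gamma> L (\<theta> r \<omega>)) t I \<and>
        (\<lambda>N. torus_norm L 2 (\<lambda>x. \<theta> t \<omega> x - \<theta> 0 \<omega> x + I x - (\<Sum>n<N. g n x * W n t \<omega>)))
          \<longlonglongrightarrow> 0) \<and>
     (AE \<omega> in M. (\<lambda>t. \<theta> t \<omega>) \<in> C_H1 L \<inter> L2loc_H2 L) \<and>
     (AE \<omega> in M. \<forall>t\<ge>0. torus_avg L (\<theta> t \<omega>) = 0) \<and>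
     (\<forall>h\<ge>0. distr M (PiM {0..} (\<lambda>_. sobolev_borel L 1)) (\<lambda>\<omega>. \<lambda>t\<in>{0..}. \<theta> (t + h) \<omega>) =
             distr M (PiM {0..} (\<lambda>_. sobolev_borel L 1)) (\<lambda>\<omega>. \<lambda>t\<in>{0..}. \<theta> t \<omega>))"


section \<open>The structure function\<close>

definition incr :: "real^2 \<Rightarrow> (real^2 \<Rightarrow> 'b::ab_group_add) \<Rightarrow> real^2 \<Rightarrow> 'b" where
  "incr h f x = f (x + h) - f x"

definition circle_avg :: "(real^2 \<Rightarrow> real) \<Rightarrow> real" where
  "circle_avg f = (LINT a:{0..2*pi}|lborel. f (vector [cos a, sin a])) / (2 * pi)"

definition S_E :: "'w measure \<Rightarrow> real \<Rightarrow> ('w \<Rightarrow> real^2 \<Rightarrow> real) \<Rightarrow> real \<Rightarrow> real" where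
  "S_E M L \<theta> l = (LINT \<omega>|M. circle_avg (\<lambda>n. torus_avg L (\<lambda>x.
     (incr (l *\<^sub>R n) (\<theta> \<omega>) x)\<^sup>2 * (incr (l *\<^sub>R n) (riesz_perp L (\<theta> \<omega>)) x \<bullet> n))))"

end

theory Submission
  imports Defs
begin

text \<open>
  Since \<open>a\<^sup>2 b \<le> a\<^sup>3 + b\<^sup>3\<close>, the flux is at most the sum of the cubed \<open>L\<^sup>3\<close> norms of the increments of \<open>\<theta>\<close>
  and of its two Riesz transforms. For \<open>1/3 < p < min s 1\<close> these norms are bounded by \<open>C l\<^sup>p\<close> times the
  Besov norm with \<open>C\<close> independent of the side \<open>L \<ge> 1\<close> of the torus, so that \<open>S_E(l) / l = O(l\<^sup>3\<^sup>p\<^sup>-\<^sup>1)\<close>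
  uniformly in the parameters.

  The increment of a Littlewood--Paley block is a Fourier multiplier with a compactly supported symbol.
  On trigonometric polynomials it is a finite combination of translates, taken over a fine grid, and the
  sum of the absolute values of the weights is bounded, uniformly in \<open>L\<close>, by Cauchy--Schwarz, discrete
  Parseval and a bound on the mixed second differences of the symbol. No Calderon--Zygmund theory is
  needed: increments kill the singularity of the Riesz symbol at the origin. The blocks are summed with
  geometric weights; the sum is identified by the uniqueness of Fourier coefficients, which also shows that
  the Riesz transforms exist.
\<close>

section \<open>The normalized measure on the torus\<close>

text \<open>The constants must not see \<open>L\<close>, although the lattice spacing 2 pi /
  \<open>L\<close> shrinks to zero. Hence no uniform bound is claimed for the Riesz transform itself
  on the low-frequency block: its increments are bounded uniformly there, and for the transform
  plain finiteness is enough. The mixed difference suffices, without pure second differences,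
  because the product weight (1 + x^2)(1 + y^2) already has a summable inverse in the plane. Trading
  the regularity \<open>s\<close> for \<open>p < s\<close> leaves a factor 2^((p - s) j) on the j-th
  block. It pays for summing the blocks, since a norm with a supremum over blocks gives no
  summability of its own. As \<open>fmult\<close> is a choice operator, nothing can be said of
  \<open>riesz\<close> before some square integrable function with the right coefficients has been
  produced. The block series supplies one, cubic integrability being stronger than square
  integrability on a space of finite measure.\<close>

definition tm :: "real \<Rightarrow> (real^2) measure" where
  "tm L = density lborel (\<lambda>x. ennreal (indicator (torus_cell L) x / L\<^sup>2))"

definition lvec :: "real \<Rightarrow> int \<times> int \<Rightarrow> real^2" where
  "lvec L n = vector [L * real_of_int (fst n), L * real_of_int (snd n)]"

lemma lvec_nth [simp]: "lvec L n $ 1 = L * real_of_int (fst n)" "lvec L n $ 2 = L * real_of_int (snd n)"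
  by (simp_all add: lvec_def)

lemma sets_tm [measurable_cong, simp]: "sets (tm L) = sets borel"
  by (simp add: tm_def)

lemma space_tm [simp]: "space (tm L) = UNIV"
  by (simp add: tm_def)

lemma torus_cell_borel [measurable]: "torus_cell L \<in> sets borel"
  by (simp add: torus_cell_def)

lemma torus_periodic_lvec:
  assumes "torus_periodic L f"
  shows "f (x + lvec L n) = f x"
proof -
  have A: "f (y + axis i L) = f y" for y i
    using assms by (auto simp: torus_periodic_def)
  have N: "f (y + axis i (L * real k)) = f y" for y i and k :: nat
  proof (induction k)
    case (Suc k)
    have "y + axis i (L * real (Suc k)) = (y + axis i (L * real k)) + axis i L"
      by (simp add: vec_eq_iff axis_def algebra_simps)
    then show ?case using A Suc by metis
  qed (simp add: axis_def zero_vec_def[symmetric])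
  have Z: "f (y + axis i (L * real_of_int k)) = f y" for y i and k :: int
  proof (cases "k \<ge> 0")
    case True then show ?thesis using N[of y i "nat k"] by simp
  next
    case False
    have "f ((y + axis i (L * real_of_int k)) + axis i (L * real (nat (-k)))) = f (y + axis i (L * real_of_int k))"
      by (rule N)
    moreover have "(y + axis i (L * real_of_int k)) + axis i (L * real (nat (-k))) = y"
      using False by (simp add: vec_eq_iff axis_def)
    ultimately show ?thesis by simp
  qed
  have "x + lvec L n = (x + axis 1 (L * real_of_int (fst n))) + axis 2 (L * real_of_int (snd n))"
    by (simp add: vec_eq_iff forall_2 axis_def)
  then show ?thesis using Z by metis
qed

text \<open>The closed \<open>torus_cell\<close> overlaps its translates along the edges. The
  half-open cell has exactly one lattice translate through each point, and it differs from the
  closed one by a null set.\<close>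

definition hcell :: "real \<Rightarrow> (real^2) set" where
  "hcell L = {x. 0 \<le> x $ 1 \<and> x $ 1 < L \<and> 0 \<le> x $ 2 \<and> x $ 2 < L}"

lemma hcell_borel [measurable]: "hcell L \<in> sets borel"
  unfolding hcell_def by measurable

lemma hcell_unique_shift:
  assumes "L > 0"
  shows "x + lvec L n \<in> hcell L \<longleftrightarrow> n = (- \<lfloor>x $ 1 / L\<rfloor>, - \<lfloor>x $ 2 / L\<rfloor>)"
proof -
  have *: "(0 \<le> a + L * real_of_int k \<and> a + L * real_of_int k < L) \<longleftrightarrow> k = - \<lfloor>a / L\<rfloor>" for a k
  proof -
    have "(0 \<le> a + L * real_of_int k \<and> a + L * real_of_int k < L) \<longleftrightarrow>
        (of_int (-k) \<le> a / L \<and> a / L < of_int (-k) + 1)"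
      using assms by (auto simp: field_simps)
    also have "\<dots> \<longleftrightarrow> \<lfloor>a / L\<rfloor> = - k"
      by (auto simp: floor_eq_iff)
    finally show ?thesis by auto
  qed
  show ?thesis
    using *[of "x $ 1" "fst n"] *[of "x $ 2" "snd n"] by (cases n) (auto simp: hcell_def)
qed

lemma AE_cell_hcell: "AE x in lborel. indicator (torus_cell L) x = (indicator (hcell L) x :: real)"
proof -
  have "cbox 0 (\<chi> i. L) - box 0 (\<chi> i. L) \<in> null_sets (lborel :: (real^2) measure)"
    by (rule null_sets_cbox_Diff_box)
  moreover have "box 0 (\<chi> i. L) \<subseteq> hcell L" "hcell L \<subseteq> cbox 0 (\<chi> i. L)"
    by (auto simp: hcell_def mem_box_cart forall_2 less_imp_le)
  ultimately show ?thesis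
    unfolding torus_cell_def
    by (intro AE_I'[of "cbox 0 (\<chi> i. L) - box 0 (\<chi> i. L)"]) (auto simp: indicator_def)
qed

lemma nn_integral_tm:
  assumes [measurable]: "f \<in> borel_measurable borel"
  shows "(\<integral>\<^sup>+x. f x \<partial>tm L) = ennreal (1 / L\<^sup>2) * (\<integral>\<^sup>+x. f x * indicator (hcell L) x \<partial>lborel)"
proof -
  have "(\<integral>\<^sup>+x. f x \<partial>tm L) = (\<integral>\<^sup>+x. ennreal (indicator (torus_cell L) x / L\<^sup>2) * f x \<partial>lborel)"
    unfolding tm_def by (subst nn_integral_density) auto
  also have "\<dots> = (\<integral>\<^sup>+x. ennreal (1 / L\<^sup>2) * (f x * indicator (hcell L) x) \<partial>lborel)"
  proof (rule nn_integral_cong_AE)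
    show "AE x in lborel. ennreal (indicator (torus_cell L) x / L\<^sup>2) * f x
        = ennreal (1 / L\<^sup>2) * (f x * indicator (hcell L) x)"
      using AE_cell_hcell[of L] by eventually_elim (auto simp: indicator_def mult.commute)
  qed
  also have "\<dots> = ennreal (1 / L\<^sup>2) * (\<integral>\<^sup>+x. f x * indicator (hcell L) x \<partial>lborel)"
    by (rule nn_integral_cmult) auto
  finally show ?thesis .
qed

lemma nn_integral_lborel_shift:
  fixes f :: "real^2 \<Rightarrow> ennreal"
  assumes [measurable]: "f \<in> borel_measurable borel"
  shows "(\<integral>\<^sup>+x. f (x + c) \<partial>lborel) = (\<integral>\<^sup>+x. f x \<partial>lborel)"
proof -
  have "(\<integral>\<^sup>+x. f x \<partial>lborel) = (\<integral>\<^sup>+x. f x \<partial>distr lborel borel ((+) c))"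
    by (simp only: lborel_distr_plus)
  also have "\<dots> = (\<integral>\<^sup>+x. f (c + x) \<partial>lborel)"
    by (rule nn_integral_distr) auto
  finally show ?thesis by (simp add: add.commute)
qed

text \<open>Both sides are cut along the tiles \<open>hcell L + lvec L n\<close>, which are then moved back into
  \<open>hcell L\<close>.\<close>

lemma nn_integral_tm_shift:
  fixes f :: "real^2 \<Rightarrow> ennreal"
  assumes L: "L > 0" and [measurable]: "f \<in> borel_measurable borel" and per: "torus_periodic L f"
  shows "(\<integral>\<^sup>+x. f (x + h) \<partial>tm L) = (\<integral>\<^sup>+x. f x \<partial>tm L)"
proof -
  let ?D = "hcell L" and ?C = "count_space (UNIV :: (int \<times> int) set)"
  have one: "(\<integral>\<^sup>+n. indicator ?D (x + lvec L n) \<partial>?C) = 1" for x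
  proof -
    have "(\<integral>\<^sup>+n. indicator ?D (x + lvec L n) \<partial>?C)
        = (\<integral>\<^sup>+n. indicator {(- \<lfloor>x $ 1 / L\<rfloor>, - \<lfloor>x $ 2 / L\<rfloor>)} n \<partial>?C)"
      by (intro nn_integral_cong) (simp add: indicator_def hcell_unique_shift[OF L])
    also have "\<dots> = 1" by (subst nn_integral_indicator) auto
    finally show ?thesis .
  qed
  have "(\<integral>\<^sup>+x. f (x + h) * indicator ?D x \<partial>lborel)
      = (\<integral>\<^sup>+x. f (x + h) * indicator ?D x * (\<integral>\<^sup>+n. indicator ?D (x + h + lvec L n) \<partial>?C) \<partial>lborel)"
    by (simp add: one)
  also have "\<dots> = (\<integral>\<^sup>+x. (\<integral>\<^sup>+n. f (x + h) * indicator ?D x * indicator ?D (x + h + lvec L n) \<partial>?C) \<partial>lborel)"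
    by (simp add: nn_integral_cmult)
  also have "\<dots> = (\<integral>\<^sup>+n. (\<integral>\<^sup>+x. f (x + h) * indicator ?D x * indicator ?D (x + h + lvec L n) \<partial>lborel) \<partial>?C)"
    by (rule nn_integral_count_space_nn_integral) auto
  also have "\<dots> = (\<integral>\<^sup>+n. (\<integral>\<^sup>+x. f x * indicator ?D (x - h - lvec L n) * indicator ?D x \<partial>lborel) \<partial>?C)"
  proof (rule nn_integral_cong)
    fix n :: "int \<times> int"
    have "(\<integral>\<^sup>+x. f x * indicator ?D (x - h - lvec L n) * indicator ?D x \<partial>lborel) =
      (\<integral>\<^sup>+x. f (x + (h + lvec L n)) * indicator ?D (x + (h + lvec L n) - h - lvec L n) * indicator ?D (x + (h + lvec L n)) \<partial>lborel)"
      by (rule nn_integral_lborel_shift[symmetric]) measurable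
    also have "\<dots> = (\<integral>\<^sup>+x. f (x + h) * indicator ?D x * indicator ?D (x + h + lvec L n) \<partial>lborel)"
      using torus_periodic_lvec[OF per, of "x + h" n for x] by (simp add: add.assoc)
    finally show "(\<integral>\<^sup>+x. f (x + h) * indicator ?D x * indicator ?D (x + h + lvec L n) \<partial>lborel)
        = (\<integral>\<^sup>+x. f x * indicator ?D (x - h - lvec L n) * indicator ?D x \<partial>lborel)" by simp
  qed
  also have "\<dots> = (\<integral>\<^sup>+x. (\<integral>\<^sup>+n. f x * indicator ?D x * indicator ?D (x - h - lvec L n) \<partial>?C) \<partial>lborel)"
    by (subst nn_integral_count_space_nn_integral) (auto simp: mult_ac)
  also have "\<dots> = (\<integral>\<^sup>+x. f x * indicator ?D x * (\<integral>\<^sup>+n. indicator ?D (x - h - lvec L n) \<partial>?C) \<partial>lborel)"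
    by (simp add: nn_integral_cmult)
  also have "\<dots> = (\<integral>\<^sup>+x. f x * indicator ?D x \<partial>lborel)"
  proof -
    \<comment> \<open>In \<open>one\<close> the lattice vector is added, here it is subtracted; the
      counting measure is invariant under negation.\<close>
    have "(\<integral>\<^sup>+n. indicator ?D (x - h - lvec L n) \<partial>?C) = 1" for x
    proof -
      have "(\<integral>\<^sup>+n. indicator ?D (x - h + lvec L n) \<partial>distr ?C ?C uminus) = (\<integral>\<^sup>+n. indicator ?D (x - h + lvec L (- n)) \<partial>?C)"
        by (rule nn_integral_distr) auto
      moreover have "distr ?C ?C uminus = ?C"
        using bij_betw_def by (subst distr_bij_count_space) (auto intro!: bij_uminus)
      moreover have "x - h + lvec L (- n) = x - h - lvec L n" for n
        by (simp add: vec_eq_iff forall_2)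
      ultimately show ?thesis using one[of "x - h"] by simp
    qed
    then show ?thesis by simp
  qed
  finally show ?thesis by (simp add: nn_integral_tm)
qed

lemma prob_space_tm:
  assumes "L > 0" shows "prob_space (tm L)"
proof
  have "emeasure (tm L) (space (tm L)) = (\<integral>\<^sup>+x. ennreal (1 / L\<^sup>2) * indicator (torus_cell L) x \<partial>lborel)"
    unfolding tm_def by (subst emeasure_density) (auto intro!: nn_integral_cong simp: indicator_def)
  also have "\<dots> = ennreal (1 / L\<^sup>2) * emeasure lborel (torus_cell L)"
    by (simp add: nn_integral_cmult)
  also have "emeasure lborel (torus_cell L) = ennreal (L\<^sup>2)"
    using assms unfolding torus_cell_def
    by (subst emeasure_lborel_cbox_eq)
      (auto simp: Basis_vec_def inner_axis prod.UNION_disjoint power2_eq_square axis_eq_axis cart_eq_inner_axis[symmetric]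
        prod_constant[symmetric] cong: prod.cong)
  finally show "emeasure (tm L) (space (tm L)) = 1"
    using assms by (simp add: ennreal_mult'[symmetric])
qed

lemma torus_avg_tm:
  assumes "L > 0" and [measurable]: "f \<in> borel_measurable borel"
  shows "torus_avg L f = integral\<^sup>L (tm L) f"
proof -
  have "integral\<^sup>L (tm L) f = (LINT x|lborel. (indicator (torus_cell L) x / L\<^sup>2) *\<^sub>R f x)"
    unfolding tm_def by (subst integral_density) auto
  also have "\<dots> = (LINT x|lborel. (1 / L\<^sup>2) *\<^sub>R (indicator (torus_cell L) x *\<^sub>R f x))"
    by (intro Bochner_Integration.integral_cong) auto
  also have "\<dots> = torus_avg L f"
    unfolding torus_avg_def set_lebesgue_integral_def
    by (subst integral_scaleR_right) (simp add: inverse_eq_divide)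
  finally show ?thesis by simp
qed

lemma set_integrable_tm:
  fixes f :: "real^2 \<Rightarrow> real"
  assumes L: "L > 0" and [measurable]: "f \<in> borel_measurable borel"
  shows "set_integrable lborel (torus_cell L) f \<longleftrightarrow> integrable (tm L) f"
proof -
  have "integrable (tm L) f \<longleftrightarrow> integrable lborel (\<lambda>x. (indicator (torus_cell L) x / L\<^sup>2) *\<^sub>R f x)"
    unfolding tm_def by (subst integrable_density) auto
  also have "\<dots> \<longleftrightarrow> integrable lborel (\<lambda>x. (1 / L\<^sup>2) * (indicator (torus_cell L) x * f x))"
    by (intro Bochner_Integration.integrable_cong) auto
  also have "\<dots> \<longleftrightarrow> set_integrable lborel (torus_cell L) f"
    unfolding set_integrable_def using L by (subst integrable_mult_left_iff) auto
  finally show ?thesis by simp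
qed

lemma integral_tm_shift_real:
  fixes f :: "real^2 \<Rightarrow> real"
  assumes L: "L > 0" and [measurable]: "f \<in> borel_measurable borel" and per: "torus_periodic L f"
    and int: "integrable (tm L) f"
  shows "integrable (tm L) (\<lambda>x. f (x + h))" "(\<integral>x. f (x + h) \<partial>tm L) = (\<integral>x. f x \<partial>tm L)"
proof -
  have per': "torus_periodic L (\<lambda>x. ennreal (f x))" "torus_periodic L (\<lambda>x. ennreal (- f x))"
    "torus_periodic L (\<lambda>x. ennreal (norm (f x)))"
    using per by (auto simp: torus_periodic_def)
  have "(\<integral>\<^sup>+x. ennreal (norm (f (x + h))) \<partial>tm L) = (\<integral>\<^sup>+x. ennreal (norm (f x)) \<partial>tm L)"
    using per' by (intro nn_integral_tm_shift[OF L, of "\<lambda>x. ennreal (norm (f x))"]) auto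
  then show i: "integrable (tm L) (\<lambda>x. f (x + h))"
    using int by (auto simp: integrable_iff_bounded)
  have "(\<integral>\<^sup>+x. ennreal (f (x + h)) \<partial>tm L) = (\<integral>\<^sup>+x. ennreal (f x) \<partial>tm L)"
       "(\<integral>\<^sup>+x. ennreal (- f (x + h)) \<partial>tm L) = (\<integral>\<^sup>+x. ennreal (- f x) \<partial>tm L)"
    using per' by (intro nn_integral_tm_shift[OF L, of "\<lambda>x. ennreal (f x)"]
        nn_integral_tm_shift[OF L, of "\<lambda>x. ennreal (- f x)"]; simp)+
  then show "(\<integral>x. f (x + h) \<partial>tm L) = (\<integral>x. f x \<partial>tm L)"
    using int i by (simp add: real_lebesgue_integral_def)
qed

lemma integral_tm_shift:
  fixes f :: "real^2 \<Rightarrow> complex"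
  assumes L: "L > 0" and [measurable]: "f \<in> borel_measurable borel" and per: "torus_periodic L f"
    and int: "integrable (tm L) f"
  shows "(\<integral>x. f (x + h) \<partial>tm L) = (\<integral>x. f x \<partial>tm L)"
proof -
  have p: "torus_periodic L (\<lambda>x. Re (f x))" "torus_periodic L (\<lambda>x. Im (f x))"
    using per by (auto simp: torus_periodic_def)
  have i: "integrable (tm L) (\<lambda>x. Re (f x))" "integrable (tm L) (\<lambda>x. Im (f x))"
    using int by auto
  note R = integral_tm_shift_real[OF L _ p(1) i(1), of h]
  note I = integral_tm_shift_real[OF L _ p(2) i(2), of h]
  have "integrable (tm L) (\<lambda>x. complex_of_real (Re (f (x + h))) + \<i> * complex_of_real (Im (f (x + h))))"
    using R(1) I(1) by (intro Bochner_Integration.integrable_add integrable_mult_right integrable_of_real) auto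
  then have "integrable (tm L) (\<lambda>x. f (x + h))"
    by (simp add: complex_eq[symmetric])
  then show ?thesis
    using R(2) I(2) int by (intro complex_eqI) auto
qed

section \<open>Trigonometric polynomials\<close>

definition ew :: "real^2 \<Rightarrow> real^2 \<Rightarrow> complex" where
  "ew k x = cis (k \<bullet> x)"

definition trig :: "(real^2) set \<Rightarrow> (real^2 \<Rightarrow> complex) \<Rightarrow> real^2 \<Rightarrow> complex" where
  "trig S c x = (\<Sum>k\<in>S. c k * ew k x)"

lemma ew_exp: "exp (\<i> * complex_of_real (k \<bullet> x)) = ew k x"
  by (simp add: ew_def cis_conv_exp)

lemma ew_exp_minus: "exp (- \<i> * complex_of_real (k \<bullet> x)) = ew (- k) x"
  by (simp add: ew_def cis_conv_exp)

lemma norm_ew [simp]: "norm (ew k x) = 1"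
  by (simp add: ew_def)

lemma ew_add: "ew k (x + y) = ew k x * ew k y" "ew (k + l) x = ew k x * ew l x"
  by (simp_all add: ew_def cis_mult inner_add_left inner_add_right)

lemma ew_zero [simp]: "ew 0 x = 1" "ew k 0 = 1"
  by (simp_all add: ew_def)

lemma cnj_ew: "cnj (ew k x) = ew (- k) x"
  by (simp add: ew_def cis_cnj)

lemma continuous_on_ew [continuous_intros]:
  "continuous_on A f \<Longrightarrow> continuous_on A (\<lambda>x. ew k (f x))"
  unfolding ew_def by (intro continuous_intros)

lemma continuous_on_trig [continuous_intros]: "continuous_on A (trig S c)"
  unfolding trig_def by (intro continuous_intros)

lemma borel_measurable_ew [measurable]: "ew k \<in> borel_measurable borel"
  by (intro borel_measurable_continuous_onI continuous_intros)

lemma borel_measurable_trig [measurable]: "trig S c \<in> borel_measurable borel"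
  by (intro borel_measurable_continuous_onI continuous_intros)

section \<open>The frequency lattice and the orthogonality of its characters\<close>

definition lfreq :: "real \<Rightarrow> int \<times> int \<Rightarrow> real^2" where
  "lfreq L n = vector [2 * pi / L * real_of_int (fst n), 2 * pi / L * real_of_int (snd n)]"

lemma lfreq_nth [simp]:
  "lfreq L n $ 1 = 2 * pi / L * real_of_int (fst n)" "lfreq L n $ 2 = 2 * pi / L * real_of_int (snd n)"
  by (simp_all add: lfreq_def)

lemma freq_eq: "freq L = range (lfreq L)"
proof (intro equalityI subsetI)
  fix k assume "k \<in> freq L"
  then obtain a b :: int where "k $ 1 = 2 * pi / L * real_of_int a" "k $ 2 = 2 * pi / L * real_of_int b"
    unfolding freq_def by blast
  then have "k = lfreq L (a, b)" by (simp add: vec_eq_iff forall_2)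
  then show "k \<in> range (lfreq L)" by auto
qed (auto simp: freq_def forall_2)

lemma inj_lfreq: "L > 0 \<Longrightarrow> inj (lfreq L)"
  by (auto simp: inj_on_def vec_eq_iff forall_2)

lemma freq_zero [simp]: "0 \<in> freq L"
  unfolding freq_def by (auto intro!: exI[of _ 0])

lemma freq_add: "k \<in> freq L \<Longrightarrow> l \<in> freq L \<Longrightarrow> k + l \<in> freq L"
proof -
  assume "k \<in> freq L" "l \<in> freq L"
  then obtain m n where "k = lfreq L m" "l = lfreq L n" unfolding freq_eq by blast
  then have "k + l = lfreq L (fst m + fst n, snd m + snd n)"
    by (simp add: vec_eq_iff forall_2 algebra_simps add_divide_distrib)
  then show ?thesis unfolding freq_eq by blast
qed

lemma freq_minus: "k \<in> freq L \<Longrightarrow> - k \<in> freq L"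
proof -
  assume "k \<in> freq L"
  then obtain m where "k = lfreq L m" unfolding freq_eq by blast
  then have "- k = lfreq L (- fst m, - snd m)"
    by (simp add: vec_eq_iff forall_2)
  then show ?thesis unfolding freq_eq by blast
qed

lemma torus_periodic_ew:
  assumes "L > 0" "k \<in> freq L"
  shows "torus_periodic L (ew k)"
  unfolding torus_periodic_def
proof (intro allI)
  fix x :: "real^2" and i :: 2
  obtain m :: int where m: "k $ i = 2 * pi / L * real_of_int m"
    using assms unfolding freq_def by blast
  have "ew k (axis i L) = cis (2 * pi * real_of_int m)"
    using m assms by (simp add: ew_def inner_axis)
  also have "\<dots> = 1" by (rule cis_multiple_2pi) auto
  finally show "ew k (x + axis i L) = ew k x" by (simp add: ew_add)
qed

lemma torus_periodic_trig:
  assumes "L > 0" "S \<subseteq> freq L"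
  shows "torus_periodic L (trig S c)"
  using torus_periodic_ew[OF assms(1)] assms(2)
  unfolding torus_periodic_def trig_def by (auto intro!: sum.cong)

lemma integrable_tm_bounded:
  fixes f :: "real^2 \<Rightarrow> 'b::{banach,second_countable_topology}"
  assumes "L > 0" "f \<in> borel_measurable borel" "\<And>x. norm (f x) \<le> B"
  shows "integrable (tm L) f"
proof -
  interpret prob_space "tm L" by (rule prob_space_tm[OF assms(1)])
  show ?thesis using assms by (intro integrable_const_bound[of _ B]) auto
qed

lemma integrable_ew: "L > 0 \<Longrightarrow> integrable (tm L) (ew k)"
  by (rule integrable_tm_bounded[of _ _ 1]) auto

lemma integral_ew:
  assumes L: "L > 0" and k: "k \<in> freq L"
  shows "(\<integral>x. ew k x \<partial>tm L) = (if k = 0 then 1 else 0)"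
proof (cases "k = 0")
  case True
  interpret prob_space "tm L" by (rule prob_space_tm[OF L])
  show ?thesis using True prob_space by simp
next
  case False
  \<comment> \<open>Shifting by \<open>h\<close> changes the phase by pi, so the shift-invariant
    integral equals its own negative.\<close>
  define h where "h = (pi / (k \<bullet> k)) *\<^sub>R k"
  have "ew k h = -1" using False by (simp add: ew_def h_def cis_pi)
  then have "(\<integral>x. ew k (x + h) \<partial>tm L) = - (\<integral>x. ew k x \<partial>tm L)"
    by (simp add: ew_add)
  moreover have "(\<integral>x. ew k (x + h) \<partial>tm L) = (\<integral>x. ew k x \<partial>tm L)"
    by (rule integral_tm_shift[OF L _ torus_periodic_ew[OF L k] integrable_ew[OF L]]) auto
  ultimately show ?thesis using False by simp
qed

lemma integral_trig_ew:
  assumes L: "L > 0" and S: "finite S" "S \<subseteq> freq L" and k: "k \<in> freq L"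
  shows "(\<integral>x. trig S c x * ew (- k) x \<partial>tm L) = (if k \<in> S then c k else 0)"
proof -
  have "(\<integral>x. trig S c x * ew (- k) x \<partial>tm L) = (\<integral>x. (\<Sum>l\<in>S. c l * ew (l - k) x) \<partial>tm L)"
    unfolding trig_def by (simp add: sum_distrib_right ew_add(2)[symmetric] mult.assoc)
  also have "\<dots> = (\<Sum>l\<in>S. c l * (\<integral>x. ew (l - k) x \<partial>tm L))"
    using L by (subst Bochner_Integration.integral_sum) (auto intro!: integrable_mult_right integrable_ew)
  also have "\<dots> = (\<Sum>l\<in>S. if l = k then c l else 0)"
  proof (rule sum.cong)
    fix l assume "l \<in> S"
    then have "l - k \<in> freq L" using S k freq_add[of l L "- k"] freq_minus[of k L] by auto
    then show "c l * (\<integral>x. ew (l - k) x \<partial>tm L) = (if l = k then c l else 0)"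
      using integral_ew[OF L, of "l - k"] by auto
  qed simp
  also have "\<dots> = (if k \<in> S then c k else 0)" using S by (simp add: sum.delta)
  finally show ?thesis .
qed

lemma fcoeff_tm:
  assumes "L > 0" and [measurable]: "f \<in> borel_measurable borel"
  shows "fcoeff L f k = (\<integral>x. complex_of_real (f x) * ew (- k) x \<partial>tm L)"
  unfolding fcoeff_def ew_exp_minus using assms(1) by (subst torus_avg_tm) auto

lemma finite_freq_ball:
  assumes "L > 0" shows "finite {k \<in> freq L. norm k \<le> r}"
proof -
  define B where "B = \<lceil>r * L / (2 * pi)\<rceil>"
  have "{k \<in> freq L. norm k \<le> r} \<subseteq> lfreq L ` ({-B..B} \<times> {-B..B})"
  proof
    fix k assume "k \<in> {k \<in> freq L. norm k \<le> r}"
    then obtain n where n: "k = lfreq L n" and r: "norm k \<le> r" unfolding freq_eq by auto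
    have *: "\<bar>m\<bar> \<le> B" if "\<bar>2 * pi / L * real_of_int m\<bar> \<le> r" for m :: int
    proof -
      have "\<bar>real_of_int m\<bar> \<le> r * L / (2 * pi)"
        using that assms by (simp add: abs_mult field_simps)
      then show ?thesis unfolding B_def by linarith
    qed
    have "\<bar>k $ 1\<bar> \<le> r" "\<bar>k $ 2\<bar> \<le> r"
      using r component_le_norm_cart[of k 1] component_le_norm_cart[of k 2] by linarith+
    then have "\<bar>fst n\<bar> \<le> B" "\<bar>snd n\<bar> \<le> B" using * unfolding n by simp_all
    then show "k \<in> lfreq L ` ({-B..B} \<times> {-B..B})"
      unfolding n by (cases n) (auto intro!: imageI)
  qed
  then show ?thesis by (rule finite_subset) auto
qed

text \<open>\<open>S\<close> need only contain the support of the cutoff: the frequency sets used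
  later are balls and annuli, not exact supports.\<close>

lemma freq_cut_eq_trig:
  assumes S: "finite S" "S \<subseteq> freq L" and z: "\<And>k. k \<in> freq L - S \<Longrightarrow> \<psi> k = 0"
  shows "freq_cut L \<psi> f = trig S (\<lambda>k. complex_of_real (\<psi> k) * fcoeff L f k)"
proof
  fix x
  have "freq_cut L \<psi> f x = (\<Sum>\<^sub>\<infinity>k\<in>S. complex_of_real (\<psi> k) * fcoeff L f k * exp (\<i> * complex_of_real (k \<bullet> x)))"
    unfolding freq_cut_def using assms by (intro infsum_cong_neutral) auto
  then show "freq_cut L \<psi> f x = trig S (\<lambda>k. complex_of_real (\<psi> k) * fcoeff L f k) x"
    using S by (simp add: trig_def ew_exp)
qed

text \<open>The cube of the normalized L^3 norm, with values in \<open>ennreal\<close> so that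
  estimates carry no integrability side conditions. Keeping the cube avoids roots; sums are then
  treated by weighted Hoelder inequalities in place of the triangle inequality.\<close>

definition N3 :: "real \<Rightarrow> (real^2 \<Rightarrow> 'b::real_normed_vector) \<Rightarrow> ennreal" where
  "N3 L f = (\<integral>\<^sup>+x. ennreal (norm (f x) ^ 3) \<partial>tm L)"

lemma N3_shift:
  assumes "L > 0" "f \<in> borel_measurable borel" "torus_periodic L f"
  shows "N3 L (\<lambda>x. f (x + h)) = N3 L f"
  unfolding N3_def using assms
  by (intro nn_integral_tm_shift[of L "\<lambda>x. ennreal (norm (f x) ^ 3)"]) (auto simp: torus_periodic_def)

lemma norm_trig_le: "norm (trig S c x) \<le> (\<Sum>k\<in>S. norm (c k))"
  unfolding trig_def by (rule order_trans[OF norm_sum]) (simp add: norm_mult)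

lemma N3_trig_torus_norm:
  assumes L: "L > 0"
  shows "N3 L (trig S c) = ennreal (torus_norm L 3 (trig S c) ^ 3)"
proof -
  have i: "integrable (tm L) (\<lambda>x. norm (trig S c x) ^ 3)"
    using L by (intro integrable_tm_bounded[of _ _ "(\<Sum>k\<in>S. norm (c k)) ^ 3"])
      (auto intro!: power_mono norm_trig_le)
  have "torus_avg L (\<lambda>x. norm (trig S c x) powr 3) = (\<integral>x. norm (trig S c x) ^ 3 \<partial>tm L)"
    using L by (subst torus_avg_tm) auto
  moreover have "(\<integral>x. norm (trig S c x) ^ 3 \<partial>tm L) \<ge> 0" by simp
  ultimately have "torus_norm L 3 (trig S c) ^ 3 = (\<integral>x. norm (trig S c x) ^ 3 \<partial>tm L)"
  proof -
    have "(a powr (1 / 3)) ^ 3 = a" if "a \<ge> 0" for a :: real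
      using that by (cases "a = 0") (simp_all add: powr_power)
    then show ?thesis
      using \<open>(\<integral>x. norm (trig S c x) ^ 3 \<partial>tm L) \<ge> 0\<close>
        \<open>torus_avg L (\<lambda>x. norm (trig S c x) powr 3) = (\<integral>x. norm (trig S c x) ^ 3 \<partial>tm L)\<close>
      unfolding torus_norm_def by metis
  qed
  then show ?thesis
    unfolding N3_def using i by (simp add: nn_integral_eq_integral)
qed

lemma incr_trig: "incr h (trig S c) = trig S (\<lambda>k. (ew k h - 1) * c k)"
  unfolding incr_def trig_def by (auto simp: ew_add algebra_simps sum_subtractf)

section \<open>Uniqueness of Fourier coefficients\<close>

text \<open>The lattice is symmetric, so testing against \<open>ew k\<close> instead of
  \<open>ew (- k)\<close> is the same as vanishing of all Fourier coefficients. The class is stable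
  under multiplication by characters, which drives the approximation argument.\<close>

definition null_coeffs :: "real \<Rightarrow> (real^2 \<Rightarrow> complex) set" where
  "null_coeffs L = {F. integrable (tm L) F \<and> (\<forall>k\<in>freq L. (\<integral>x. F x * ew k x \<partial>tm L) = 0)}"

lemma integrable_tm_mult_bounded:
  fixes F G :: "real^2 \<Rightarrow> complex"
  assumes F: "integrable (tm L) F" and [measurable]: "G \<in> borel_measurable borel"
    and B: "\<And>x. norm (G x) \<le> B"
  shows "integrable (tm L) (\<lambda>x. F x * G x)"
proof (rule Bochner_Integration.integrable_bound)
  show "integrable (tm L) (\<lambda>x. norm (F x) * B)" using F by auto
  show "(\<lambda>x. F x * G x) \<in> borel_measurable (tm L)" using F by auto
  have "norm (F x) * norm (G x) \<le> norm (F x) * \<bar>B\<bar>" for x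
    using B[of x] by (intro mult_left_mono) auto
  then show "AE x in tm L. norm (F x * G x) \<le> norm (norm (F x) * B)"
    by (auto simp: norm_mult abs_mult)
qed

lemma null_coeffs_ew:
  assumes F: "F \<in> null_coeffs L" and l: "l \<in> freq L"
  shows "(\<lambda>x. F x * ew l x) \<in> null_coeffs L"
proof -
  have "integrable (tm L) (\<lambda>x. F x * ew l x)"
    using F by (intro integrable_tm_mult_bounded[where B = 1]) (auto simp: null_coeffs_def)
  moreover have "(\<integral>x. F x * ew l x * ew k x \<partial>tm L) = 0" if "k \<in> freq L" for k
    using F freq_add[OF l that] by (auto simp: null_coeffs_def ew_add mult.assoc)
  ultimately show ?thesis by (simp add: null_coeffs_def)
qed

lemma null_coeffs_cmult: "F \<in> null_coeffs L \<Longrightarrow> (\<lambda>x. c * F x) \<in> null_coeffs L"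
  by (simp add: null_coeffs_def mult.assoc)

lemma null_coeffs_add:
  assumes "F \<in> null_coeffs L" "G \<in> null_coeffs L"
  shows "(\<lambda>x. F x + G x) \<in> null_coeffs L"
proof -
  have "integrable (tm L) (\<lambda>x. F x * ew k x)" "integrable (tm L) (\<lambda>x. G x * ew k x)" for k
    using assms by (auto intro!: integrable_tm_mult_bounded[where B = 1] simp: null_coeffs_def)
  then show ?thesis using assms by (simp add: null_coeffs_def distrib_right)
qed

text \<open>Moves the torus into a compact subset of a Euclidean space, where the Stone-Weierstrass
  theorem for real polynomial functions applies. Polynomials in these coordinates are trigonometric
  polynomials in \<open>x\<close>.\<close>

definition torus_emb :: "real \<Rightarrow> real^2 \<Rightarrow> complex \<times> complex" where
  "torus_emb L x = (cis (2 * pi / L * x $ 1), cis (2 * pi / L * x $ 2))"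

lemma continuous_on_torus_emb: "continuous_on A (torus_emb L)"
  unfolding torus_emb_def by (intro continuous_intros)

lemma torus_emb_torus: "torus_emb L x \<in> sphere 0 1 \<times> sphere 0 1"
  by (simp add: torus_emb_def)

text \<open>Induction on the polynomial. \<open>F\<close> stays arbitrary, because the product case
  applies the hypothesis for one factor to \<open>F\<close> already multiplied by the other.\<close>

lemma real_polynomial_null_coeffs:
  assumes "real_polynomial_function q" "L > 0"
  shows "F \<in> null_coeffs L \<Longrightarrow> (\<lambda>x. F x * complex_of_real (q (torus_emb L x))) \<in> null_coeffs L"
  using assms(1)
proof (induction arbitrary: F)
  case (linear q)
  interpret bounded_linear q by fact
  let ?k = "lfreq L (1, 0)" and ?l = "lfreq L (0, 1)"
  have kl: "?k \<in> freq L" "?l \<in> freq L" by (auto simp: freq_eq)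
  have e: "ew ?k x = fst (torus_emb L x)" "ew ?l x = snd (torus_emb L x)" for x
    by (simp_all add: torus_emb_def ew_def inner_vec_def sum_2)
  \<comment> \<open>A real-linear functional on a pair of complex numbers is fixed by its values on
    four real basis vectors.\<close>
  have q: "q (z, w) = Re z * q (1, 0) + Im z * q (\<i>, 0) + Re w * q (0, 1) + Im w * q (0, \<i>)" for z w
  proof -
    have "(z, w) = Re z *\<^sub>R (1, 0) + Im z *\<^sub>R (\<i>, 0) + Re w *\<^sub>R (0, 1) + Im w *\<^sub>R (0, \<i>)"
      by (simp add: complex_eq_iff)
    then show ?thesis by (simp only: add scaleR real_scaleR_def)
  qed
  have re: "complex_of_real (Re z) = (z + cnj z) / 2" "complex_of_real (Im z) = - \<i> * (z - cnj z) / 2" for z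
    by (simp_all add: complex_eq_iff)
  \<comment> \<open>Coefficients obtained by writing real and imaginary parts through z and its
    conjugate; on the unit circle the conjugate is the character of opposite frequency.\<close>
  define a where "a = complex_of_real (q (1, 0)) / 2 - \<i> * complex_of_real (q (\<i>, 0)) / 2"
  define a' where "a' = complex_of_real (q (1, 0)) / 2 + \<i> * complex_of_real (q (\<i>, 0)) / 2"
  define b where "b = complex_of_real (q (0, 1)) / 2 - \<i> * complex_of_real (q (0, \<i>)) / 2"
  define b' where "b' = complex_of_real (q (0, 1)) / 2 + \<i> * complex_of_real (q (0, \<i>)) / 2"
  have "complex_of_real (q (torus_emb L x)) = a * ew ?k x + a' * ew (- ?k) x + b * ew ?l x + b' * ew (- ?l) x" for x
  proof -
    have "q (torus_emb L x) = Re (ew ?k x) * q (1, 0) + Im (ew ?k x) * q (\<i>, 0)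
        + Re (ew ?l x) * q (0, 1) + Im (ew ?l x) * q (0, \<i>)"
      using q[of "fst (torus_emb L x)" "snd (torus_emb L x)"] unfolding e by simp
    then show ?thesis
      by (simp only: of_real_add of_real_mult re cnj_ew a_def a'_def b_def b'_def) (simp add: field_simps)
  qed
  then have "(\<lambda>x. F x * complex_of_real (q (torus_emb L x))) =
    (\<lambda>x. a * (F x * ew ?k x) + a' * (F x * ew (- ?k) x) + b * (F x * ew ?l x) + b' * (F x * ew (- ?l) x))"
    by (simp add: fun_eq_iff algebra_simps)
  then show ?case
    using linear.prems kl by (simp add: null_coeffs_add null_coeffs_cmult null_coeffs_ew freq_minus)
next
  case (const c)
  then show ?case using null_coeffs_cmult[of F L "complex_of_real c"] by (simp add: mult.commute)
next
  case (add f g)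
  then show ?case by (simp add: distrib_left null_coeffs_add)
next
  case (mult f g)
  have "(\<lambda>x. F x * complex_of_real (f (torus_emb L x)) * complex_of_real (g (torus_emb L x))) \<in> null_coeffs L"
    by (intro mult.IH mult.prems)
  then show ?case by (simp add: mult.assoc)
qed

lemma continuous_null_coeffs:
  assumes L: "L > 0" and F: "F \<in> null_coeffs L" and \<psi>: "continuous_on (sphere 0 1 \<times> sphere 0 1) \<psi>"
  shows "(\<integral>x. F x * complex_of_real (\<psi> (torus_emb L x)) \<partial>tm L) = 0"
proof -
  let ?S = "sphere (0::complex) 1 \<times> sphere (0::complex) 1"
  have iF: "integrable (tm L) F" using F by (simp add: null_coeffs_def)
  have ce: "continuous_on UNIV (\<lambda>x. \<phi> (torus_emb L x))" if "continuous_on ?S \<phi>" for \<phi> :: "_ \<Rightarrow> real"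
    by (rule continuous_on_compose2[OF that continuous_on_torus_emb]) (rule image_subsetI, rule torus_emb_torus)
  have int: "integrable (tm L) (\<lambda>x. F x * complex_of_real (\<phi> (torus_emb L x)))" if c: "continuous_on ?S \<phi>" for \<phi>
  proof -
    have "compact (\<phi> ` ?S)" by (intro compact_continuous_image c compact_Times) auto
    then obtain B where B: "\<And>z. z \<in> ?S \<Longrightarrow> norm (\<phi> z) \<le> B"
      using compact_imp_bounded bounded_iff by (metis image_eqI)
    show ?thesis
      using ce[OF c] B[OF torus_emb_torus]
      by (intro integrable_tm_mult_bounded[OF iF, where B = B]) (auto intro!: borel_measurable_continuous_onI continuous_intros)
  qed
  have bound: "norm (\<integral>x. F x * complex_of_real (\<psi> (torus_emb L x)) \<partial>tm L) \<le> e * (\<integral>x. norm (F x) \<partial>tm L)" if e: "e > 0" for e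
  proof -
    obtain q where q: "real_polynomial_function q" "\<And>z. z \<in> ?S \<Longrightarrow> \<bar>\<psi> z - q z\<bar> < e"
      by (rule Stone_Weierstrass_real_polynomial_function[OF _ \<psi> e]) (auto intro!: compact_Times)
    have cq: "continuous_on ?S q"
      using q(1) continuous_on_polymonial_function real_polynomial_function_eq by blast
    have "(\<integral>x. F x * complex_of_real (q (torus_emb L x)) * ew 0 x \<partial>tm L) = 0"
      using real_polynomial_null_coeffs[OF q(1) L F] unfolding null_coeffs_def by (simp del: ew_zero)
    then have "(\<integral>x. F x * complex_of_real (\<psi> (torus_emb L x)) \<partial>tm L)
      = (\<integral>x. F x * complex_of_real (\<psi> (torus_emb L x)) - F x * complex_of_real (q (torus_emb L x)) \<partial>tm L)"
      using int[OF \<psi>] int[OF cq] by simp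
    also have "norm \<dots> \<le> (\<integral>x. norm (F x * complex_of_real (\<psi> (torus_emb L x)) - F x * complex_of_real (q (torus_emb L x))) \<partial>tm L)"
      by (rule integral_norm_bound)
    also have "\<dots> \<le> (\<integral>x. e * norm (F x) \<partial>tm L)"
    proof (rule integral_mono)
      fix x
      have "norm (F x * complex_of_real (\<psi> (torus_emb L x)) - F x * complex_of_real (q (torus_emb L x)))
        = norm (F x) * \<bar>\<psi> (torus_emb L x) - q (torus_emb L x)\<bar>"
        by (simp only: right_diff_distrib[symmetric] of_real_diff[symmetric] norm_mult norm_of_real)
      also have "\<dots> \<le> norm (F x) * e"
        using q(2)[OF torus_emb_torus, of L x] by (intro mult_left_mono) auto
      finally show "norm (F x * complex_of_real (\<psi> (torus_emb L x)) - F x * complex_of_real (q (torus_emb L x))) \<le> e * norm (F x)"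
        by (simp add: mult.commute)
    qed (use iF int[OF \<psi>] int[OF cq] in auto)
    finally show ?thesis by simp
  qed
  have "norm (\<integral>x. F x * complex_of_real (\<psi> (torus_emb L x)) \<partial>tm L) \<le> 0"
  proof (rule field_le_epsilon)
    fix d :: real assume "d > 0"
    \<comment> \<open>The denominator below is \<open>?I + 1\<close>, since the L^1 norm
      \<open>?I\<close> may vanish.\<close>
    let ?I = "\<integral>x. norm (F x) \<partial>tm L"
    have "norm (\<integral>x. F x * complex_of_real (\<psi> (torus_emb L x)) \<partial>tm L) \<le> d / (?I + 1) * ?I"
      using \<open>d > 0\<close> by (intro bound) (auto intro!: divide_pos_pos add_nonneg_pos)
    also have "\<dots> \<le> d"
      using \<open>d > 0\<close> by (simp add: divide_le_eq add_nonneg_pos mult_left_mono)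
    finally show "norm (\<integral>x. F x * complex_of_real (\<psi> (torus_emb L x)) \<partial>tm L) \<le> 0 + d" by simp
  qed
  then show ?thesis by simp
qed

text \<open>Compares a point of the open cell with a point of the closed cell: their coordinates
  differ by strictly less than a period, so the gluing of opposite edges cannot confuse
  them.\<close>

lemma cis_eq_imp_eq:
  assumes "L > 0" "cis (2 * pi / L * a) = cis (2 * pi / L * b)" "\<bar>a - b\<bar> < L"
  shows "a = b"
proof -
  have "cis (2 * pi / L * a - 2 * pi / L * b) = 1"
    unfolding cis_divide[symmetric] assms(2) by simp
  then have "cos (2 * pi / L * a - 2 * pi / L * b) = 1" by (metis cis.simps(1) one_complex.simps(1))
  then obtain n :: int where "2 * pi / L * a - 2 * pi / L * b = of_int n * (2 * pi)"
    using cos_one_2pi_int by auto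
  then have "(2 * pi) * (a - b) = (2 * pi) * (L * of_int n)" using assms(1) by (simp add: field_simps)
  then have n: "a - b = L * of_int n" by simp
  then have "real_of_int \<bar>n\<bar> < 1" using assms by (simp add: abs_mult)
  then have "n = 0" by linarith
  then show ?thesis using n by simp
qed

lemma AE_tm_box:
  assumes "L > 0"
  shows "AE x in tm L. x \<in> box 0 (\<chi> i. L)"
proof -
  have "AE x in lborel. x \<in> torus_cell L \<longrightarrow> x \<in> box 0 (\<chi> i. L)"
    using null_sets_cbox_Diff_box[of 0 "\<chi> i. L"]
    by (intro AE_I'[of "cbox 0 (\<chi> i. L) - box 0 (\<chi> i. L)"]) (auto simp: torus_cell_def)
  then show ?thesis
    unfolding tm_def using assms by (subst AE_density) (auto simp: indicator_def elim!: eventually_mono)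
qed

text \<open>The indicator function of an open subset of the open cell is a limit of continuous
  functions of \<open>torus_emb L x\<close>.\<close>

lemma null_coeffs_integral_open:
  assumes L: "L > 0" and F: "F \<in> null_coeffs L" and U: "open U"
  shows "(\<integral>x. F x * complex_of_real (indicator U x) \<partial>tm L) = 0"
proof -
  let ?c = "cbox 0 (\<chi> i. L) :: (real^2) set" and ?b = "box 0 (\<chi> i. L) :: (real^2) set"
  let ?V = "U \<inter> ?b"
  \<comment> \<open>The complement of \<open>?V\<close> in the closed cell, seen on the torus. Its
    image is compact, hence the distance to it is positive off it. \<open>U\<close> is first cut
    down to the open cell because \<open>torus_emb\<close> identifies opposite edges.\<close>
  define C where "C = torus_emb L ` (?c - ?V)"
  have "compact (?c - ?V)" using U by (intro compact_diff) auto
  \<comment> \<open>A corner never lies in the open cell, so \<open>C\<close> is nonempty; the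
    distance to an empty set would be 0 by convention.\<close>
  moreover have "0 \<in> ?c - ?V" using L by (auto simp: mem_box_cart)
  ultimately have C: "closed C" "C \<noteq> {}"
    unfolding C_def using compact_imp_closed[OF compact_continuous_image[OF continuous_on_torus_emb]] by auto
  \<comment> \<open>Truncated multiples of the distance to \<open>C\<close>: continuous, between 0
    and 1, constantly 0 on \<open>C\<close> and eventually 1 off it.\<close>
  define \<psi> where "\<psi> n z = min 1 (real n * infdist z C)" for n z
  have c: "continuous_on A (\<psi> n)" for A n unfolding \<psi>_def by (intro continuous_intros)
  have lim: "(\<lambda>n. \<psi> n (torus_emb L x)) \<longlonglongrightarrow> indicator U x" if x: "x \<in> ?b" for x
  proof (cases "x \<in> U")
    case True
    have "torus_emb L x \<notin> C"
    proof
      assume "torus_emb L x \<in> C"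
      then obtain y where y: "y \<in> ?c" "y \<notin> ?V" "torus_emb L x = torus_emb L y" unfolding C_def by auto
      have "x $ i = y $ i" for i
      proof (rule cis_eq_imp_eq[OF L])
        show "cis (2 * pi / L * x $ i) = cis (2 * pi / L * y $ i)"
          using y(3) exhaust_2[of i] by (auto simp: torus_emb_def)
        show "\<bar>x $ i - y $ i\<bar> < L"
        proof -
          have "0 < x $ i \<and> x $ i < L" "0 \<le> y $ i \<and> y $ i \<le> L"
            using x y(1) by (simp_all add: mem_box_cart)
          then show ?thesis by linarith
        qed
      qed
      then have "x = y" by (simp add: vec_eq_iff)
      then show False using y x True by auto
    qed
    then have "infdist (torus_emb L x) C > 0"
      using C by (metis in_closed_iff_infdist_zero infdist_nonneg order_le_less)
    then obtain N where N: "real N * infdist (torus_emb L x) C > 1"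
      using reals_Archimedean3 by blast
    have "eventually (\<lambda>n. \<psi> n (torus_emb L x) = 1) sequentially"
    proof (rule eventually_sequentiallyI[of N])
      fix n assume "N \<le> n"
      then have "real N * infdist (torus_emb L x) C \<le> real n * infdist (torus_emb L x) C"
        by (intro mult_right_mono) (auto simp: infdist_nonneg)
      then show "\<psi> n (torus_emb L x) = 1" using N by (simp add: \<psi>_def)
    qed
    then show ?thesis using True by (simp add: tendsto_eventually)
  next
    case False
    have "torus_emb L x \<in> C" unfolding C_def using x False box_subset_cbox by blast
    then show ?thesis using False by (simp add: \<psi>_def)
  qed
  have iF: "integrable (tm L) F" using F by (simp add: null_coeffs_def)
  have [measurable]: "(\<lambda>x. \<psi> n (torus_emb L x)) \<in> borel_measurable borel" for n
    by (intro borel_measurable_continuous_onI continuous_on_compose2[OF c continuous_on_torus_emb]) auto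
  have [measurable]: "U \<in> sets borel" using U by simp
  have "(\<lambda>n. \<integral>x. F x * complex_of_real (\<psi> n (torus_emb L x)) \<partial>tm L) \<longlonglongrightarrow> (\<integral>x. F x * complex_of_real (indicator U x) \<partial>tm L)"
  proof (rule integral_dominated_convergence[where w = "\<lambda>x. norm (F x)"])
    show "AE x in tm L. (\<lambda>n. F x * complex_of_real (\<psi> n (torus_emb L x))) \<longlonglongrightarrow> F x * complex_of_real (indicator U x)"
      using AE_tm_box[OF L] by eventually_elim (intro tendsto_intros lim)
    show "AE x in tm L. norm (F x * complex_of_real (\<psi> n (torus_emb L x))) \<le> norm (F x)" for n
      by (auto simp: norm_mult \<psi>_def infdist_nonneg intro!: mult_left_le)
  qed (use iF in auto)
  moreover have "(\<integral>x. F x * complex_of_real (\<psi> n (torus_emb L x)) \<partial>tm L) = 0" for n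
    by (rule continuous_null_coeffs[OF L F c])
  ultimately have "(\<lambda>n::nat. 0) \<longlonglongrightarrow> (\<integral>x. F x * complex_of_real (indicator U x) \<partial>tm L)"
    by simp
  then show ?thesis by (simp add: LIMSEQ_const_iff)
qed

text \<open>The positive and negative parts of \<open>f\<close> are densities of two finite measures
  that agree on open sets, an intersection-stable generator of the Borel sets, so the measures
  coincide. As \<open>ennreal\<close> sends negative numbers to 0, equality of the densities of
  \<open>f\<close> and \<open>- f\<close> forces \<open>f x = 0\<close>.\<close>

lemma AE_zero_of_integral_open:
  fixes f :: "real^2 \<Rightarrow> real"
  assumes L: "L > 0" and f: "integrable (tm L) f"
    and z: "\<And>U. open U \<Longrightarrow> (\<integral>x. f x * indicator U x \<partial>tm L) = 0"
  shows "AE x in tm L. f x = 0"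
proof -
  interpret prob_space "tm L" by (rule prob_space_tm[OF L])
  have [measurable]: "f \<in> borel_measurable borel" using borel_measurable_integrable[OF f] by simp
  define P where "P = density (tm L) (\<lambda>x. ennreal (f x))"
  define N where "N = density (tm L) (\<lambda>x. ennreal (- f x))"
  have eP: "emeasure P U = (\<integral>\<^sup>+x. ennreal (f x * indicator U x) \<partial>tm L)"
    and eN: "emeasure N U = (\<integral>\<^sup>+x. ennreal (- (f x * indicator U x)) \<partial>tm L)" if "U \<in> sets borel" for U
    using that unfolding P_def N_def
    by (auto simp: emeasure_density intro!: nn_integral_cong split: split_indicator)
  have fin: "emeasure P U < \<infinity>" "emeasure N U < \<infinity>" "emeasure P U = emeasure N U" if "open U" for U
  proof -
    have U: "U \<in> sets borel" using that by simp
    have i: "integrable (tm L) (\<lambda>x. f x * indicator U x)" using f U by (intro integrable_real_mult_indicator) auto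
    show *: "emeasure P U < \<infinity>" "emeasure N U < \<infinity>"
      using i unfolding eP[OF U] eN[OF U] real_integrable_def by (auto simp: top.not_eq_extremum)
    have "enn2real (emeasure P U) = enn2real (emeasure N U)"
      using z[OF that] real_lebesgue_integral_def[OF i] eP[OF U] eN[OF U] by simp
    then show "emeasure P U = emeasure N U"
      using * by (metis ennreal_enn2real infinity_ennreal_def)
  qed
  have "P = N"
  proof (rule measure_eqI_generator_eq[where E = "{S. open S}" and \<Omega> = UNIV and A = "\<lambda>_. UNIV"])
    show "sets P = sigma_sets UNIV {S. open S}" "sets N = sigma_sets UNIV {S. open S}"
      by (simp_all add: P_def N_def borel_def)
    show "emeasure P UNIV \<noteq> \<infinity>" for i :: nat using fin(1)[of UNIV] by simp
  qed (use fin(3) in \<open>auto simp: Int_stable_def\<close>)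
  then have "AE x in tm L. ennreal (f x) = ennreal (- f x)"
    unfolding P_def N_def by (intro density_unique) auto
  then show ?thesis
  proof eventually_elim
    case (elim x)
    then show "f x = 0" by (cases "f x \<ge> 0") (auto simp: ennreal_neg)
  qed
qed

theorem null_coeffs_AE_zero:
  assumes L: "L > 0" and F: "F \<in> null_coeffs L"
  shows "AE x in tm L. F x = 0"
proof -
  have iF: "integrable (tm L) F" using F by (simp add: null_coeffs_def)
  have c: "complex_integrable (tm L) (\<lambda>x. F x * complex_of_real (indicator U x))" if "open U" for U
    using that by (intro integrable_tm_mult_bounded[OF iF, where B = 1]) auto
  have "(\<integral>x. Re (F x) * indicator U x \<partial>tm L) = 0" "(\<integral>x. Im (F x) * indicator U x \<partial>tm L) = 0" if "open U" for U
    using null_coeffs_integral_open[OF L F that] integral_Re[OF c[OF that]] integral_Im[OF c[OF that]] by simp_all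
  then have "AE x in tm L. Re (F x) = 0" "AE x in tm L. Im (F x) = 0"
    using iF by (auto intro!: AE_zero_of_integral_open[OF L])
  then show ?thesis by eventually_elim (simp add: complex_eq_iff)
qed

section \<open>A discrete multiplier theorem\<close>

text \<open>Trigonometric polynomials are evaluated on a grid of \<open>Q\<close> points per period, on which
  characters of frequency less than \<open>Q\<close> are exactly orthogonal.\<close>

definition ec :: "nat \<Rightarrow> int \<Rightarrow> nat \<Rightarrow> complex" where
  "ec Q n q = cis (2 * pi * real_of_int n * real q / real Q)"

lemma ec_add: "ec Q (m + n) q = ec Q m q * ec Q n q"
  by (simp add: ec_def cis_mult add_divide_distrib algebra_simps)

lemma cnj_ec: "cnj (ec Q n q) = ec Q (- n) q"
  by (simp add: ec_def cis_cnj)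

lemma norm_ec [simp]: "norm (ec Q n q) = 1"
  by (simp add: ec_def)

lemma sum_ec:
  assumes "\<bar>n\<bar> < int Q"
  shows "(\<Sum>q<Q. ec Q n q) = (if n = 0 then of_nat Q else 0)"
proof (cases "n = 0")
  case False
  define z where "z = cis (2 * pi * real_of_int n / real Q)"
  have Q: "Q > 0" using assms by auto
  have z: "ec Q n q = z ^ q" for q
  proof -
    have "z ^ q = cis (real q * (2 * pi * real_of_int n / real Q))" unfolding z_def by (rule Complex.DeMoivre)
    then show ?thesis by (simp add: ec_def mult_ac)
  qed
  have "z ^ Q = cis (2 * pi * real_of_int n)" using Q by (simp add: z_def Complex.DeMoivre)
  also have "\<dots> = 1" by (rule cis_multiple_2pi) auto
  finally have zQ: "z ^ Q = 1" .
  have "z \<noteq> 1"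
  proof
    assume "z = 1"
    then have "cos (2 * pi * real_of_int n / real Q) = 1" unfolding z_def by (metis cis.simps(1) one_complex.simps(1))
    then obtain m :: int where "2 * pi * real_of_int n / real Q = of_int m * (2 * pi)"
      using cos_one_2pi_int by auto
    then have "(2 * pi) * real_of_int n = (2 * pi) * (real_of_int m * real Q)" using Q by (simp add: field_simps)
    then have "real_of_int n = real_of_int (m * int Q)" by simp
    then have "n = m * int Q" by (simp only: of_int_eq_iff)
    then have "\<bar>m\<bar> * int Q < 1 * int Q" "m \<noteq> 0" using assms False by (auto simp: abs_mult)
    then show False using Q by (simp add: mult_less_cancel_right)
  qed
  then show ?thesis using False zQ by (simp add: z geometric_sum)
qed (simp add: ec_def)

definition E2 :: "nat \<Rightarrow> int \<times> int \<Rightarrow> nat \<times> nat \<Rightarrow> complex" where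
  "E2 Q n q = ec Q (fst n) (fst q) * ec Q (snd n) (snd q)"

lemma E2_add: "E2 Q (m + n) q = E2 Q m q * E2 Q n q"
  by (simp add: E2_def ec_add)

lemma cnj_E2: "cnj (E2 Q n q) = E2 Q (- n) q"
  by (simp add: E2_def cnj_ec)

lemma norm_E2 [simp]: "norm (E2 Q n q) = 1"
  by (simp add: E2_def norm_mult)

abbreviation grid :: "nat \<Rightarrow> (nat \<times> nat) set" where
  "grid Q \<equiv> {..<Q} \<times> {..<Q}"

lemma sum_E2:
  assumes "\<bar>fst n\<bar> < int Q" "\<bar>snd n\<bar> < int Q"
  shows "(\<Sum>q\<in>grid Q. E2 Q n q) = (if n = 0 then (of_nat Q)\<^sup>2 else 0)"
proof -
  have "(\<Sum>q\<in>grid Q. E2 Q n q) = (\<Sum>a<Q. ec Q (fst n) a) * (\<Sum>b<Q. ec Q (snd n) b)"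
    by (simp add: E2_def sum_product sum.cartesian_product split_def)
  then show ?thesis
    using sum_ec[OF assms(1)] sum_ec[OF assms(2)] by (auto simp: power2_eq_square zero_prod_def prod_eq_iff)
qed

text \<open>The hypothesis \<open>sep\<close> excludes aliasing: no two distinct frequencies of
  \<open>S\<close> are congruent modulo \<open>Q\<close> in both coordinates.\<close>

lemma discrete_Parseval:
  assumes S: "finite S" and sep: "\<And>m n. m \<in> S \<Longrightarrow> n \<in> S \<Longrightarrow> \<bar>fst m - fst n\<bar> < int Q \<and> \<bar>snd m - snd n\<bar> < int Q"
  shows "(\<Sum>q\<in>grid Q. (cmod (\<Sum>n\<in>S. b n * E2 Q n q))\<^sup>2) = (real Q)\<^sup>2 * (\<Sum>n\<in>S. (cmod (b n))\<^sup>2)"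
proof -
  have "complex_of_real (\<Sum>q\<in>grid Q. (cmod (\<Sum>n\<in>S. b n * E2 Q n q))\<^sup>2)
      = (\<Sum>q\<in>grid Q. (\<Sum>m\<in>S. b m * E2 Q m q) * cnj (\<Sum>n\<in>S. b n * E2 Q n q))"
    by (simp only: of_real_sum complex_norm_square)
  also have "\<dots> = (\<Sum>q\<in>grid Q. \<Sum>m\<in>S. \<Sum>n\<in>S. (b m * cnj (b n)) * E2 Q (m - n) q)"
    using E2_add[of Q m "- n" for m n] by (simp add: sum_product cnj_E2 mult_ac)
  also have "\<dots> = (\<Sum>m\<in>S. \<Sum>n\<in>S. \<Sum>q\<in>grid Q. (b m * cnj (b n)) * E2 Q (m - n) q)"
    by (subst sum.swap, rule sum.cong[OF refl], rule sum.swap)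
  also have "\<dots> = (\<Sum>m\<in>S. \<Sum>n\<in>S. if m = n then (b m * cnj (b n)) * (of_nat Q)\<^sup>2 else 0)"
    using sep by (intro sum.cong refl) (simp add: sum_distrib_left[symmetric] sum_E2)
  also have "\<dots> = (\<Sum>m\<in>S. (b m * cnj (b m)) * (of_nat Q)\<^sup>2)"
    using S by (simp add: sum.delta)
  also have "\<dots> = complex_of_real ((real Q)\<^sup>2 * (\<Sum>n\<in>S. (cmod (b n))\<^sup>2))"
    by (simp only: complex_norm_square[symmetric] of_real_mult of_real_sum of_real_power of_real_of_nat_eq sum_distrib_left mult.commute)
  finally show ?thesis by (simp only: of_real_eq_iff)
qed

abbreviation ibox :: "int \<Rightarrow> (int \<times> int) set" where
  "ibox K \<equiv> {-K..K} \<times> {-K..K}"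

text \<open>Summation by parts: multiplying the kernel by a character minus 1 differences its
  coefficients. The margin of one between the support and \<open>ibox K\<close> keeps the shifted
  coefficients inside the box.\<close>

lemma E2_difference:
  assumes z: "\<And>n. n \<notin> ibox (K - 1) \<Longrightarrow> a n = 0"
  shows "(ec Q 1 (fst q) - 1) * (\<Sum>n\<in>ibox K. a n * E2 Q n q) = (\<Sum>n\<in>ibox K. (a (n - (1, 0)) - a n) * E2 Q n q)"
    and "(ec Q 1 (snd q) - 1) * (\<Sum>n\<in>ibox K. a n * E2 Q n q) = (\<Sum>n\<in>ibox K. (a (n - (0, 1)) - a n) * E2 Q n q)"
proof -
  have shift: "(\<Sum>n\<in>ibox K. a n * E2 Q (n + d) q) = (\<Sum>n\<in>ibox K. a (n - d) * E2 Q n q)"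
    if d: "d = (1, 0) \<or> d = (0, 1)" for d
  proof -
    have "(\<Sum>n\<in>ibox K. a n * E2 Q (n + d) q) = (\<Sum>n\<in>ibox (K - 1). a n * E2 Q (n + d) q)"
      using z by (intro sum.mono_neutral_right) auto
    also have "\<dots> = (\<Sum>n\<in>(\<lambda>n. n + d) ` ibox (K - 1). a (n - d) * E2 Q n q)"
      by (subst sum.reindex) (auto simp: inj_on_def)
    also have "\<dots> = (\<Sum>n\<in>ibox K. a (n - d) * E2 Q n q)"
    proof (rule sum.mono_neutral_left)
      show "(\<lambda>n. n + d) ` ibox (K - 1) \<subseteq> ibox K" using d by auto
      show "\<forall>n\<in>ibox K - (\<lambda>n. n + d) ` ibox (K - 1). a (n - d) * E2 Q n q = 0"
      proof
        fix n assume "n \<in> ibox K - (\<lambda>n. n + d) ` ibox (K - 1)"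
        then have "n - d \<notin> ibox (K - 1)" by (metis DiffD2 diff_add_cancel image_eqI)
        then show "a (n - d) * E2 Q n q = 0" using z by simp
      qed
    qed auto
    finally show ?thesis .
  qed
  have "ec Q 1 (fst q) * E2 Q n q = E2 Q (n + (1, 0)) q" "ec Q 1 (snd q) * E2 Q n q = E2 Q (n + (0, 1)) q" for n
    unfolding E2_add by (simp_all add: E2_def ec_def)
  then have "ec Q 1 (fst q) * (\<Sum>n\<in>ibox K. a n * E2 Q n q) = (\<Sum>n\<in>ibox K. a n * E2 Q (n + (1, 0)) q)"
    "ec Q 1 (snd q) * (\<Sum>n\<in>ibox K. a n * E2 Q n q) = (\<Sum>n\<in>ibox K. a n * E2 Q (n + (0, 1)) q)"
    by (simp_all add: sum_distrib_left mult.left_commute)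
  then show "(ec Q 1 (fst q) - 1) * (\<Sum>n\<in>ibox K. a n * E2 Q n q) = (\<Sum>n\<in>ibox K. (a (n - (1, 0)) - a n) * E2 Q n q)"
    "(ec Q 1 (snd q) - 1) * (\<Sum>n\<in>ibox K. a n * E2 Q n q) = (\<Sum>n\<in>ibox K. (a (n - (0, 1)) - a n) * E2 Q n q)"
    using shift[of "(1, 0)"] shift[of "(0, 1)"] by (simp_all add: left_diff_distrib sum_subtractf)
qed

section \<open>Summability of the inverse weight on the grid\<close>

lemma one_minus_cos_ge:
  assumes "0 \<le> t" "t \<le> pi"
  shows "1 - cos t \<ge> 2 * t\<^sup>2 / pi\<^sup>2"
proof -
  \<comment> \<open>Jordan's inequality for the sine: on [0, pi/2] the graph lies above its chord.
    The half-angle formula then squares it.\<close>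
  have concave: "concave_on {0..pi/2} sin"
  proof (rule f''_le0_imp_concave[where f' = cos and f'' = "\<lambda>x. - sin x"])
    show "- sin x \<le> 0" if "x \<in> {0..pi/2}" for x :: real
      using that sin_ge_zero[of x] by simp
  qed (auto intro!: derivative_eq_intros)
  have s: "sin (t / 2) \<ge> t / pi"
  proof -
    have "sin ((1 - t / pi) *\<^sub>R 0 + (t / pi) *\<^sub>R (pi / 2)) \<ge> (1 - t / pi) * sin 0 + (t / pi) * sin (pi / 2)"
      using assms by (intro concave_onD[OF concave]) auto
    then show ?thesis by simp
  qed
  have "1 - cos t = 2 * (sin (t / 2))\<^sup>2"
    using cos_double_sin[of "t / 2"] by simp
  also have "\<dots> \<ge> 2 * (t / pi)\<^sup>2"
    using s assms by (intro mult_left_mono power_mono) auto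
  finally show ?thesis by (simp add: power_divide)
qed

text \<open>The squared chord length is 2 - 2 cos of the angle, and the angle is measured to the
  nearer of 0 and 2 pi, whence the minimum. The constant is 2 * 2 * (2 pi)^2 / pi^2 = 16.\<close>

lemma norm_ec_1_minus_1:
  assumes "Q > 0" "q < Q"
  shows "(cmod (ec Q 1 q - 1))\<^sup>2 \<ge> 16 * (real (min q (Q - q)) / real Q)\<^sup>2"
proof -
  let ?t = "2 * pi * real q / real Q" and ?u = "2 * pi * real (Q - q) / real Q"
  have n: "(cmod (ec Q 1 q - 1))\<^sup>2 = 2 - 2 * cos ?t"
  proof -
    have "(cmod (ec Q 1 q - 1))\<^sup>2 = (cos ?t - 1)\<^sup>2 + (sin ?t)\<^sup>2"
      by (simp add: ec_def cmod_power2)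
    then show ?thesis using sin_cos_squared_add[of ?t] by (simp only: power2_diff) simp
  qed
  have tu: "?u = 2 * pi - ?t" using assms by (simp add: of_nat_diff field_simps)
  have "cos ?u = cos ?t" unfolding tu by (simp add: cos_2pi_minus)
  have 16: "2 * (2 * (2 * pi * x / real Q)\<^sup>2 / pi\<^sup>2) = 16 * (x / real Q)\<^sup>2" for x
    by (simp add: power2_eq_square)
  show ?thesis
  proof (cases "2 * q \<le> Q")
    case True
    then have "real (2 * q) \<le> real Q" by (simp only: of_nat_le_iff)
    then have "?t \<le> pi" using assms by (simp add: field_simps)
    then have "1 - cos ?t \<ge> 2 * ?t\<^sup>2 / pi\<^sup>2" by (intro one_minus_cos_ge) auto
    moreover have "min q (Q - q) = q" using True by simp
    ultimately show ?thesis using n 16[of "real q"] by simp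
  next
    case False
    then have "real (2 * (Q - q)) \<le> real Q" by (simp only: of_nat_le_iff)
    then have "?u \<le> pi" using assms by (simp add: field_simps)
    then have "1 - cos ?u \<ge> 2 * ?u\<^sup>2 / pi\<^sup>2" by (intro one_minus_cos_ge) auto
    moreover have "min q (Q - q) = Q - q" using False by simp
    ultimately show ?thesis using n 16[of "real (Q - q)"] \<open>cos ?u = cos ?t\<close> by simp
  qed
qed

text \<open>Comparison with the integral of 1 / (1 + x^2): each term after the first is at most a
  difference quotient of the arctangent, and these telescope to at most pi / (2 c).\<close>

lemma sum_inverse_square_le:
  assumes c: "c > 0"
  shows "(\<Sum>q<Q. 1 / (1 + (c * real q)\<^sup>2)) \<le> 1 + pi / (2 * c)"
proof (cases Q)
  case (Suc P)
  have step: "1 / (1 + (c * real (Suc q))\<^sup>2) \<le> (arctan (c * real (Suc q)) - arctan (c * real q)) / c" for q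
  proof -
    have "c * real q < c * real (Suc q)" using c by simp
    moreover have "\<And>x. DERIV arctan x :> inverse (1 + x\<^sup>2)" by (rule DERIV_arctan)
    ultimately obtain z where z: "c * real q < z" "z < c * real (Suc q)"
      "arctan (c * real (Suc q)) - arctan (c * real q) = (c * real (Suc q) - c * real q) * inverse (1 + z\<^sup>2)"
      using MVT2[of "c * real q" "c * real (Suc q)" arctan "\<lambda>x. inverse (1 + x\<^sup>2)"] by metis
    have "0 \<le> z" using z(1) c by (meson less_eq_real_def mult_nonneg_nonneg of_nat_0_le_iff order_trans)
    then have "z\<^sup>2 \<le> (c * real (Suc q))\<^sup>2" using z by (intro power_mono) auto
    then have "1 / (1 + (c * real (Suc q))\<^sup>2) \<le> inverse (1 + z\<^sup>2)"
      by (simp add: inverse_eq_divide frac_le add_pos_nonneg)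
    also have "\<dots> = (arctan (c * real (Suc q)) - arctan (c * real q)) / c"
      unfolding z(3) using c by (simp add: algebra_simps)
    finally show ?thesis .
  qed
  have "(\<Sum>q<Q. 1 / (1 + (c * real q)\<^sup>2)) = 1 + (\<Sum>q<P. 1 / (1 + (c * real (Suc q))\<^sup>2))"
    unfolding Suc by (subst sum.lessThan_Suc_shift) simp
  also have "\<dots> \<le> 1 + (\<Sum>q<P. (arctan (c * real (Suc q)) - arctan (c * real q)) / c)"
    by (intro add_left_mono sum_mono step)
  also have "(\<Sum>q<P. (arctan (c * real (Suc q)) - arctan (c * real q)) / c) = arctan (c * real P) / c"
    unfolding sum_divide_distrib[symmetric] by (subst sum_lessThan_telescope) simp
  also have "\<dots> \<le> (pi / 2) / c" using c arctan_bounded[of "c * real P"] by (intro divide_right_mono) auto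
  finally show ?thesis by simp
qed (use c in auto)

lemma sum_weight_le:
  assumes N: "N > 0" and Q: "N \<le> real Q"
  shows "(\<Sum>q<Q. 1 / (1 + N\<^sup>2 * (cmod (ec Q 1 q - 1))\<^sup>2)) \<le> 3 * real Q / N"
proof -
  have Q0: "Q > 0" using N Q by (cases Q) auto
  \<comment> \<open>Chosen so that \<open>(c * x)^2\<close> equals \<open>N^2\<close> times the
    lower bound \<open>16 * (x / Q)^2\<close> for the chord.\<close>
  define c where "c = 4 * N / real Q"
  have c: "c > 0" using N Q0 by (simp add: c_def)
  let ?f = "\<lambda>q::nat. 1 / (1 + (c * real q)\<^sup>2)"
  \<comment> \<open>The term at the minimum of \<open>q\<close> and \<open>Q - q\<close> is bounded
    by the sum of both terms, which gives two one-sided sums. \<open>Q - q\<close> is written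
    \<open>Suc (Q - Suc q)\<close> to fit the reversal lemma for sums.\<close>
  have "(\<Sum>q<Q. 1 / (1 + N\<^sup>2 * (cmod (ec Q 1 q - 1))\<^sup>2)) \<le> (\<Sum>q<Q. ?f q + ?f (Suc (Q - Suc q)))"
  proof (rule sum_mono)
    fix q assume "q \<in> {..<Q}"
    then have q: "q < Q" "Suc (Q - Suc q) = Q - q" by auto
    have "(c * real (min q (Q - q)))\<^sup>2 = N\<^sup>2 * (16 * (real (min q (Q - q)) / real Q)\<^sup>2)"
      by (simp add: c_def power2_eq_square)
    also have "\<dots> \<le> N\<^sup>2 * (cmod (ec Q 1 q - 1))\<^sup>2"
      using norm_ec_1_minus_1[OF Q0 q(1)] by (intro mult_left_mono) auto
    finally have "1 / (1 + N\<^sup>2 * (cmod (ec Q 1 q - 1))\<^sup>2) \<le> ?f (min q (Q - q))"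
      by (intro divide_left_mono) (auto intro!: mult_pos_pos add_pos_nonneg)
    also have "\<dots> \<le> ?f q + ?f (Q - q)"
      by (cases "q \<le> Q - q") (simp_all add: min_def)
    finally show "1 / (1 + N\<^sup>2 * (cmod (ec Q 1 q - 1))\<^sup>2) \<le> ?f q + ?f (Suc (Q - Suc q))"
      using q(2) by simp
  qed
  also have "\<dots> = (\<Sum>q<Q. ?f q) + (\<Sum>q<Q. ?f (Suc q))"
    by (simp only: sum.distrib sum.nat_diff_reindex[of "\<lambda>i. ?f (Suc i)"])
  also have "(\<Sum>q<Q. ?f (Suc q)) \<le> pi / (2 * c)"
    using sum_inverse_square_le[OF c, of "Suc Q"] by (simp add: sum.lessThan_Suc_shift del: sum.lessThan_Suc)
  also have "(\<Sum>q<Q. ?f q) \<le> 1 + pi / (2 * c)" by (rule sum_inverse_square_le[OF c])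
  also have "1 + pi / (2 * c) + pi / (2 * c) = 1 + (pi / 4) * (real Q / N)"
    using N Q0 by (simp add: c_def field_simps)
  also have "\<dots> \<le> real Q / N + 2 * (real Q / N)"
    using N Q pi_less_4 by (intro add_mono mult_right_mono) auto
  finally show ?thesis by simp
qed

text \<open>Hoelder with exponents 3/2 and 3, from two applications of Cauchy-Schwarz: with X, W, Y,
  Z the sums named below, X^2 \<le> W Z and Z^2 \<le> X Y, so X^4 \<le> W^2 X Y, and one factor X
  cancels.\<close>

lemma sum_weighted_cube_le:
  fixes w z :: "'i \<Rightarrow> real"
  assumes "\<And>i. i \<in> I \<Longrightarrow> 0 \<le> w i" "\<And>i. i \<in> I \<Longrightarrow> 0 \<le> z i"
  shows "(\<Sum>i\<in>I. w i * z i) ^ 3 \<le> (\<Sum>i\<in>I. w i)\<^sup>2 * (\<Sum>i\<in>I. w i * z i ^ 3)"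
proof -
  let ?X = "\<Sum>i\<in>I. w i * z i" and ?W = "\<Sum>i\<in>I. w i" and ?Y = "\<Sum>i\<in>I. w i * z i ^ 3" and ?Z = "\<Sum>i\<in>I. w i * (z i)\<^sup>2"
  have nn: "?X \<ge> 0" "?W \<ge> 0" "?Y \<ge> 0" "?Z \<ge> 0" using assms by (auto intro!: sum_nonneg mult_nonneg_nonneg)
  have 1: "?X\<^sup>2 \<le> ?W * ?Z"
  proof -
    have "?X = (\<Sum>i\<in>I. sqrt (w i) * (sqrt (w i) * z i))"
      using assms by (intro sum.cong) (auto simp: mult.assoc[symmetric])
    also have "\<dots>\<^sup>2 \<le> (\<Sum>i\<in>I. (sqrt (w i))\<^sup>2) * (\<Sum>i\<in>I. (sqrt (w i) * z i)\<^sup>2)" by (rule Cauchy_Schwarz_ineq_sum)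
    also have "\<dots> = ?W * ?Z"
      using assms by (intro arg_cong2[where f = "(*)"] sum.cong) (auto simp: power_mult_distrib)
    finally show ?thesis .
  qed
  have 2: "?Z\<^sup>2 \<le> ?X * ?Y"
  proof -
    have "?Z = (\<Sum>i\<in>I. sqrt (w i * z i) * (sqrt (w i * z i) * z i))"
      using assms by (intro sum.cong) (auto simp: mult.assoc[symmetric] power2_eq_square)
    also have "\<dots>\<^sup>2 \<le> (\<Sum>i\<in>I. (sqrt (w i * z i))\<^sup>2) * (\<Sum>i\<in>I. (sqrt (w i * z i) * z i)\<^sup>2)" by (rule Cauchy_Schwarz_ineq_sum)
    also have "\<dots> = ?X * ?Y"
      using assms by (intro arg_cong2[where f = "(*)"] sum.cong) (auto simp: power_mult_distrib power2_eq_square power3_eq_cube)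
    finally show ?thesis .
  qed
  show ?thesis
  proof (cases "?X = 0")
    case True
    then show ?thesis using nn by simp
  next
    case False
    then have X: "?X > 0" using nn by simp
    have "?X * ?X ^ 3 = (?X\<^sup>2)\<^sup>2" by (simp add: power2_eq_square power3_eq_cube)
    also have "\<dots> \<le> (?W * ?Z)\<^sup>2" using 1 by (intro power_mono) auto
    also have "\<dots> = ?W\<^sup>2 * ?Z\<^sup>2" by (simp add: power_mult_distrib)
    also have "\<dots> \<le> ?W\<^sup>2 * (?X * ?Y)" using 2 by (intro mult_left_mono) auto
    finally have "?X * ?X ^ 3 \<le> ?X * (?W\<^sup>2 * ?Y)" by (simp add: mult_ac)
    then show ?thesis using X by (simp add: mult_le_cancel_left_pos)
  qed
qed

text \<open>Young's inequality for a finite convolution: the sum of the absolute weights bounds the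
  operator norm, because the L^3 norm is translation invariant.\<close>

lemma N3_sum_shift_le:
  assumes L: "L > 0" and [measurable]: "P \<in> borel_measurable borel" and per: "torus_periodic L P" and I: "finite I"
  shows "N3 L (\<lambda>x. \<Sum>i\<in>I. (c i :: complex) * P (x + y i)) \<le> ennreal ((\<Sum>i\<in>I. cmod (c i)) ^ 3) * N3 L P"
proof -
  let ?W = "\<Sum>i\<in>I. cmod (c i)"
  have W: "?W \<ge> 0" by (intro sum_nonneg) auto
  have "N3 L (\<lambda>x. \<Sum>i\<in>I. c i * P (x + y i))
    \<le> (\<integral>\<^sup>+x. ennreal (?W\<^sup>2) * (\<Sum>i\<in>I. ennreal (cmod (c i)) * ennreal (norm (P (x + y i)) ^ 3)) \<partial>tm L)"
    unfolding N3_def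
  proof (rule nn_integral_mono)
    fix x
    have "norm (\<Sum>i\<in>I. c i * P (x + y i)) ^ 3 \<le> (\<Sum>i\<in>I. cmod (c i) * norm (P (x + y i))) ^ 3"
      by (intro power_mono order_trans[OF norm_sum]) (auto simp: norm_mult)
    also have "\<dots> \<le> ?W\<^sup>2 * (\<Sum>i\<in>I. cmod (c i) * norm (P (x + y i)) ^ 3)"
      by (rule sum_weighted_cube_le) auto
    finally show "ennreal (norm (\<Sum>i\<in>I. c i * P (x + y i)) ^ 3)
      \<le> ennreal (?W\<^sup>2) * (\<Sum>i\<in>I. ennreal (cmod (c i)) * ennreal (norm (P (x + y i)) ^ 3))"
      by (simp add: ennreal_mult[symmetric] sum_nonneg ennreal_leI)
  qed
  also have "\<dots> = ennreal (?W\<^sup>2) * (\<Sum>i\<in>I. ennreal (cmod (c i)) * N3 L (\<lambda>x. P (x + y i)))"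
    by (simp add: nn_integral_cmult nn_integral_sum N3_def)
  also have "\<dots> = ennreal (?W\<^sup>2) * (\<Sum>i\<in>I. ennreal (cmod (c i)) * N3 L P)"
    using N3_shift[OF L _ per] by simp
  also have "\<dots> = ennreal (?W ^ 3) * N3 L P"
  proof -
    have "(\<Sum>i\<in>I. ennreal (cmod (c i)) * N3 L P) = ennreal ?W * N3 L P"
      by (simp add: sum_distrib_right[symmetric] sum_ennreal)
    then show ?thesis
      using W by (simp add: power3_eq_cube power2_eq_square ennreal_mult mult_ac)
  qed
  finally show ?thesis .
qed

text \<open>Bounds an l^1 norm by Cauchy-Schwarz against the product weight
  \<open>w (fst q) * w (snd q)\<close>: the inverse weight is summable over the grid, and the
  weighted l^2 norm is computed by Parseval from differences of \<open>a\<close>. The support is in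
  \<open>ibox (K - 2)\<close> because the mixed difference widens it by one in each direction and
  \<open>E2_difference\<close> wants a further margin. When \<open>2 * K + 1\<close> is of order
  \<open>N\<close>, the bound is of order \<open>A\<close> times the number of grid points.\<close>

lemma sum_cmod_kernel_le:
  assumes z: "\<And>n. n \<notin> ibox (K - 2) \<Longrightarrow> a n = 0" and K: "K \<ge> 2" and N: "N > 0"
    and Q: "N \<le> real Q" "2 * K < int Q"
    and A: "\<And>n. cmod (a n) \<le> A" "\<And>n. N * cmod (a (n - (1, 0)) - a n) \<le> A" "\<And>n. N * cmod (a (n - (0, 1)) - a n) \<le> A"
      "\<And>n. N\<^sup>2 * cmod (a (n - (0, 1) - (1, 0)) - a (n - (0, 1)) - (a (n - (1, 0)) - a n)) \<le> A"
  shows "(\<Sum>q\<in>grid Q. cmod (\<Sum>n\<in>ibox K. a n * E2 Q n q)) \<le> 6 * A * (2 * real_of_int K + 1) * (real Q)\<^sup>2 / N"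
proof -
  define H where "H q = (\<Sum>n\<in>ibox K. a n * E2 Q n q)" for q
  define w where "w q = 1 + N\<^sup>2 * (cmod (ec Q 1 q - 1))\<^sup>2" for q
  have w: "w q \<ge> 1" for q by (simp add: w_def)
  have A0: "A \<ge> 0" using A(1)[of 0] norm_ge_zero order_trans by blast
  define a1 where "a1 n = a (n - (1, 0)) - a n" for n
  define a2 where "a2 n = a (n - (0, 1)) - a n" for n
  define a12 where "a12 n = a1 (n - (0, 1)) - a1 n" for n
  have z1: "a1 n = 0" if "n \<notin> ibox (K - 1)" for n
  proof -
    have "n \<notin> ibox (K - 2)" "n - (1, 0) \<notin> ibox (K - 2)" using that by (cases n; auto)+
    then show ?thesis using z by (simp add: a1_def)
  qed
  have z': "a n = 0" if "n \<notin> ibox (K - 1)" for n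
    using that by (intro z) auto
  have d1: "(ec Q 1 (fst q) - 1) * H q = (\<Sum>n\<in>ibox K. a1 n * E2 Q n q)" for q
    unfolding H_def a1_def by (rule E2_difference(1)[OF z'])
  have d2: "(ec Q 1 (snd q) - 1) * H q = (\<Sum>n\<in>ibox K. a2 n * E2 Q n q)" for q
    unfolding H_def a2_def by (rule E2_difference(2)[OF z'])
  have d12: "(ec Q 1 (snd q) - 1) * ((ec Q 1 (fst q) - 1) * H q) = (\<Sum>n\<in>ibox K. a12 n * E2 Q n q)" for q
    unfolding d1 a12_def by (rule E2_difference(2)[OF z1])
  have card: "real (card (ibox K)) = (2 * real_of_int K + 1)\<^sup>2"
    using K by (simp add: card_cartesian_product power2_eq_square)
  have pars: "(\<Sum>q\<in>grid Q. (cmod (\<Sum>n\<in>ibox K. b n * E2 Q n q))\<^sup>2) \<le> (real Q)\<^sup>2 * ((2 * real_of_int K + 1)\<^sup>2 * B\<^sup>2)"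
    if B: "\<And>n. cmod (b n) \<le> B" for b B
  proof -
    have "(\<Sum>q\<in>grid Q. (cmod (\<Sum>n\<in>ibox K. b n * E2 Q n q))\<^sup>2) = (real Q)\<^sup>2 * (\<Sum>n\<in>ibox K. (cmod (b n))\<^sup>2)"
      using Q(2) by (intro discrete_Parseval) auto
    also have "(\<Sum>n\<in>ibox K. (cmod (b n))\<^sup>2) \<le> (\<Sum>n\<in>ibox K. B\<^sup>2)"
      using B by (intro sum_mono power_mono) auto
    also have "\<dots> = (2 * real_of_int K + 1)\<^sup>2 * B\<^sup>2" by (simp only: sum_constant card)
    finally show ?thesis by (simp add: mult_left_mono)
  qed
  let ?C = "(2 * real_of_int K + 1)\<^sup>2 * A\<^sup>2"
  have B1: "cmod (a1 n) \<le> A / N" "cmod (a2 n) \<le> A / N" "cmod (a12 n) \<le> A / N\<^sup>2" for n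
    using A(2)[of n] A(3)[of n] A(4)[of n] N
    by (simp_all add: a1_def a2_def a12_def pos_le_divide_eq mult.commute)
  have S: "(\<Sum>q\<in>grid Q. (w (fst q) * w (snd q)) * (cmod (H q))\<^sup>2) \<le> 4 * ((real Q)\<^sup>2 * ?C)"
  proof -
    \<comment> \<open>Expanding the product weight gives one term for each of the four bounds in
      \<open>A\<close>. Each contributes the same amount, hence the factor 4 in
      \<open>S\<close>.\<close>
    have e: "(w (fst q) * w (snd q)) * (cmod (H q))\<^sup>2 = (cmod (H q))\<^sup>2
        + N\<^sup>2 * (cmod ((ec Q 1 (fst q) - 1) * H q))\<^sup>2 + N\<^sup>2 * (cmod ((ec Q 1 (snd q) - 1) * H q))\<^sup>2
        + N ^ 4 * (cmod ((ec Q 1 (snd q) - 1) * ((ec Q 1 (fst q) - 1) * H q)))\<^sup>2" for q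
      unfolding w_def norm_mult power_mult_distrib by (simp add: algebra_simps power4_eq_xxxx power2_eq_square)
    have "(\<Sum>q\<in>grid Q. (cmod (H q))\<^sup>2) \<le> (real Q)\<^sup>2 * ?C"
      unfolding H_def by (rule pars[OF A(1)])
    moreover have "N\<^sup>2 * (\<Sum>q\<in>grid Q. (cmod ((ec Q 1 (fst q) - 1) * H q))\<^sup>2) \<le> (real Q)\<^sup>2 * ?C"
    proof -
      have "N\<^sup>2 * (\<Sum>q\<in>grid Q. (cmod ((ec Q 1 (fst q) - 1) * H q))\<^sup>2) \<le> N\<^sup>2 * ((real Q)\<^sup>2 * ((2 * real_of_int K + 1)\<^sup>2 * (A / N)\<^sup>2))"
        unfolding d1 by (intro mult_left_mono pars B1) auto
      also have "\<dots> = (real Q)\<^sup>2 * ?C" using N by (simp add: power_divide)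
      finally show ?thesis .
    qed
    moreover have "N\<^sup>2 * (\<Sum>q\<in>grid Q. (cmod ((ec Q 1 (snd q) - 1) * H q))\<^sup>2) \<le> (real Q)\<^sup>2 * ?C"
    proof -
      have "N\<^sup>2 * (\<Sum>q\<in>grid Q. (cmod ((ec Q 1 (snd q) - 1) * H q))\<^sup>2) \<le> N\<^sup>2 * ((real Q)\<^sup>2 * ((2 * real_of_int K + 1)\<^sup>2 * (A / N)\<^sup>2))"
        unfolding d2 by (intro mult_left_mono pars B1) auto
      also have "\<dots> = (real Q)\<^sup>2 * ?C" using N by (simp add: power_divide)
      finally show ?thesis .
    qed
    moreover have "N ^ 4 * (\<Sum>q\<in>grid Q. (cmod ((ec Q 1 (snd q) - 1) * ((ec Q 1 (fst q) - 1) * H q)))\<^sup>2) \<le> (real Q)\<^sup>2 * ?C"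
    proof -
      have "N ^ 4 * (\<Sum>q\<in>grid Q. (cmod ((ec Q 1 (snd q) - 1) * ((ec Q 1 (fst q) - 1) * H q)))\<^sup>2)
          \<le> N ^ 4 * ((real Q)\<^sup>2 * ((2 * real_of_int K + 1)\<^sup>2 * (A / N\<^sup>2)\<^sup>2))"
        unfolding d12 using N by (intro mult_left_mono pars B1) auto
      also have "\<dots> = (real Q)\<^sup>2 * ?C" using N by (simp add: power_divide)
      finally show ?thesis .
    qed
    ultimately show ?thesis
      unfolding e sum.distrib sum_distrib_left[symmetric] by linarith
  qed
  have W: "(\<Sum>q\<in>grid Q. 1 / (w (fst q) * w (snd q))) \<le> (3 * real Q / N)\<^sup>2"
  proof -
    have "(\<Sum>q\<in>grid Q. 1 / (w (fst q) * w (snd q))) = (\<Sum>q<Q. 1 / w q) * (\<Sum>q<Q. 1 / w q)"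
      by (simp add: sum_product sum.cartesian_product split_def)
    also have "\<dots> \<le> (3 * real Q / N) * (3 * real Q / N)"
      unfolding w_def using N Q(1) by (intro mult_mono sum_weight_le) (auto intro!: sum_nonneg add_nonneg_nonneg)
    finally show ?thesis by (simp add: power2_eq_square)
  qed
  have "(\<Sum>q\<in>grid Q. cmod (H q))\<^sup>2
    = (\<Sum>q\<in>grid Q. sqrt (1 / (w (fst q) * w (snd q))) * (sqrt (w (fst q) * w (snd q)) * cmod (H q)))\<^sup>2"
  proof (intro arg_cong[where f = "\<lambda>x. x\<^sup>2"] sum.cong refl)
    fix q
    have "w (fst q) * w (snd q) > 0" using w[of "fst q"] w[of "snd q"] by (intro mult_pos_pos) linarith+
    then have "sqrt (1 / (w (fst q) * w (snd q))) * sqrt (w (fst q) * w (snd q)) = 1"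
      by (simp only: real_sqrt_mult[symmetric]) (auto simp: zero_less_mult_iff)
    then show "cmod (H q) = sqrt (1 / (w (fst q) * w (snd q))) * (sqrt (w (fst q) * w (snd q)) * cmod (H q))"
      by (simp only: mult.assoc[symmetric] mult_1)
  qed
  also have "\<dots> \<le> (\<Sum>q\<in>grid Q. (sqrt (1 / (w (fst q) * w (snd q))))\<^sup>2) * (\<Sum>q\<in>grid Q. (sqrt (w (fst q) * w (snd q)) * cmod (H q))\<^sup>2)"
    by (rule Cauchy_Schwarz_ineq_sum)
  also have "\<dots> = (\<Sum>q\<in>grid Q. 1 / (w (fst q) * w (snd q))) * (\<Sum>q\<in>grid Q. (w (fst q) * w (snd q)) * (cmod (H q))\<^sup>2)"
  proof -
    have "0 \<le> w (fst q) * w (snd q)" for q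
      using w[of "fst q"] w[of "snd q"] by (intro mult_nonneg_nonneg) linarith+
    then show ?thesis
      by (simp only: power_mult_distrib real_sqrt_pow2 divide_nonneg_nonneg zero_le_one)
  qed
  also have "\<dots> \<le> (3 * real Q / N)\<^sup>2 * (4 * ((real Q)\<^sup>2 * ?C))"
    using S W by (intro mult_mono) (auto intro!: sum_nonneg mult_nonneg_nonneg simp: w_def add_nonneg_nonneg)
  \<comment> \<open>6 is 3 from the weight sum times the square root of 4.\<close>
  also have "\<dots> = (6 * A * (2 * real_of_int K + 1) * (real Q)\<^sup>2 / N)\<^sup>2"
    by (simp add: power2_eq_square)
  finally show ?thesis
    unfolding H_def by (rule power2_le_imp_le) (use K N A0 in auto)
qed

text \<open>Bounds on \<open>m\<close>, \<open>\<partial>\<^sub>1m\<close>, \<open>\<partial>\<^sub>2m\<close> and \<open>\<partial>\<^sub>1\<partial>\<^sub>2m\<close> in terms of differences, so that products of Lipschitz cutoffs in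
  each variable are admissible.\<close>

definition dbounded :: "real \<Rightarrow> (real \<Rightarrow> real \<Rightarrow> complex) \<Rightarrow> bool" where
  "dbounded A m \<longleftrightarrow> (\<forall>x y. cmod (m x y) \<le> A) \<and>
     (\<forall>x y u. cmod (m (x + u) y - m x y) \<le> A * \<bar>u\<bar>) \<and> (\<forall>x y v. cmod (m x (y + v) - m x y) \<le> A * \<bar>v\<bar>) \<and>
     (\<forall>x y u v. cmod (m (x + u) (y + v) - m (x + u) y - m x (y + v) + m x y) \<le> A * \<bar>u\<bar> * \<bar>v\<bar>)"

text \<open>Orthogonality on the grid realizes the multiplier as a combination of translates of
  \<open>trig S c\<close> with weights \<open>H q / Q^2\<close>, so the operator norm is at most the
  l^1 norm of these weights. Rescaled lattice differences of \<open>m\<close> are of order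
  \<open>1 / N\<close> while the support has about \<open>N * R\<close> points per direction; the
  powers of \<open>N\<close> cancel, and so does \<open>Q\<close>. The hypothesis \<open>R\<close>
  says that the support is at least one lattice step wide, without which rounding would spoil this
  balance.\<close>

theorem multiplier_N3:
  assumes L: "L > 0" and \<sigma>: "\<sigma> > 0" and S: "finite S" "S \<subseteq> freq L"
    and m: "dbounded A m" and supp: "\<And>x y. \<bar>x\<bar> > R \<or> \<bar>y\<bar> > R \<Longrightarrow> m x y = 0" and R: "\<sigma> * (2 * pi / L) \<le> R"
  shows "N3 L (trig S (\<lambda>k. m (\<sigma> * k $ 1) (\<sigma> * k $ 2) * c k)) \<le> ennreal ((42 * A * R) ^ 3) * N3 L (trig S c)"
proof -
  define \<tau> where "\<tau> = \<sigma> * (2 * pi / L)"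
  have \<tau>: "\<tau> > 0" "\<tau> \<le> R" using L \<sigma> R by (auto simp: \<tau>_def)
  define a where "a n = m (\<tau> * real_of_int (fst n)) (\<tau> * real_of_int (snd n))" for n
  \<comment> \<open>The number of rescaled lattice points per unit length.\<close>
  define N where "N = 1 / \<tau>"
  have N: "N > 0" "N * R \<ge> 1" using \<tau> by (auto simp: N_def)
  \<comment> \<open>The summand 2 provides the two margins required by
    \<open>sum_cmod_kernel_le\<close>; as \<open>N * R \<ge> 1\<close>, the additive constants are
    absorbed into the factor 7.\<close>
  define K where "K = \<lfloor>N * R\<rfloor> + 2"
  have K: "K \<ge> 3" "2 * real_of_int K + 1 \<le> 7 * (N * R)"
  proof -
    have "1 \<le> \<lfloor>N * R\<rfloor>" using N(2) by (simp add: le_floor_iff)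
    then show "K \<ge> 3" by (simp add: K_def)
    show "2 * real_of_int K + 1 \<le> 7 * (N * R)"
      using N(2) of_int_floor_le[of "N * R"] unfolding K_def of_int_add of_int_numeral by argo
  qed
  define T where "T = lfreq L -` S"
  have T: "finite T" "lfreq L ` T = S"
    unfolding T_def using S inj_lfreq[OF L] by (auto intro!: finite_vimageI simp: freq_eq)
  have inj: "inj_on (lfreq L) T" using inj_lfreq[OF L] by (rule inj_on_subset) auto
  \<comment> \<open>A bound for the frequencies of the polynomial. It influences only the choice of
    \<open>Q\<close>, so nothing in the final constant depends on \<open>S\<close>.\<close>
  define D where "D = Max (insert 0 ((\<lambda>n. \<bar>fst n\<bar> + \<bar>snd n\<bar>) ` T))"
  have D: "\<bar>fst n\<bar> \<le> D" "\<bar>snd n\<bar> \<le> D" if "n \<in> T" for n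
  proof -
    have "\<bar>fst n\<bar> + \<bar>snd n\<bar> \<le> D" unfolding D_def using that T by (intro Max_ge) auto
    then show "\<bar>fst n\<bar> \<le> D" "\<bar>snd n\<bar> \<le> D" by auto
  qed
  have D0: "D \<ge> 0" unfolding D_def using T by (intro Max_ge) auto
  \<comment> \<open>Large enough for three purposes: \<open>2 * K < Q\<close> for Parseval,
    \<open>K + D < Q\<close> against aliasing between kernel and polynomial,
    \<open>N \<le> Q\<close> for the weight sum.\<close>
  define Q where "Q = nat (2 * K + D + \<lceil>N\<rceil> + 1)"
  have Q: "N \<le> real Q" "2 * K < int Q" "K + D < int Q" "Q > 0"
    using K D0 N unfolding Q_def by linarith+
  have z: "a n = 0" if "n \<notin> ibox (K - 2)" for n
  proof -
    have *: "\<bar>\<tau> * real_of_int j\<bar> > R" if "\<not> (- (K - 2) \<le> j \<and> j \<le> K - 2)" for j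
    proof -
      have "\<bar>j\<bar> \<ge> \<lfloor>N * R\<rfloor> + 1" using that unfolding K_def by linarith
      then have "N * R < \<bar>real_of_int j\<bar>" by linarith
      then have "\<tau> * (N * R) < \<tau> * \<bar>real_of_int j\<bar>" using \<tau> by (simp add: mult_less_cancel_left_pos)
      then show ?thesis using \<tau> by (simp add: N_def abs_mult)
    qed
    have "\<not> (- (K - 2) \<le> fst n \<and> fst n \<le> K - 2) \<or> \<not> (- (K - 2) \<le> snd n \<and> snd n \<le> K - 2)"
      using that by (cases n) auto
    then show ?thesis unfolding a_def using *[of "fst n"] *[of "snd n"] by (intro supp) blast
  qed
  have st: "\<tau> * real_of_int (i - 1) = \<tau> * real_of_int i + (- \<tau>)" for i by (simp add: algebra_simps)
  have A1: "cmod (a n) \<le> A" for n using m unfolding dbounded_def a_def by blast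
  have A2: "N * cmod (a (n - (1, 0)) - a n) \<le> A" "N * cmod (a (n - (0, 1)) - a n) \<le> A" for n
  proof -
    have "cmod (a (n - (1, 0)) - a n) \<le> A * \<bar>- \<tau>\<bar>" "cmod (a (n - (0, 1)) - a n) \<le> A * \<bar>- \<tau>\<bar>"
      using m unfolding dbounded_def a_def fst_diff snd_diff fst_conv snd_conv st diff_zero by blast+
    then show "N * cmod (a (n - (1, 0)) - a n) \<le> A" "N * cmod (a (n - (0, 1)) - a n) \<le> A"
      using \<tau> by (simp_all add: N_def divide_le_eq mult.commute)
  qed
  have A3: "N\<^sup>2 * cmod (a (n - (0, 1) - (1, 0)) - a (n - (0, 1)) - (a (n - (1, 0)) - a n)) \<le> A" for n
  proof -
    let ?x = "\<tau> * real_of_int (fst n)" and ?y = "\<tau> * real_of_int (snd n)"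
    have "a (n - (0, 1) - (1, 0)) - a (n - (0, 1)) - (a (n - (1, 0)) - a n)
      = m (?x + (- \<tau>)) (?y + (- \<tau>)) - m (?x + (- \<tau>)) ?y - m ?x (?y + (- \<tau>)) + m ?x ?y"
      unfolding a_def fst_diff snd_diff fst_conv snd_conv st diff_zero by simp
    also have "cmod \<dots> \<le> A * \<bar>- \<tau>\<bar> * \<bar>- \<tau>\<bar>" using m unfolding dbounded_def by blast
    finally show ?thesis using \<tau> by (simp add: N_def power_divide divide_le_eq power2_eq_square mult_ac)
  qed
  define H where "H q = (\<Sum>n\<in>ibox K. a n * E2 Q n q)" for q
  \<comment> \<open>The minus sign makes the translate contribute the conjugate character, so that
    the sum over the grid selects \<open>j = n\<close>.\<close>
  define y :: "nat \<times> nat \<Rightarrow> real^2" where "y q = - vector [L * real (fst q) / real Q, L * real (snd q) / real Q]" for q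
  have y: "ew (lfreq L n) (y q) = E2 Q (- n) q" for n q
    using L by (simp add: ew_def y_def E2_def ec_def cis_mult inner_vec_def sum_2 mult_ac add_divide_distrib)
  have "(\<Sum>q\<in>grid Q. (H q / (of_nat Q)\<^sup>2) * trig S c (x + y q))
      = trig S (\<lambda>k. m (\<sigma> * k $ 1) (\<sigma> * k $ 2) * c k) x" for x
  proof -
    have tS: "trig S d x = (\<Sum>n\<in>T. d (lfreq L n) * ew (lfreq L n) x)" for d x
      unfolding trig_def T(2)[symmetric] by (rule sum.reindex[OF inj, unfolded comp_def])
    have "(\<Sum>q\<in>grid Q. (H q / (of_nat Q)\<^sup>2) * trig S c (x + y q)) =
       (\<Sum>q\<in>grid Q. \<Sum>n\<in>T. \<Sum>j\<in>ibox K. (a j * c (lfreq L n) * ew (lfreq L n) x / (of_nat Q)\<^sup>2) * E2 Q (j - n) q)"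
      unfolding tS H_def ew_add y sum_divide_distrib sum_product
      using E2_add[of Q j "- n" q for j n q] by (subst sum.swap) (simp add: mult_ac)
    also have "\<dots> = (\<Sum>n\<in>T. \<Sum>j\<in>ibox K. \<Sum>q\<in>grid Q. (a j * c (lfreq L n) * ew (lfreq L n) x / (of_nat Q)\<^sup>2) * E2 Q (j - n) q)"
      by (subst sum.swap, rule sum.cong[OF refl], rule sum.swap)
    also have "\<dots> = (\<Sum>n\<in>T. \<Sum>j\<in>ibox K. if j = n then a j * c (lfreq L n) * ew (lfreq L n) x else 0)"
    proof (intro sum.cong refl)
      fix n j assume n: "n \<in> T" and j: "j \<in> ibox K"
      have jn: "\<bar>fst (j - n)\<bar> < int Q" "\<bar>snd (j - n)\<bar> < int Q"
        using D[OF n] j Q(3) by (auto simp: abs_if split: if_splits)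
      then show "(\<Sum>q\<in>grid Q. (a j * c (lfreq L n) * ew (lfreq L n) x / (of_nat Q)\<^sup>2) * E2 Q (j - n) q)
        = (if j = n then a j * c (lfreq L n) * ew (lfreq L n) x else 0)"
        unfolding sum_distrib_left[symmetric] sum_E2[OF jn] using Q(4) by simp
    qed
    also have "\<dots> = (\<Sum>n\<in>T. a n * c (lfreq L n) * ew (lfreq L n) x)"
    proof (intro sum.cong refl)
      fix n assume "n \<in> T"
      show "(\<Sum>j\<in>ibox K. if j = n then a j * c (lfreq L n) * ew (lfreq L n) x else 0) = a n * c (lfreq L n) * ew (lfreq L n) x"
      \<comment> \<open>For frequencies outside the box the diagonal term is missing from the sum,
        but there the symbol vanishes as well.\<close>
      proof (cases "n \<in> ibox K")
        case False
        then have "a n = 0" by (intro z) auto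
        then show ?thesis by (auto intro!: sum.neutral)
      qed simp
    qed
    also have "\<dots> = trig S (\<lambda>k. m (\<sigma> * k $ 1) (\<sigma> * k $ 2) * c k) x"
      unfolding tS by (intro sum.cong refl) (simp add: a_def \<tau>_def mult.assoc)
    finally show ?thesis .
  qed
  then have "N3 L (trig S (\<lambda>k. m (\<sigma> * k $ 1) (\<sigma> * k $ 2) * c k))
      = N3 L (\<lambda>x. \<Sum>q\<in>grid Q. (H q / (of_nat Q)\<^sup>2) * trig S c (x + y q))"
    by (simp add: fun_eq_iff)
  also have "\<dots> \<le> ennreal ((\<Sum>q\<in>grid Q. cmod (H q / (of_nat Q)\<^sup>2)) ^ 3) * N3 L (trig S c)"
    using torus_periodic_trig[OF L S(2)] by (intro N3_sum_shift_le[OF L]) auto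
  also have "\<dots> \<le> ennreal ((42 * A * R) ^ 3) * N3 L (trig S c)"
  proof (intro mult_right_mono ennreal_leI power_mono)
    have "(\<Sum>q\<in>grid Q. cmod (H q / (of_nat Q)\<^sup>2)) = (\<Sum>q\<in>grid Q. cmod (H q)) / (real Q)\<^sup>2"
      by (simp add: norm_divide norm_power sum_divide_distrib)
    also have "\<dots> \<le> (6 * A * (2 * real_of_int K + 1) * (real Q)\<^sup>2 / N) / (real Q)\<^sup>2"
      unfolding H_def using K by (intro divide_right_mono sum_cmod_kernel_le z N Q A1 A2 A3) auto
    also have "\<dots> = 6 * A * (2 * real_of_int K + 1) / N" using Q(4) by simp
    also have "\<dots> \<le> 6 * A * (7 * (N * R)) / N"
      using K N order_trans[OF norm_ge_zero A1] by (intro divide_right_mono mult_left_mono) auto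
    also have "\<dots> = 42 * A * R" using N by simp
    finally show "(\<Sum>q\<in>grid Q. cmod (H q / (of_nat Q)\<^sup>2)) \<le> 42 * A * R" .
  qed (auto intro!: sum_nonneg)
  finally show ?thesis .
qed

section \<open>Symbols\<close>

lemma dbounded_nonneg: "dbounded A m \<Longrightarrow> A \<ge> 0"
  unfolding dbounded_def using norm_ge_zero order_trans by blast

lemma dbounded_mono: "dbounded A m \<Longrightarrow> A \<le> B \<Longrightarrow> dbounded B m"
  unfolding dbounded_def by (meson abs_ge_zero mult_right_mono order_trans)

lemma dbounded_const: "cmod c \<le> A \<Longrightarrow> dbounded A (\<lambda>x y. c)"
proof -
  assume c: "cmod c \<le> A"
  then have "A \<ge> 0" using norm_ge_zero order_trans by blast
  then show ?thesis using c unfolding dbounded_def by simp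
qed

lemma dbounded_swap:
  assumes "dbounded A m" shows "dbounded A (\<lambda>x y. m y x)"
proof -
  have *: "cmod (m y x) \<le> A" "cmod (m y (x + u) - m y x) \<le> A * \<bar>u\<bar>" "cmod (m (y + v) x - m y x) \<le> A * \<bar>v\<bar>"
    "cmod (m (y + v) (x + u) - m (y + v) x - m y (x + u) + m y x) \<le> A * \<bar>v\<bar> * \<bar>u\<bar>" for x y u v
    using assms unfolding dbounded_def by blast+
  have "m (y + v) (x + u) - m y (x + u) - m (y + v) x + m y x = m (y + v) (x + u) - m (y + v) x - m y (x + u) + m y x"
    "A * \<bar>u\<bar> * \<bar>v\<bar> = A * \<bar>v\<bar> * \<bar>u\<bar>" for x y u v
    by simp_all
  note c = this
  have "cmod (m (y + v) (x + u) - m y (x + u) - m (y + v) x + m y x) \<le> A * \<bar>u\<bar> * \<bar>v\<bar>" for x y u v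
    unfolding c(1) c(2)[of u v] by (rule *(4))
  then show ?thesis unfolding dbounded_def using * by blast
qed

lemma dbounded_add:
  assumes "dbounded A f" "dbounded B g"
  shows "dbounded (A + B) (\<lambda>x y. f x y + g x y)"
proof -
  have tri: "cmod (a + b) \<le> s + t" if "cmod a \<le> s" "cmod b \<le> t" for a b s t
    using that norm_triangle_le[of a b "s + t"] by simp
  show ?thesis unfolding dbounded_def
  proof (intro conjI allI)
    fix x y u v
    show "cmod (f x y + g x y) \<le> A + B"
      using assms unfolding dbounded_def by (intro tri) auto
    have "cmod ((f (x + u) y - f x y) + (g (x + u) y - g x y)) \<le> A * \<bar>u\<bar> + B * \<bar>u\<bar>"
      using assms unfolding dbounded_def by (intro tri) auto
    then show "cmod (f (x + u) y + g (x + u) y - (f x y + g x y)) \<le> (A + B) * \<bar>u\<bar>"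
      by (simp add: algebra_simps)
    have "cmod ((f x (y + v) - f x y) + (g x (y + v) - g x y)) \<le> A * \<bar>v\<bar> + B * \<bar>v\<bar>"
      using assms unfolding dbounded_def by (intro tri) auto
    then show "cmod (f x (y + v) + g x (y + v) - (f x y + g x y)) \<le> (A + B) * \<bar>v\<bar>"
      by (simp add: algebra_simps)
    have "cmod ((f (x + u) (y + v) - f (x + u) y - f x (y + v) + f x y)
        + (g (x + u) (y + v) - g (x + u) y - g x (y + v) + g x y)) \<le> A * \<bar>u\<bar> * \<bar>v\<bar> + B * \<bar>u\<bar> * \<bar>v\<bar>"
      using assms unfolding dbounded_def by (intro tri) auto
    then show "cmod (f (x + u) (y + v) + g (x + u) (y + v) - (f (x + u) y + g (x + u) y)
        - (f x (y + v) + g x (y + v)) + (f x y + g x y)) \<le> (A + B) * \<bar>u\<bar> * \<bar>v\<bar>"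
      by (simp add: algebra_simps)
  qed
qed

text \<open>Discrete Leibniz rule. The mixed difference of a product splits into four products, each
  at most \<open>A * B * \<bar>u\<bar> * \<bar>v\<bar>\<close>; this is the 4.\<close>

lemma dbounded_mult:
  assumes f: "dbounded A f" and g: "dbounded B g"
  shows "dbounded (4 * A * B) (\<lambda>x y. f x y * g x y)"
proof -
  have A: "A \<ge> 0" "B \<ge> 0" using f g by (auto intro: dbounded_nonneg)
  have f0: "cmod (f x y) \<le> A" and g0: "cmod (g x y) \<le> B" for x y
    using f g unfolding dbounded_def by auto
  have f1: "cmod (f (x + u) y - f x y) \<le> A * \<bar>u\<bar>" and g1: "cmod (g (x + u) y - g x y) \<le> B * \<bar>u\<bar>"
    and f2: "cmod (f x (y + v) - f x y) \<le> A * \<bar>v\<bar>" and g2: "cmod (g x (y + v) - g x y) \<le> B * \<bar>v\<bar>" for x y u v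
    using f g unfolding dbounded_def by auto
  have f3: "cmod (f (x + u) (y + v) - f (x + u) y - f x (y + v) + f x y) \<le> A * \<bar>u\<bar> * \<bar>v\<bar>"
    and g3: "cmod (g (x + u) (y + v) - g (x + u) y - g x (y + v) + g x y) \<le> B * \<bar>u\<bar> * \<bar>v\<bar>" for x y u v
    using f g unfolding dbounded_def by auto
  have mul: "cmod (a * b) \<le> s * t" if "cmod a \<le> s" "cmod b \<le> t" for a b s t
    using that by (auto simp: norm_mult intro!: mult_mono order_trans[OF norm_ge_zero])
  have tri: "cmod (a + b) \<le> s + t" if "cmod a \<le> s" "cmod b \<le> t" for a b s t
    using that norm_triangle_le[of a b "s + t"] by simp
  have AB: "A * B \<ge> 0" using A by simp
  show ?thesis unfolding dbounded_def
  proof (intro conjI allI)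
    fix x y u v
    have "cmod (f x y * g x y) \<le> A * B" by (intro mul f0 g0)
    then show "cmod (f x y * g x y) \<le> 4 * A * B" using AB by linarith
    have "cmod ((f (x + u) y - f x y) * g (x + u) y + f x y * (g (x + u) y - g x y)) \<le> (A * \<bar>u\<bar>) * B + A * (B * \<bar>u\<bar>)"
      by (intro tri mul f0 g0 f1 g1)
    also have "\<dots> \<le> 4 * A * B * \<bar>u\<bar>" using mult_nonneg_nonneg[OF AB abs_ge_zero[of u]] by (simp add: mult_ac)
    finally show "cmod (f (x + u) y * g (x + u) y - f x y * g x y) \<le> 4 * A * B * \<bar>u\<bar>"
      by (simp add: algebra_simps)
    have "cmod ((f x (y + v) - f x y) * g x (y + v) + f x y * (g x (y + v) - g x y)) \<le> (A * \<bar>v\<bar>) * B + A * (B * \<bar>v\<bar>)"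
      by (intro tri mul f0 g0 f2 g2)
    also have "\<dots> \<le> 4 * A * B * \<bar>v\<bar>" using mult_nonneg_nonneg[OF AB abs_ge_zero[of v]] by (simp add: mult_ac)
    finally show "cmod (f x (y + v) * g x (y + v) - f x y * g x y) \<le> 4 * A * B * \<bar>v\<bar>"
      by (simp add: algebra_simps)
    have "cmod (((f (x + u) (y + v) - f (x + u) y - f x (y + v) + f x y) * g (x + u) (y + v)
        + (f (x + u) y - f x y) * (g (x + u) (y + v) - g (x + u) y))
        + ((f x (y + v) - f x y) * (g (x + u) (y + v) - g x (y + v))
        + f x y * (g (x + u) (y + v) - g (x + u) y - g x (y + v) + g x y)))
      \<le> ((A * \<bar>u\<bar> * \<bar>v\<bar>) * B + (A * \<bar>u\<bar>) * (B * \<bar>v\<bar>)) + ((A * \<bar>v\<bar>) * (B * \<bar>u\<bar>) + A * (B * \<bar>u\<bar> * \<bar>v\<bar>))"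
      by (intro tri mul f0 g0 f1 g1 f2 g2 f3 g3)
    then show "cmod (f (x + u) (y + v) * g (x + u) (y + v) - f (x + u) y * g (x + u) y - f x (y + v) * g x (y + v) + f x y * g x y)
      \<le> 4 * A * B * \<bar>u\<bar> * \<bar>v\<bar>"
      by (simp add: algebra_simps)
  qed
qed

text \<open>The mixed difference scales by 2 in each variable, which is the worst of the four
  bounds.\<close>

lemma dbounded_dilate:
  assumes "dbounded A m"
  shows "dbounded (4 * A) (\<lambda>x y. m (2 * x) (2 * y))"
proof -
  have A: "A \<ge> 0" using assms by (rule dbounded_nonneg)
  show ?thesis unfolding dbounded_def
  proof (intro conjI allI)
    fix x y u v
    have "cmod (m (2 * x) (2 * y)) \<le> A" using assms unfolding dbounded_def by blast
    then show "cmod (m (2 * x) (2 * y)) \<le> 4 * A" using A by linarith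
    have le: "A * \<bar>2 * w\<bar> \<le> 4 * A * \<bar>w\<bar>" for w
      using mult_nonneg_nonneg[OF A abs_ge_zero[of w]] by (simp add: abs_mult)
    have "cmod (m (2 * x + 2 * u) (2 * y) - m (2 * x) (2 * y)) \<le> A * \<bar>2 * u\<bar>"
      using assms unfolding dbounded_def by blast
    then show "cmod (m (2 * (x + u)) (2 * y) - m (2 * x) (2 * y)) \<le> 4 * A * \<bar>u\<bar>"
      unfolding distrib_left using le[of u] by (rule order_trans)
    have "cmod (m (2 * x) (2 * y + 2 * v) - m (2 * x) (2 * y)) \<le> A * \<bar>2 * v\<bar>"
      using assms unfolding dbounded_def by blast
    then show "cmod (m (2 * x) (2 * (y + v)) - m (2 * x) (2 * y)) \<le> 4 * A * \<bar>v\<bar>"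
      unfolding distrib_left using le[of v] by (rule order_trans)
    have "cmod (m (2 * x + 2 * u) (2 * y + 2 * v) - m (2 * x + 2 * u) (2 * y) - m (2 * x) (2 * y + 2 * v) + m (2 * x) (2 * y))
      \<le> A * \<bar>2 * u\<bar> * \<bar>2 * v\<bar>"
      using assms unfolding dbounded_def by blast
    then show "cmod (m (2 * (x + u)) (2 * (y + v)) - m (2 * (x + u)) (2 * y) - m (2 * x) (2 * (y + v)) + m (2 * x) (2 * y))
      \<le> 4 * A * \<bar>u\<bar> * \<bar>v\<bar>"
      unfolding distrib_left by (simp add: abs_mult)
  qed
qed

section \<open>Lipschitz factors of one variable, cutoffs and increment symbols\<close>

definition lip :: "real \<Rightarrow> (real \<Rightarrow> complex) \<Rightarrow> bool" where
  "lip A f \<longleftrightarrow> (\<forall>x. cmod (f x) \<le> A) \<and> (\<forall>x u. cmod (f (x + u) - f x) \<le> A * \<bar>u\<bar>)"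

lemma lip_mult:
  assumes "lip A f" "lip B g"
  shows "lip (2 * A * B) (\<lambda>x. f x * g x)"
proof -
  have f: "cmod (f x) \<le> A" "cmod (f (x + u) - f x) \<le> A * \<bar>u\<bar>"
    and g: "cmod (g x) \<le> B" "cmod (g (x + u) - g x) \<le> B * \<bar>u\<bar>" for x u
    using assms unfolding lip_def by auto
  have mul: "cmod (a * b) \<le> s * t" if "cmod a \<le> s" "cmod b \<le> t" for a b s t
    using that by (auto simp: norm_mult intro!: mult_mono order_trans[OF norm_ge_zero])
  have tri: "cmod (a + b) \<le> s + t" if "cmod a \<le> s" "cmod b \<le> t" for a b s t
    using that norm_triangle_le[of a b "s + t"] by simp
  have AB: "A * B \<ge> 0" using order_trans[OF norm_ge_zero f(1)] order_trans[OF norm_ge_zero g(1)] by simp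
  show ?thesis unfolding lip_def
  proof (intro conjI allI)
    fix x u
    have "cmod (f x * g x) \<le> A * B" by (intro mul f g)
    then show "cmod (f x * g x) \<le> 2 * A * B" using AB by linarith
    have "cmod ((f (x + u) - f x) * g (x + u) + f x * (g (x + u) - g x)) \<le> (A * \<bar>u\<bar>) * B + A * (B * \<bar>u\<bar>)"
      by (intro tri mul f g)
    then show "cmod (f (x + u) * g (x + u) - f x * g x) \<le> 2 * A * B * \<bar>u\<bar>"
      by (simp add: algebra_simps)
  qed
qed

text \<open>The mixed difference of a tensor product is the product of the two differences, so
  Lipschitz factors are enough and piecewise linear cutoffs may be used.\<close>

lemma dbounded_tensor:
  assumes "lip A f" "lip B g"
  shows "dbounded (A * B) (\<lambda>x y. f x * g y)"
proof -
  have f: "cmod (f x) \<le> A" "cmod (f (x + u) - f x) \<le> A * \<bar>u\<bar>"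
    and g: "cmod (g x) \<le> B" "cmod (g (x + u) - g x) \<le> B * \<bar>u\<bar>" for x u
    using assms unfolding lip_def by auto
  have mul: "cmod (a * b) \<le> s * t" if "cmod a \<le> s" "cmod b \<le> t" for a b s t
    using that by (auto simp: norm_mult intro!: mult_mono order_trans[OF norm_ge_zero])
  show ?thesis unfolding dbounded_def
  proof (intro conjI allI)
    fix x y u v
    show "cmod (f x * g y) \<le> A * B" by (intro mul f g)
    have "cmod ((f (x + u) - f x) * g y) \<le> (A * \<bar>u\<bar>) * B" by (intro mul f g)
    then show "cmod (f (x + u) * g y - f x * g y) \<le> A * B * \<bar>u\<bar>" by (simp add: algebra_simps)
    have "cmod (f x * (g (y + v) - g y)) \<le> A * (B * \<bar>v\<bar>)" by (intro mul f g)
    then show "cmod (f x * g (y + v) - f x * g y) \<le> A * B * \<bar>v\<bar>" by (simp add: algebra_simps)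
    have "cmod ((f (x + u) - f x) * (g (y + v) - g y)) \<le> (A * \<bar>u\<bar>) * (B * \<bar>v\<bar>)" by (intro mul f g)
    then show "cmod (f (x + u) * g (y + v) - f (x + u) * g y - f x * g (y + v) + f x * g y) \<le> A * B * \<bar>u\<bar> * \<bar>v\<bar>"
      by (simp add: algebra_simps)
  qed
qed

text \<open>A trapezoid: for \<open>B > 0\<close> it is 1 up to modulus \<open>B\<close>, then falls
  with slope \<open>1 / B\<close> to 0 at \<open>2 * B\<close>.\<close>

definition cutoff :: "real \<Rightarrow> real \<Rightarrow> real" where
  "cutoff B x = max 0 (min 1 (2 - \<bar>x\<bar> / B))"

lemma cutoff_1: "B > 0 \<Longrightarrow> \<bar>x\<bar> \<le> B \<Longrightarrow> cutoff B x = 1"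
  using divide_le_eq_1_pos[of B "\<bar>x\<bar>"] by (simp add: cutoff_def)

lemma cutoff_0: "B > 0 \<Longrightarrow> \<bar>x\<bar> \<ge> 2 * B \<Longrightarrow> cutoff B x = 0"
  using pos_le_divide_eq[of B 2 "\<bar>x\<bar>"] by (simp add: cutoff_def)

lemma lip_cutoff:
  assumes "B \<ge> 1" shows "lip 1 (\<lambda>x. complex_of_real (cutoff B x))"
proof -
  have "\<bar>cutoff B (x + u) - cutoff B x\<bar> \<le> \<bar>u\<bar>" for x u
  proof -
    have "\<bar>\<bar>x + u\<bar> / B - \<bar>x\<bar> / B\<bar> = \<bar>\<bar>x + u\<bar> - \<bar>x\<bar>\<bar> / B" using assms by (simp add: diff_divide_distrib[symmetric])
    also have "\<dots> \<le> \<bar>u\<bar> / B" using assms by (intro divide_right_mono) auto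
    also have "\<dots> \<le> \<bar>u\<bar>" using assms by (simp add: divide_le_eq mult_left_le[of _ "\<bar>u\<bar>"] mult_le_cancel_left1)
    finally have "\<bar>\<bar>x + u\<bar> / B - \<bar>x\<bar> / B\<bar> \<le> \<bar>u\<bar>" .
    moreover have "\<bar>max 0 (min 1 (2 - a)) - max 0 (min 1 (2 - b))\<bar> \<le> \<bar>a - b\<bar>" for a b :: real
      by (auto simp: max_def min_def)
    ultimately show ?thesis unfolding cutoff_def by (rule order_trans[rotated])
  qed
  then show ?thesis unfolding lip_def of_real_diff[symmetric] norm_of_real by (simp add: cutoff_def)
qed

lemma cmod_cis_minus_1_le: "cmod (cis x - 1) \<le> \<bar>x\<bar>"
proof -
  have "(cmod (cis x - 1))\<^sup>2 = 2 - 2 * cos x"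
  proof -
    have "(cmod (cis x - 1))\<^sup>2 = (cos x - 1)\<^sup>2 + (sin x)\<^sup>2" by (simp add: cmod_power2)
    then show ?thesis using sin_cos_squared_add[of x] by (simp only: power2_diff) simp
  qed
  also have "\<dots> = 4 * (sin (x / 2))\<^sup>2" using cos_double_sin[of "x / 2"] by simp
  also have "\<dots> \<le> 4 * \<bar>x / 2\<bar>\<^sup>2"
    using abs_sin_x_le_abs_x[of "x / 2"] by (metis abs_ge_zero mult_left_mono power2_abs power_mono zero_le_numeral)
  also have "\<dots> = \<bar>x\<bar>\<^sup>2" by (simp add: power_divide)
  finally show ?thesis by (rule power2_le_imp_le) simp
qed

lemma cmod_cis_diff_le: "cmod (cis (x + u) - cis x) \<le> \<bar>u\<bar>"
proof -
  have "cis (x + u) - cis x = cis x * (cis u - 1)" by (simp add: cis_mult algebra_simps)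
  then show ?thesis using cmod_cis_minus_1_le[of u] by (simp add: norm_mult)
qed

lemma lip_cis:
  assumes "\<bar>q\<bar> \<le> 1" shows "lip 1 (\<lambda>x. cis (q * x))"
proof -
  have "cmod (cis (q * (x + u)) - cis (q * x)) \<le> \<bar>u\<bar>" for x u
  proof -
    have "cmod (cis (q * x + q * u) - cis (q * x)) \<le> \<bar>q * u\<bar>" by (rule cmod_cis_diff_le)
    also have "\<dots> \<le> \<bar>u\<bar>" using assms by (simp add: abs_mult mult_left_le_one_le)
    finally show ?thesis by (simp add: distrib_left)
  qed
  then show ?thesis by (simp add: lip_def)
qed

text \<open>The point is the factor \<open>\<bar>p\<bar>\<close>, which carries the smallness of the
  increment. Clamping \<open>x\<close> to the support of the cutoff does not change the product and
  makes the first factor \<open>2 * B * \<bar>p\<bar>\<close>-Lipschitz and bounded by the same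
  constant; \<open>lip_mult\<close> doubles it.\<close>

lemma lip_cis_minus_1_cutoff:
  assumes B: "B \<ge> 1"
  shows "lip (4 * B * \<bar>p\<bar>) (\<lambda>x. (cis (p * x) - 1) * complex_of_real (cutoff B x))"
proof -
  define cl where "cl x = max (- (2 * B)) (min (2 * B) x)" for x :: real
  have cl: "\<bar>cl x\<bar> \<le> 2 * B" "\<bar>cl (x + u) - cl x\<bar> \<le> \<bar>u\<bar>" for x u
    using B unfolding cl_def by linarith+
  have "lip (2 * B * \<bar>p\<bar>) (\<lambda>x. cis (p * cl x) - 1)"
    unfolding lip_def
  proof (intro conjI allI)
    fix x u
    have "cmod (cis (p * cl x) - 1) \<le> \<bar>p\<bar> * \<bar>cl x\<bar>" using cmod_cis_minus_1_le[of "p * cl x"] by (simp add: abs_mult)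
    also have "\<dots> \<le> \<bar>p\<bar> * (2 * B)" by (intro mult_left_mono cl) auto
    finally show "cmod (cis (p * cl x) - 1) \<le> 2 * B * \<bar>p\<bar>" by (simp add: mult_ac)
    have "cmod (cis (p * cl x + p * (cl (x + u) - cl x)) - cis (p * cl x)) \<le> \<bar>p * (cl (x + u) - cl x)\<bar>"
      by (rule cmod_cis_diff_le)
    also have "\<dots> \<le> \<bar>p\<bar> * \<bar>u\<bar>" unfolding abs_mult by (intro mult_left_mono cl) auto
    also have "\<dots> \<le> (2 * B * \<bar>p\<bar>) * \<bar>u\<bar>"
      using B by (intro mult_right_mono) (auto simp: mult_le_cancel_right1)
    finally show "cmod (cis (p * cl (x + u)) - 1 - (cis (p * cl x) - 1)) \<le> 2 * B * \<bar>p\<bar> * \<bar>u\<bar>"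
      by (simp add: algebra_simps)
  qed
  then have "lip (2 * (2 * B * \<bar>p\<bar>) * 1) (\<lambda>x. (cis (p * cl x) - 1) * complex_of_real (cutoff B x))"
    by (rule lip_mult) (rule lip_cutoff[OF B])
  moreover have "(cis (p * cl x) - 1) * complex_of_real (cutoff B x) = (cis (p * x) - 1) * complex_of_real (cutoff B x)" for x
  proof (cases "\<bar>x\<bar> \<ge> 2 * B")
    case True then show ?thesis using B by (simp add: cutoff_0)
  next
    case False then have "cl x = x" unfolding cl_def by linarith
    then show ?thesis by simp
  qed
  ultimately show ?thesis by (simp add: mult.assoc)
qed

definition cutoff_symbol :: "real \<Rightarrow> real \<Rightarrow> real \<Rightarrow> complex" where
  "cutoff_symbol B x y = complex_of_real (cutoff B x) * complex_of_real (cutoff B y)"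

definition incr_symbol :: "real \<Rightarrow> real \<Rightarrow> real \<Rightarrow> real \<Rightarrow> real \<Rightarrow> complex" where
  "incr_symbol B p q x y = (cis (p * x + q * y) - 1) * cutoff_symbol B x y"

lemma cutoff_symbol_1: "B > 0 \<Longrightarrow> \<bar>x\<bar> \<le> B \<Longrightarrow> \<bar>y\<bar> \<le> B \<Longrightarrow> cutoff_symbol B x y = 1"
  by (simp add: cutoff_symbol_def cutoff_1)

lemma cutoff_symbol_0: "B > 0 \<Longrightarrow> \<bar>x\<bar> > 2 * B \<or> \<bar>y\<bar> > 2 * B \<Longrightarrow> cutoff_symbol B x y = 0"
  by (auto simp: cutoff_symbol_def cutoff_0)

lemma dbounded_cutoff_symbol: "B \<ge> 1 \<Longrightarrow> dbounded 1 (cutoff_symbol B)"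
  using dbounded_tensor[OF lip_cutoff lip_cutoff, of B B] unfolding cutoff_symbol_def by simp

text \<open>From e^(i(px + qy)) - 1 = (e^(ipx) - 1) e^(iqy) + (e^(iqy) - 1): each summand is a
  tensor product with one small factor. The constant is 8 + 4, and \<open>H \<le> 1\<close> keeps
  the oscillating factor 1-Lipschitz.\<close>

lemma dbounded_incr_symbol:
  assumes B: "B \<ge> 1" and pq: "\<bar>p\<bar> \<le> H" "\<bar>q\<bar> \<le> H" "H \<le> 1"
  shows "dbounded (12 * B * H) (incr_symbol B p q)"
proof -
  have "dbounded ((4 * B * \<bar>p\<bar>) * (2 * 1 * 1)) (\<lambda>x y. ((cis (p * x) - 1) * complex_of_real (cutoff B x)) * (cis (q * y) * complex_of_real (cutoff B y)))"
    using pq B by (intro dbounded_tensor lip_cis_minus_1_cutoff lip_mult lip_cis lip_cutoff) auto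
  moreover have "dbounded (1 * (4 * B * \<bar>q\<bar>)) (\<lambda>x y. complex_of_real (cutoff B x) * ((cis (q * y) - 1) * complex_of_real (cutoff B y)))"
    using pq B by (intro dbounded_tensor lip_cis_minus_1_cutoff lip_cutoff) auto
  ultimately have "dbounded ((4 * B * \<bar>p\<bar>) * (2 * 1 * 1) + 1 * (4 * B * \<bar>q\<bar>))
     (\<lambda>x y. ((cis (p * x) - 1) * complex_of_real (cutoff B x)) * (cis (q * y) * complex_of_real (cutoff B y))
       + complex_of_real (cutoff B x) * ((cis (q * y) - 1) * complex_of_real (cutoff B y)))"
    by (rule dbounded_add)
  note 1 = this
  have 2: "(\<lambda>x y. ((cis (p * x) - 1) * complex_of_real (cutoff B x)) * (cis (q * y) * complex_of_real (cutoff B y))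
       + complex_of_real (cutoff B x) * ((cis (q * y) - 1) * complex_of_real (cutoff B y))) = incr_symbol B p q"
    by (simp add: fun_eq_iff incr_symbol_def cutoff_symbol_def cis_mult[symmetric] algebra_simps)
  have 3: "(4 * B * \<bar>p\<bar>) * (2 * 1 * 1) + 1 * (4 * B * \<bar>q\<bar>) \<le> 12 * B * H"
  proof -
    have "B * \<bar>p\<bar> \<le> B * H" "B * \<bar>q\<bar> \<le> B * H" using pq B by (auto intro!: mult_left_mono)
    then show ?thesis by linarith
  qed
  show ?thesis using dbounded_mono[OF 1 3] unfolding 2 .
qed

text \<open>The Riesz symbol, with \<open>1 / \<bar>\<xi>\<bar>\<close> replaced inside the unit disc by its first-order Taylor
  polynomial in \<open>\<bar>\<xi>\<bar>\<^sup>2\<close> at \<open>1\<close>, so that the mixed second differences stay controlled.\<close>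

definition rinv_sqrt :: "real \<Rightarrow> real" where
  "rinv_sqrt s = (if s \<ge> 1 then 1 / sqrt s else (3 - s) / 2)"

definition rriesz :: "real \<Rightarrow> real \<Rightarrow> real" where
  "rriesz x y = x * rinv_sqrt (x\<^sup>2 + y\<^sup>2)"

text \<open>The derivative of \<open>rinv_sqrt\<close> at the squared modulus is -1/2 times the
  inverse cube of this truncated modulus, which stays at least 1 and is Lipschitz with constant
  1.\<close>

definition rmodulus :: "real \<Rightarrow> real \<Rightarrow> real" where
  "rmodulus x y = max 1 (cmod (Complex x y))"

text \<open>Both branches have value 1 and slope -1/2 at 1, so the function is differentiable across
  the junction and one formula with \<open>max 1 s\<close> serves on both sides.\<close>

lemma rinv_sqrt_deriv: "(rinv_sqrt has_real_derivative - 1 / (2 * sqrt (max 1 s) ^ 3)) (at s)"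
proof -
  have A: "((\<lambda>s. 1 / sqrt s) has_real_derivative - 1 / (2 * sqrt s ^ 3)) (at s)" if "s > 0" for s :: real
    using that by (auto intro!: derivative_eq_intros simp: power3_eq_cube field_simps power2_eq_square)
  have B: "((\<lambda>s. (3 - s) / 2) has_real_derivative - 1 / 2) (at s)" for s :: real
    by (auto intro!: derivative_eq_intros)
  consider "s > 1" | "s < 1" | "s = 1" by linarith
  then show ?thesis
  proof cases
    case 1
    have "eventually (\<lambda>x. 1 / sqrt x = rinv_sqrt x) (nhds s)"
      using eventually_nhds_in_open[of "{1<..}" s] 1 by (auto elim!: eventually_mono simp: rinv_sqrt_def)
    then show ?thesis using A[of s] 1 by (subst DERIV_cong_ev[OF refl, symmetric]) auto
  next
    case 2
    have "eventually (\<lambda>x. (3 - x) / 2 = rinv_sqrt x) (nhds s)"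
      using eventually_nhds_in_open[of "{..<1}" s] 2 by (auto elim!: eventually_mono simp: rinv_sqrt_def)
    then show ?thesis using B[of s] 2 by (subst DERIV_cong_ev[OF refl, symmetric]) auto
  next
    case 3
    have r: "((\<lambda>x. (1 / sqrt x - 1 / sqrt 1) / (x - 1)) \<longlongrightarrow> - 1 / 2) (at 1)"
      using A[of 1] by (simp add: has_field_derivative_iff)
    have l: "((\<lambda>x. ((3 - x) / 2 - (3 - 1) / 2) / (x - 1)) \<longlongrightarrow> - 1 / 2) (at (1::real))"
      using B[of 1] by (simp add: has_field_derivative_iff)
    have "((\<lambda>x. (rinv_sqrt x - rinv_sqrt 1) / (x - 1)) \<longlongrightarrow> - 1 / 2) (at 1)"
    proof (rule filterlim_split_at)
      have "((\<lambda>x. (1 / sqrt x - 1 / sqrt 1) / (x - 1)) \<longlongrightarrow> - 1 / 2) (at_right 1)"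
        using r by (rule filterlim_mono) (auto simp: at_le)
      then show "((\<lambda>x. (rinv_sqrt x - rinv_sqrt 1) / (x - 1)) \<longlongrightarrow> - 1 / 2) (at_right 1)"
        by (rule Lim_transform_eventually) (auto simp: eventually_at_filter rinv_sqrt_def)
      have "((\<lambda>x. ((3 - x) / 2 - (3 - 1) / 2) / (x - 1)) \<longlongrightarrow> - 1 / 2) (at_left (1::real))"
        using l by (rule filterlim_mono) (auto simp: at_le)
      then show "((\<lambda>x. (rinv_sqrt x - rinv_sqrt 1) / (x - 1)) \<longlongrightarrow> - 1 / 2) (at_left 1)"
        by (rule Lim_transform_eventually) (auto simp: eventually_at_filter rinv_sqrt_def)
    qed
    then show ?thesis using 3 by (simp add: has_field_derivative_iff)
  qed
qed

lemma rmodulus_bounds: "rmodulus x y \<ge> 1" "\<bar>x\<bar> \<le> rmodulus x y" "\<bar>y\<bar> \<le> rmodulus x y"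
  using abs_Re_le_cmod[of "Complex x y"] abs_Im_le_cmod[of "Complex x y"] by (auto simp: rmodulus_def)

lemma sqrt_max_rmodulus: "sqrt (max 1 (x\<^sup>2 + y\<^sup>2)) = rmodulus x y"
proof -
  have "cmod (Complex x y) = sqrt (x\<^sup>2 + y\<^sup>2)" by (simp add: cmod_def)
  then show ?thesis
    unfolding rmodulus_def max_def by auto
qed

lemma rmodulus_Lipschitz: "\<bar>rmodulus (x + u) y - rmodulus x y\<bar> \<le> \<bar>u\<bar>"
proof -
  have "\<bar>cmod (Complex (x + u) y) - cmod (Complex x y)\<bar> \<le> cmod (Complex (x + u) y - Complex x y)"
    by (rule norm_triangle_ineq3)
  also have "Complex (x + u) y - Complex x y = complex_of_real u" by (simp add: complex_eq_iff)
  finally show ?thesis unfolding rmodulus_def by simp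
qed

lemma rinv_sqrt_bounds: "s \<ge> 0 \<Longrightarrow> 0 \<le> rinv_sqrt s \<and> rinv_sqrt s \<le> 3 / 2"
proof -
  assume "s \<ge> 0"
  moreover have "0 \<le> 1 / sqrt s" "1 / sqrt s \<le> 3 / 2" if "s \<ge> 1"
  proof -
    have "1 \<le> sqrt s" using that by simp
    then have "1 / sqrt s \<le> 1" by (simp add: divide_le_eq_1)
    then show "0 \<le> 1 / sqrt s" "1 / sqrt s \<le> 3 / 2" using \<open>1 \<le> sqrt s\<close> by (simp, linarith)
  qed
  ultimately show ?thesis unfolding rinv_sqrt_def by (cases "s \<ge> 1") (simp_all only: if_True if_False, simp_all)
qed

definition rriesz_dy :: "real \<Rightarrow> real \<Rightarrow> real" where
  "rriesz_dy x y = - (x * y) / rmodulus x y ^ 3"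

lemma rriesz_deriv_y: "((\<lambda>y. rriesz x y) has_real_derivative rriesz_dy x y) (at y)"
proof -
  have "((\<lambda>y. x\<^sup>2 + y\<^sup>2) has_real_derivative 2 * y) (at y)"
    by (auto intro!: derivative_eq_intros)
  from DERIV_cmult[OF DERIV_chain'[OF this rinv_sqrt_deriv], of x] show ?thesis
    by (simp add: sqrt_max_rmodulus rriesz_dy_def rriesz_def)
qed

lemma rriesz_deriv_x: "((\<lambda>x. rriesz x y) has_real_derivative rinv_sqrt (x\<^sup>2 + y\<^sup>2) - x\<^sup>2 / rmodulus x y ^ 3) (at x)"
proof -
  have "((\<lambda>x. x\<^sup>2 + y\<^sup>2) has_real_derivative 2 * x) (at x)"
    by (auto intro!: derivative_eq_intros)
  from DERIV_mult[OF DERIV_ident DERIV_chain'[OF this rinv_sqrt_deriv]] show ?thesis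
    unfolding sqrt_max_rmodulus rriesz_def by (simp add: power2_eq_square)
qed

lemma rriesz_dy_decomp: "rriesz_dy x y = - ((x * (1 / rmodulus x y)) * (y * (1 / rmodulus x y)) * (1 / rmodulus x y))"
  by (simp add: rriesz_dy_def power3_eq_cube)

lemma rriesz_dy_bound: "\<bar>rriesz_dy x y\<bar> \<le> 1"
proof -
  have "\<bar>x * (1 / rmodulus x y)\<bar> \<le> 1" "\<bar>y * (1 / rmodulus x y)\<bar> \<le> 1" "\<bar>1 / rmodulus x y\<bar> \<le> 1"
    using rmodulus_bounds[where x = x and y = y] by (auto simp: abs_mult divide_le_eq)
  then have "\<bar>x * (1 / rmodulus x y)\<bar> * \<bar>y * (1 / rmodulus x y)\<bar> * \<bar>1 / rmodulus x y\<bar> \<le> 1"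
    by (intro mult_le_one mult_nonneg_nonneg) auto
  then show ?thesis unfolding rriesz_dy_decomp abs_minus by (simp only: abs_mult)
qed

text \<open>The mixed second derivative jumps across the unit circle, so a Lipschitz bound on the
  first derivative stands in for it. The product of three bounded factors in
  \<open>rriesz_dy_decomp\<close> is differenced one factor at a time, giving 2 + 1 + 1.\<close>

lemma rriesz_dy_Lipschitz: "\<bar>rriesz_dy (x + u) y - rriesz_dy x y\<bar> \<le> 4 * \<bar>u\<bar>"
proof -
  let ?M = "rmodulus x y" and ?M' = "rmodulus (x + u) y"
  let ?w = "1 / ?M" and ?w' = "1 / ?M'"
  have alg1: "(a + b) * c - a * d = b * c + a * (c - d)" for a b c d :: real by (simp add: algebra_simps)
  have alg2: "- (a' * b' * c') - - (a * b * c) = - ((a' - a) * (b' * c') + (a * (b' - b)) * c' + (a * b) * (c' - c))"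
    for a b c a' b' c' :: real by (simp add: algebra_simps)
  note b = rmodulus_bounds[where x = x and y = y] and b' = rmodulus_bounds[where x = "x + u" and y = y]
  have dw: "\<bar>?w' - ?w\<bar> = \<bar>?M' - ?M\<bar> / (?M' * ?M)"
  proof -
    have "?w' - ?w = (?M - ?M') / (?M' * ?M)" using b b' by (simp add: diff_frac_eq)
    then show ?thesis using b(1) b'(1) by (simp add: abs_mult abs_minus_commute)
  qed
  \<comment> \<open>A coordinate \<open>c\<close> may be large, but only up to \<open>?M\<close>,
    and the difference of the inverses has \<open>?M\<close> in its denominator.\<close>
  have cw: "\<bar>c\<bar> * \<bar>?w' - ?w\<bar> \<le> \<bar>u\<bar>" if "\<bar>c\<bar> \<le> ?M" for c
  proof -
    have "\<bar>c\<bar> * \<bar>?w' - ?w\<bar> \<le> ?M * (\<bar>u\<bar> / (?M' * ?M))"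
      unfolding dw using that b b' rmodulus_Lipschitz[of x u y] by (intro mult_mono divide_right_mono) auto
    also have "\<dots> = \<bar>u\<bar> / ?M'" using b by simp
    also have "\<dots> \<le> \<bar>u\<bar>" using b' by (simp add: divide_le_eq mult_le_cancel_left1)
    finally show ?thesis .
  qed
  define P where "P = x * ?w"
  define P' where "P' = (x + u) * ?w'"
  define Y where "Y = y * ?w"
  define Y' where "Y' = y * ?w'"
  have bounds: "\<bar>P\<bar> \<le> 1" "\<bar>P'\<bar> \<le> 1" "\<bar>Y\<bar> \<le> 1" "\<bar>Y'\<bar> \<le> 1" "\<bar>?w\<bar> \<le> 1" "\<bar>?w'\<bar> \<le> 1"
    using b b' by (auto simp: P_def P'_def Y_def Y'_def abs_mult divide_le_eq)
  have dP: "\<bar>P' - P\<bar> \<le> 2 * \<bar>u\<bar>"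
  proof -
    have "P' - P = u * ?w' + x * (?w' - ?w)" unfolding P_def P'_def by (rule alg1)
    then have "\<bar>P' - P\<bar> \<le> \<bar>u\<bar> * \<bar>?w'\<bar> + \<bar>x\<bar> * \<bar>?w' - ?w\<bar>" by (metis abs_mult abs_triangle_ineq)
    also have "\<dots> \<le> \<bar>u\<bar> * 1 + \<bar>u\<bar>" using bounds cw[of x] b by (intro add_mono mult_left_mono) auto
    finally show ?thesis by simp
  qed
  have dY: "\<bar>Y' - Y\<bar> \<le> \<bar>u\<bar>"
  proof -
    have "Y' - Y = y * (?w' - ?w)" unfolding Y_def Y'_def by (rule right_diff_distrib[symmetric])
    then show ?thesis using cw[of y] b by (simp add: abs_mult)
  qed
  have dw1: "\<bar>?w' - ?w\<bar> \<le> \<bar>u\<bar>" using cw[of 1] b by simp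
  have eq: "rriesz_dy (x + u) y - rriesz_dy x y = - ((P' - P) * (Y' * ?w') + (P * (Y' - Y)) * ?w' + (P * Y) * (?w' - ?w))"
    unfolding rriesz_dy_decomp P_def[symmetric] P'_def[symmetric] Y_def[symmetric] Y'_def[symmetric] by (rule alg2)
  have "\<bar>rriesz_dy (x + u) y - rriesz_dy x y\<bar> \<le> \<bar>P' - P\<bar> * \<bar>Y' * ?w'\<bar> + \<bar>P * (Y' - Y)\<bar> * \<bar>?w'\<bar> + \<bar>P * Y\<bar> * \<bar>?w' - ?w\<bar>"
    unfolding eq abs_mult[symmetric] by linarith
  also have "\<dots> \<le> (2 * \<bar>u\<bar>) * 1 + \<bar>u\<bar> * 1 + 1 * \<bar>u\<bar>"
  proof (intro add_mono mult_mono)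
    show "\<bar>Y' * ?w'\<bar> \<le> 1" unfolding abs_mult using bounds by (intro mult_le_one) auto
    show "\<bar>P * Y\<bar> \<le> 1" unfolding abs_mult using bounds by (intro mult_le_one) auto
    have "\<bar>P * (Y' - Y)\<bar> \<le> 1 * \<bar>u\<bar>" unfolding abs_mult using bounds dY by (intro mult_mono) auto
    then show "\<bar>P * (Y' - Y)\<bar> \<le> \<bar>u\<bar>" by simp
  qed (rule dP dw1 bounds abs_ge_zero zero_le_one mult_nonneg_nonneg zero_le_numeral)+
  finally show ?thesis by linarith
qed

lemma derivative_bound_increment:
  fixes f f' :: "real \<Rightarrow> real"
  assumes "\<And>t. (f has_real_derivative f' t) (at t)" "\<And>t. \<bar>f' t\<bar> \<le> B"
  shows "\<bar>f (x + u) - f x\<bar> \<le> B * \<bar>u\<bar>"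
proof -
  have "norm (f (x + u) - f x) \<le> B * norm (x + u - x)"
    by (rule field_differentiable_bound[of UNIV f f']) (use assms in auto)
  then show ?thesis by simp
qed

lemma dbounded_rriesz: "dbounded 5 (\<lambda>x y. complex_of_real (rriesz x y))"
  unfolding dbounded_def
proof (intro conjI allI)
  fix x y u v
  have px: "0 \<le> rinv_sqrt (x\<^sup>2 + y\<^sup>2)" "rinv_sqrt (x\<^sup>2 + y\<^sup>2) \<le> 3 / 2" for x y using rinv_sqrt_bounds[of "x\<^sup>2 + y\<^sup>2"] by auto
  have "\<bar>rriesz x y\<bar> \<le> 2"
  proof (cases "x\<^sup>2 + y\<^sup>2 \<ge> 1")
    case True
    have "\<bar>x\<bar> \<le> sqrt (x\<^sup>2 + y\<^sup>2)" by (rule real_le_rsqrt) simp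
    moreover have "sqrt (x\<^sup>2 + y\<^sup>2) > 0" using True by auto
    ultimately have "\<bar>x\<bar> / sqrt (x\<^sup>2 + y\<^sup>2) \<le> 1" by (simp add: divide_le_eq)
    moreover have "\<bar>rriesz x y\<bar> = \<bar>x\<bar> / sqrt (x\<^sup>2 + y\<^sup>2)"
      using True by (simp add: rriesz_def rinv_sqrt_def abs_mult)
    ultimately show ?thesis by linarith
  next
    case False
    then have "x\<^sup>2 \<le> 1" by (smt (verit) zero_le_power2)
    then have "\<bar>x\<bar> \<le> 1" by (simp add: abs_square_le_1)
    then have "\<bar>x\<bar> * rinv_sqrt (x\<^sup>2 + y\<^sup>2) \<le> 1 * (3 / 2)" using px[of x y] by (intro mult_mono) auto
    then show ?thesis using px[of x y] by (simp add: rriesz_def abs_mult)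
  qed
  then show "cmod (complex_of_real (rriesz x y)) \<le> 5" by simp
  have gx: "\<bar>rinv_sqrt (x\<^sup>2 + y\<^sup>2) - x\<^sup>2 / rmodulus x y ^ 3\<bar> \<le> 5" for x
  proof -
    have "\<bar>x\<^sup>2 / rmodulus x y ^ 3\<bar> \<le> 1"
    proof -
      have "x\<^sup>2 \<le> rmodulus x y ^ 2" using rmodulus_bounds[where x = x and y = y] by (metis abs_ge_zero power2_abs power_mono)
      also have "\<dots> \<le> rmodulus x y ^ 3" using rmodulus_bounds[where x = x and y = y] by (intro power_increasing) auto
      finally show ?thesis using rmodulus_bounds[where x = x and y = y] by (simp add: divide_le_eq)
    qed
    then show ?thesis using px[of x y] by linarith
  qed
  have "\<bar>rriesz (x + u) y - rriesz x y\<bar> \<le> 5 * \<bar>u\<bar>"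
    by (rule derivative_bound_increment[OF rriesz_deriv_x gx])
  then show "cmod (complex_of_real (rriesz (x + u) y) - complex_of_real (rriesz x y)) \<le> 5 * \<bar>u\<bar>"
    by (simp only: of_real_diff[symmetric] norm_of_real)
  have "\<bar>rriesz x (y + v) - rriesz x y\<bar> \<le> 1 * \<bar>v\<bar>"
    by (rule derivative_bound_increment[OF rriesz_deriv_y rriesz_dy_bound])
  then show "cmod (complex_of_real (rriesz x (y + v)) - complex_of_real (rriesz x y)) \<le> 5 * \<bar>v\<bar>"
    by (simp only: of_real_diff[symmetric] norm_of_real)
  \<comment> \<open>The mixed difference is an increment in the second variable of a difference in
    the first; the derivative of the latter is a difference of \<open>rriesz_dy\<close>.\<close>
  have "\<bar>(rriesz (x + u) (y + v) - rriesz x (y + v)) - (rriesz (x + u) y - rriesz x y)\<bar> \<le> 4 * \<bar>u\<bar> * \<bar>v\<bar>"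
    by (rule derivative_bound_increment[where f' = "\<lambda>t. rriesz_dy (x + u) t - rriesz_dy x t", OF _ rriesz_dy_Lipschitz])
       (intro DERIV_diff rriesz_deriv_y)
  also have "\<dots> \<le> 5 * \<bar>u\<bar> * \<bar>v\<bar>" by (intro mult_right_mono) auto
  finally have "\<bar>rriesz (x + u) (y + v) - rriesz (x + u) y - rriesz x (y + v) + rriesz x y\<bar> \<le> 5 * \<bar>u\<bar> * \<bar>v\<bar>"
    by (simp add: algebra_simps)
  then show "cmod (complex_of_real (rriesz (x + u) (y + v)) - complex_of_real (rriesz (x + u) y)
      - complex_of_real (rriesz x (y + v)) + complex_of_real (rriesz x y)) \<le> 5 * \<bar>u\<bar> * \<bar>v\<bar>"
    by (simp only: of_real_diff[symmetric] of_real_add[symmetric] norm_of_real)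
qed

section \<open>Increments of Littlewood--Paley blocks\<close>

abbreviation tmul :: "(real \<Rightarrow> real \<Rightarrow> complex) \<Rightarrow> (real^2 \<Rightarrow> complex) \<Rightarrow> real^2 \<Rightarrow> complex" where
  "tmul t c \<equiv> (\<lambda>k. t (k $ 1) (k $ 2) * c k)"

text \<open>\<open>t\<close> is a symbol homogeneous of degree 0, possibly singular at the origin;
  \<open>r\<close> is a regular stand-in for it outside the unit disc. By homogeneity every nonzero
  frequency can be scaled to where the two agree.\<close>

definition hsymbol :: "real \<Rightarrow> (real \<Rightarrow> real \<Rightarrow> complex) \<Rightarrow> (real \<Rightarrow> real \<Rightarrow> complex) \<Rightarrow> bool" where
  "hsymbol A t r \<longleftrightarrow> dbounded A r \<and> (\<forall>x y. x\<^sup>2 + y\<^sup>2 \<ge> 1 \<longrightarrow> r x y = t x y) \<and>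
     (\<forall>c x y. c > 0 \<longrightarrow> t (c * x) (c * y) = t x y)"

lemma norm_vec2: "norm (x :: real^2) = sqrt ((x $ 1)\<^sup>2 + (x $ 2)\<^sup>2)"
  by (simp add: norm_vec_def L2_set_def sum_2)

lemma hsymbol_one: "hsymbol 1 (\<lambda>x y. 1) (\<lambda>x y. 1)"
  by (simp add: hsymbol_def dbounded_const)

text \<open>The imaginary unit counts as a constant symbol, so \<open>dbounded_mult\<close> gives 4
  * 1 * 5 = 20.\<close>

lemma hsymbol_riesz_1: "hsymbol 20 (\<lambda>x y. \<i> * complex_of_real (x / sqrt (x\<^sup>2 + y\<^sup>2))) (\<lambda>x y. \<i> * complex_of_real (rriesz x y))"
proof -
  have "dbounded (4 * 1 * 5) (\<lambda>x y. \<i> * complex_of_real (rriesz x y))"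
    by (intro dbounded_mult dbounded_const dbounded_rriesz) simp
  moreover have "c * x / sqrt ((c * x)\<^sup>2 + (c * y)\<^sup>2) = x / sqrt (x\<^sup>2 + y\<^sup>2)" if "c > 0" for c x y :: real
    using that by (simp add: power_mult_distrib distrib_left[symmetric] real_sqrt_mult)
  ultimately show ?thesis
    by (auto simp: hsymbol_def rriesz_def rinv_sqrt_def simp del: of_real_divide of_real_mult)
qed

lemma hsymbol_swap: "hsymbol A t r \<Longrightarrow> hsymbol A (\<lambda>x y. t y x) (\<lambda>x y. r y x)"
  unfolding hsymbol_def using dbounded_swap[of A r] by (auto simp: add.commute)

lemma hsymbol_riesz_2: "hsymbol 20 (\<lambda>x y. \<i> * complex_of_real (y / sqrt (x\<^sup>2 + y\<^sup>2))) (\<lambda>x y. \<i> * complex_of_real (rriesz y x))"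
  using hsymbol_swap[OF hsymbol_riesz_1] by (simp add: add.commute)

lemma hsymbol_nonneg: "hsymbol A t r \<Longrightarrow> A \<ge> 0"
  unfolding hsymbol_def using dbounded_nonneg by blast

lemma trig_cong: "(\<And>k. k \<in> S \<Longrightarrow> c k = d k) \<Longrightarrow> trig S c = trig S d"
  unfolding trig_def by (auto intro!: ext sum.cong)

lemma N3_incr_le:
  assumes L: "L > 0" and [measurable]: "P \<in> borel_measurable borel" and per: "torus_periodic L P"
  shows "N3 L (incr h P) \<le> 8 * N3 L (P :: real^2 \<Rightarrow> complex)"
proof -
  have "N3 L (\<lambda>x. \<Sum>i\<in>{0::nat,1}. (if i = 0 then -1 else 1) * P (x + (if i = 0 then 0 else h)))
     \<le> ennreal ((\<Sum>i\<in>{0::nat,1}. cmod (if i = 0 then -1 else 1)) ^ 3) * N3 L P"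
    by (rule N3_sum_shift_le[OF L]) (use per in auto)
  then show ?thesis by (simp add: incr_def[abs_def])
qed

text \<open>Rescaling by the inner radius \<open>\<kappa>\<close> puts \<open>S\<close> outside the
  unit disc, where \<open>r\<close> may replace \<open>t\<close>, and inside the region where the
  cutoff is 1. The constant 336 is 42 * 4 * 2, from \<open>multiplier_N3\<close> with radius
  \<open>2 * B\<close> and the product rule; the increment symbol brings in 12 and a second factor
  \<open>B\<close>.\<close>

lemma block_multiplier:
  assumes t: "hsymbol A t r" and L: "L \<ge> 1" and a: "0 < a" "a \<le> \<kappa>" and \<beta>: "B \<ge> 1" "B \<ge> \<beta>" "B \<ge> 2 * pi / a"
    and S: "finite S" "S \<subseteq> freq L" and k: "\<And>k. k \<in> S \<Longrightarrow> \<kappa> \<le> norm k \<and> norm k \<le> \<beta> * \<kappa>"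
  shows "N3 L (trig S (tmul t c)) \<le> ennreal ((336 * A * B) ^ 3) * N3 L (trig S c)"
    and "\<kappa> * norm h \<le> 1 \<Longrightarrow> N3 L (incr h (trig S (tmul t c)))
       \<le> ennreal ((4032 * A * B\<^sup>2 * (\<kappa> * norm h)) ^ 3) * N3 L (trig S c)"
proof -
  have \<kappa>: "\<kappa> > 0" using a by simp
  have r: "dbounded A r" using t by (simp add: hsymbol_def)
  have tk: "r (1 / \<kappa> * k $ 1) (1 / \<kappa> * k $ 2) = t (k $ 1) (k $ 2)" "cutoff_symbol B (1 / \<kappa> * k $ 1) (1 / \<kappa> * k $ 2) = 1" if "k \<in> S" for k
  proof -
    have "(1 / \<kappa> * k $ 1)\<^sup>2 + (1 / \<kappa> * k $ 2)\<^sup>2 = (norm k / \<kappa>)\<^sup>2"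
      by (simp add: norm_vec2 power_divide power_mult_distrib add_divide_distrib)
    also have "\<dots> \<ge> 1" using k[OF that] \<kappa> by (intro one_le_power) (simp add: le_divide_eq)
    finally show "r (1 / \<kappa> * k $ 1) (1 / \<kappa> * k $ 2) = t (k $ 1) (k $ 2)"
    proof -
      assume "1 \<le> (1 / \<kappa> * k $ 1)\<^sup>2 + (1 / \<kappa> * k $ 2)\<^sup>2"
      then have "r (1 / \<kappa> * k $ 1) (1 / \<kappa> * k $ 2) = t (1 / \<kappa> * k $ 1) (1 / \<kappa> * k $ 2)"
        using t unfolding hsymbol_def by blast
      moreover have "1 / \<kappa> > 0" using \<kappa> by simp
      then have "t (1 / \<kappa> * k $ 1) (1 / \<kappa> * k $ 2) = t (k $ 1) (k $ 2)"
        using t unfolding hsymbol_def by blast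
      ultimately show ?thesis by simp
    qed
    have "\<bar>1 / \<kappa> * k $ i\<bar> \<le> B" for i
    proof -
      have "\<bar>k $ i\<bar> \<le> \<beta> * \<kappa>" using component_le_norm_cart[of k i] k[OF that] by linarith
      also have "\<dots> \<le> B * \<kappa>" using \<beta> \<kappa> by (intro mult_right_mono) auto
      finally show ?thesis using \<kappa> by (simp add: abs_mult divide_le_eq)
    qed
    then show "cutoff_symbol B (1 / \<kappa> * k $ 1) (1 / \<kappa> * k $ 2) = 1" using \<beta> by (intro cutoff_symbol_1) auto
  qed
  \<comment> \<open>\<open>L \<ge> 1\<close> bounds the rescaled lattice step from above; the third
    condition on \<open>B\<close> makes the support wide enough for it.\<close>
  have sp: "1 / \<kappa> * (2 * pi / L) \<le> 2 * B"
  proof -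
    have "1 / \<kappa> * (2 * pi / L) \<le> 1 / a * (2 * pi / 1)" using a L by (intro mult_mono divide_left_mono) auto
    then show ?thesis using \<beta> by simp
  qed
  have "N3 L (trig S (\<lambda>k. (r (1 / \<kappa> * k $ 1) (1 / \<kappa> * k $ 2) * cutoff_symbol B (1 / \<kappa> * k $ 1) (1 / \<kappa> * k $ 2)) * c k))
    \<le> ennreal ((42 * (4 * A * 1) * (2 * B)) ^ 3) * N3 L (trig S c)"
    using L \<kappa> \<beta> cutoff_symbol_0[of B] dbounded_mult[OF r dbounded_cutoff_symbol]
    by (intro multiplier_N3[where m = "\<lambda>x y. r x y * cutoff_symbol B x y"] S sp) auto
  moreover have "trig S (\<lambda>k. (r (1 / \<kappa> * k $ 1) (1 / \<kappa> * k $ 2) * cutoff_symbol B (1 / \<kappa> * k $ 1) (1 / \<kappa> * k $ 2)) * c k)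
    = trig S (tmul t c)"
    by (rule trig_cong) (simp only: tk mult_1_right)
  moreover have "42 * (4 * A * 1) * (2 * B) = 336 * A * B" by simp
  ultimately show "N3 L (trig S (tmul t c)) \<le> ennreal ((336 * A * B) ^ 3) * N3 L (trig S c)"
    by (simp only:)
  assume h: "\<kappa> * norm h \<le> 1"
  let ?e = "incr_symbol B (\<kappa> * h $ 1) (\<kappa> * h $ 2)"
  have hc: "\<bar>\<kappa> * h $ i\<bar> \<le> \<kappa> * norm h" for i
    using \<kappa> component_le_norm_cart[of h i] by (simp add: abs_mult)
  have "N3 L (trig S (\<lambda>k. (r (1 / \<kappa> * k $ 1) (1 / \<kappa> * k $ 2) * ?e (1 / \<kappa> * k $ 1) (1 / \<kappa> * k $ 2)) * c k))
    \<le> ennreal ((42 * (4 * A * (12 * B * (\<kappa> * norm h))) * (2 * B)) ^ 3) * N3 L (trig S c)"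
    using L \<kappa> \<beta> cutoff_symbol_0[of B] dbounded_mult[OF r dbounded_incr_symbol[OF \<beta>(1) hc hc h]]
    by (intro multiplier_N3[where m = "\<lambda>x y. r x y * ?e x y"] S sp) (auto simp: incr_symbol_def)
  moreover have "trig S (\<lambda>k. (r (1 / \<kappa> * k $ 1) (1 / \<kappa> * k $ 2) * ?e (1 / \<kappa> * k $ 1) (1 / \<kappa> * k $ 2)) * c k)
    = incr h (trig S (tmul t c))"
    unfolding incr_trig
  proof (rule trig_cong)
    fix k assume k: "k \<in> S"
    have "\<kappa> * h $ 1 * (1 / \<kappa> * k $ 1) + \<kappa> * h $ 2 * (1 / \<kappa> * k $ 2) = k \<bullet> h"
      using \<kappa> by (simp add: inner_vec_def sum_2 mult.commute)
    then have e: "?e (1 / \<kappa> * k $ 1) (1 / \<kappa> * k $ 2) = ew k h - 1"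
      unfolding incr_symbol_def ew_def by (simp only: tk[OF k] mult_1_right)
    show "(r (1 / \<kappa> * k $ 1) (1 / \<kappa> * k $ 2) * ?e (1 / \<kappa> * k $ 1) (1 / \<kappa> * k $ 2)) * c k = (ew k h - 1) * (t (k $ 1) (k $ 2) * c k)"
      unfolding tk(1)[OF k] e by (simp only: mult_ac)
  qed
  moreover have "42 * (4 * A * (12 * B * (\<kappa> * norm h))) * (2 * B) = 4032 * A * B\<^sup>2 * (\<kappa> * norm h)"
    by (simp add: power2_eq_square)
  ultimately show "N3 L (incr h (trig S (tmul t c)))
       \<le> ennreal ((4032 * A * B\<^sup>2 * (\<kappa> * norm h)) ^ 3) * N3 L (trig S c)"
    by (simp only:)
qed

text \<open>Interpolation: the increment is of order \<open>\<kappa> * norm h\<close> when this is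
  at most 1, and of order 1 by the triangle inequality otherwise. In both cases the p-th power is
  larger.\<close>

lemma block_increment:
  assumes t: "hsymbol A t r" and L: "L \<ge> 1" and a: "0 < a" "a \<le> \<kappa>" and \<beta>: "B \<ge> 1" "B \<ge> \<beta>" "B \<ge> 2 * pi / a"
    and S: "finite S" "S \<subseteq> freq L" and k: "\<And>k. k \<in> S \<Longrightarrow> \<kappa> \<le> norm k \<and> norm k \<le> \<beta> * \<kappa>"
    and p: "0 \<le> p" "p \<le> 1" and h: "h \<noteq> 0"
  shows "N3 L (incr h (trig S (tmul t c)))
       \<le> ennreal ((4032 * A * B\<^sup>2 * (\<kappa> * norm h) powr p) ^ 3) * N3 L (trig S c)"
proof (cases "\<kappa> * norm h \<le> 1")
  case True
  have A: "A \<ge> 0" using hsymbol_nonneg[OF t] .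
  have "(\<kappa> * norm h) powr 1 \<le> (\<kappa> * norm h) powr p"
    using True a h p by (intro powr_mono') auto
  then have "\<kappa> * norm h \<le> (\<kappa> * norm h) powr p" using a by simp
  then have "ennreal ((4032 * A * B\<^sup>2 * (\<kappa> * norm h)) ^ 3) \<le> ennreal ((4032 * A * B\<^sup>2 * (\<kappa> * norm h) powr p) ^ 3)"
    using A a by (intro ennreal_leI power_mono mult_left_mono) auto
  then show ?thesis
    using block_multiplier(2)[OF t L a \<beta> S k True, of c] by (meson mult_right_mono order_trans zero_le)
next
  case False
  have A: "A \<ge> 0" using hsymbol_nonneg[OF t] .
  have "N3 L (incr h (trig S (tmul t c))) \<le> 8 * N3 L (trig S (tmul t c))"
    using L torus_periodic_trig[OF _ S(2)] by (intro N3_incr_le) auto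
  also have "\<dots> \<le> 8 * (ennreal ((336 * A * B) ^ 3) * N3 L (trig S c))"
    by (intro mult_left_mono block_multiplier(1)[OF t L a \<beta> S k]) auto
  also have "\<dots> = ennreal (8 * (336 * A * B) ^ 3) * N3 L (trig S c)"
    using A \<beta> by (simp add: ennreal_mult' mult.assoc)
  also have "\<dots> \<le> ennreal ((4032 * A * B\<^sup>2 * (\<kappa> * norm h) powr p) ^ 3) * N3 L (trig S c)"
  proof (intro mult_right_mono ennreal_leI)
    have "1 \<le> (\<kappa> * norm h) powr p" using False p by (intro ge_one_powr_ge_zero) auto
    moreover have "B \<le> B\<^sup>2" using \<beta> by (simp add: power2_eq_square)
    ultimately have "B * 1 \<le> B\<^sup>2 * (\<kappa> * norm h) powr p" using \<beta> by (intro mult_mono) auto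
    then have "672 * A * B \<le> 4032 * A * (B\<^sup>2 * (\<kappa> * norm h) powr p)"
      using A \<beta> by (intro mult_mono) auto
    then have "(672 * A * B) ^ 3 \<le> (4032 * A * B\<^sup>2 * (\<kappa> * norm h) powr p) ^ 3"
      using A \<beta> by (intro power_mono) (auto simp: mult.assoc)
    moreover have "8 * (336 * A * B) ^ 3 = (672 * A * B) ^ 3" by (simp add: power3_eq_cube)
    ultimately show "8 * (336 * A * B) ^ 3 \<le> (4032 * A * B\<^sup>2 * (\<kappa> * norm h) powr p) ^ 3" by simp
  qed auto
  finally show ?thesis .
qed

text \<open>Hoelder with free positive weights, in the role of the triangle inequality for cubes of
  norms.\<close>

lemma N3_sum_le:
  assumes I: "finite I" and w: "\<And>i. i \<in> I \<Longrightarrow> w i > 0" and [measurable]: "\<And>i. i \<in> I \<Longrightarrow> (v i :: real^2 \<Rightarrow> complex) \<in> borel_measurable borel"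
  shows "N3 L (\<lambda>x. \<Sum>i\<in>I. v i x) \<le> ennreal ((\<Sum>i\<in>I. w i)\<^sup>2) * (\<Sum>i\<in>I. ennreal (1 / (w i)\<^sup>2) * N3 L (v i))"
proof -
  have "N3 L (\<lambda>x. \<Sum>i\<in>I. v i x)
    \<le> (\<integral>\<^sup>+x. ennreal ((\<Sum>i\<in>I. w i)\<^sup>2) * (\<Sum>i\<in>I. ennreal (1 / (w i)\<^sup>2) * ennreal (norm (v i x) ^ 3)) \<partial>tm L)"
    unfolding N3_def
  proof (rule nn_integral_mono)
    fix x
    have "norm (\<Sum>i\<in>I. v i x) ^ 3 \<le> (\<Sum>i\<in>I. w i * (norm (v i x) / w i)) ^ 3"
    proof (intro power_mono order_trans[OF norm_sum] sum_mono)
      fix i assume "i \<in> I"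
      then show "norm (v i x) \<le> w i * (norm (v i x) / w i)" using w[of i] by simp
    qed auto
    also have "\<dots> \<le> (\<Sum>i\<in>I. w i)\<^sup>2 * (\<Sum>i\<in>I. w i * (norm (v i x) / w i) ^ 3)"
      using w by (intro sum_weighted_cube_le) (auto simp: less_imp_le)
    also have "(\<Sum>i\<in>I. w i * (norm (v i x) / w i) ^ 3) = (\<Sum>i\<in>I. 1 / (w i)\<^sup>2 * norm (v i x) ^ 3)"
      using w by (intro sum.cong) (auto simp: power_divide power3_eq_cube power2_eq_square)
    finally show "ennreal (norm (\<Sum>i\<in>I. v i x) ^ 3)
      \<le> ennreal ((\<Sum>i\<in>I. w i)\<^sup>2) * (\<Sum>i\<in>I. ennreal (1 / (w i)\<^sup>2) * ennreal (norm (v i x) ^ 3))"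
      by (simp add: ennreal_mult[symmetric] sum_nonneg ennreal_leI)
  qed
  also have "\<dots> = ennreal ((\<Sum>i\<in>I. w i)\<^sup>2) * (\<Sum>i\<in>I. ennreal (1 / (w i)\<^sup>2) * N3 L (v i))"
    by (simp add: nn_integral_cmult nn_integral_sum N3_def)
  finally show ?thesis .
qed

lemma sum_half_powers_le: "(\<Sum>i\<le>n. (1 / 2) ^ i) \<le> (2::real)"
proof -
  have "(\<Sum>i\<le>n. (1 / 2) ^ i) = 2 - (1 / 2 :: real) ^ n" by (induction n) auto
  then show ?thesis by simp
qed

lemma norm_freq_ge:
  assumes L: "L > 0" and k: "k \<in> freq L" "k \<noteq> 0"
  shows "norm k \<ge> 2 * pi / L"
proof -
  obtain i where i: "k $ i \<noteq> 0" using k(2) by (auto simp: vec_eq_iff)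
  obtain m :: int where m: "k $ i = 2 * pi / L * real_of_int m" using k(1) unfolding freq_def by blast
  have "m \<noteq> 0" using i m by auto
  then have "1 \<le> real_of_int \<bar>m\<bar>" by linarith
  then have "2 * pi / L * 1 \<le> 2 * pi / L * real_of_int \<bar>m\<bar>" using L by (intro mult_left_mono) auto
  also have "\<dots> = \<bar>k $ i\<bar>" using L m by (simp add: abs_mult)
  also have "\<dots> \<le> norm k" by (rule component_le_norm_cart)
  finally show ?thesis by simp
qed

text \<open>Near the origin \<open>t\<close> is singular; on the lattice it is the telescoping sum of the dilates of
  \<open>r(2\<xi>) - r(\<xi>)\<close>, which is supported in the unit disc. The \<open>i\<close>-th dilate lives at frequency \<open>2\<^sup>-\<^sup>i\<close>
  and contributes \<open>O(2\<^sup>-\<^sup>i\<bar>h\<bar>)\<close> to the increment.\<close>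

lemma low_block_increment:
  assumes t: "hsymbol A t r" and L: "L \<ge> 1" and B: "B \<ge> 2 * pi" "B \<ge> R"
    and S: "finite S" "S \<subseteq> freq L" and k: "\<And>k. k \<in> S \<Longrightarrow> norm k \<le> R" and h: "norm h \<le> 1"
  shows "N3 L (incr h (trig S (tmul t c))) \<le> ennreal ((161280 * A * B\<^sup>2 * norm h) ^ 3) * N3 L (trig S c)"
proof -
  have A: "A \<ge> 0" using hsymbol_nonneg[OF t] .
  have B1: "B \<ge> 1" using B pi_ge_two by linarith
  have r: "dbounded A r" using t by (simp add: hsymbol_def)
  \<comment> \<open>The number of doublings that moves every nonzero lattice frequency out of the
    unit disc, where \<open>r\<close> equals \<open>t\<close>. It grows with \<open>L\<close>, but
    the geometric decay makes the sum insensitive to it. Minimality keeps the rescaled lattice step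
    below 1 for all smaller indices, as \<open>multiplier_N3\<close> requires.\<close>
  define n where "n = (LEAST n::nat. 2 ^ n * (2 * pi / L) \<ge> 1)"
  have "\<exists>n::nat. 2 ^ n * (2 * pi / L) \<ge> 1"
  proof -
    obtain n where "L / (2 * pi) < 2 ^ n" using real_arch_pow[of 2 "L / (2 * pi)"] by auto
    then have "2 ^ n * (2 * pi / L) \<ge> 1" using L by (simp add: field_simps)
    then show ?thesis by blast
  qed
  then have n: "2 ^ n * (2 * pi / L) \<ge> 1" unfolding n_def by (rule LeastI_ex)
  have less_n: "2 ^ i * (2 * pi / L) < 1" if "i < n" for i
    using not_less_Least[of i "\<lambda>n. 2 ^ n * (2 * pi / L) \<ge> 1"] that unfolding n_def by simp
  define D where "D x y = r (2 * x) (2 * y) + (-1) * r x y" for x y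
  have D: "dbounded (8 * A) D"
  proof -
    have "dbounded (4 * A + 4 * 1 * A) D" unfolding D_def by (intro dbounded_add dbounded_dilate dbounded_mult dbounded_const r) simp
    then show ?thesis by simp
  qed
  have D0: "D x y = 0" if "x\<^sup>2 + y\<^sup>2 \<ge> 1" for x y
  proof -
    have "(2 * x)\<^sup>2 + (2 * y)\<^sup>2 \<ge> 1" using that by (simp add: power_mult_distrib)
    then show ?thesis using t that unfolding D_def hsymbol_def by simp
  qed
  \<comment> \<open>\<open>h\<close> is divided by \<open>2 ^ i\<close> because the symbol is
    evaluated at \<open>2 ^ i\<close> times the frequency; this division is the source of the decay
    in \<open>i\<close>.\<close>
  define e where "e i = incr_symbol B (h $ 1 / 2 ^ i) (h $ 2 / 2 ^ i)" for i :: nat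
  have e: "dbounded (12 * B * (norm h / 2 ^ i)) (e i)" for i
    unfolding e_def
  proof (rule dbounded_incr_symbol[OF B1])
    have "\<bar>h $ j\<bar> / 2 ^ i \<le> norm h / 2 ^ i" for j by (intro divide_right_mono component_le_norm_cart) auto
    then show "\<bar>h $ 1 / 2 ^ i\<bar> \<le> norm h / 2 ^ i" "\<bar>h $ 2 / 2 ^ i\<bar> \<le> norm h / 2 ^ i" by (simp_all add: abs_mult)
    have "norm h \<le> 2 ^ i" using h one_le_power[of "2::real" i] by linarith
    then show "norm h / 2 ^ i \<le> 1" by (simp add: divide_le_eq)
  qed
  have e0: "e i x y = 0" if "\<bar>x\<bar> > 2 * B \<or> \<bar>y\<bar> > 2 * B" for i x y
    using cutoff_symbol_0[of B] B1 that unfolding e_def incr_symbol_def by simp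
  \<comment> \<open>Index 0 carries the initial value of the telescoping sum, index
    \<open>Suc j\<close> its j-th difference.\<close>
  define y where "y i k = (case i of 0 \<Rightarrow> r (k $ 1) (k $ 2) * e 0 (k $ 1) (k $ 2)
     | Suc j \<Rightarrow> D (2 ^ j * k $ 1) (2 ^ j * k $ 2) * e j (2 ^ j * k $ 1) (2 ^ j * k $ 2))" for i :: nat and k :: "real^2"
  define v where "v i = trig S (\<lambda>k. y i k * c k)" for i
  \<comment> \<open>Large enough for both kinds of term: index 0 contributes \<open>C / 20\<close>,
    and index \<open>i > 0\<close> contributes 4/5 of \<open>C * (1 / 2) ^ i\<close>.\<close>
  define C where "C = 80640 * A * B\<^sup>2 * norm h"
  have C: "C \<ge> 0" unfolding C_def using A by simp
  have v: "N3 L (v i) \<le> ennreal ((C * (1 / 2) ^ i) ^ 3) * N3 L (trig S c)" if i: "i \<le> n" for i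
  proof (cases i)
    case 0
    have "N3 L (trig S (\<lambda>k. (r (1 * k $ 1) (1 * k $ 2) * e 0 (1 * k $ 1) (1 * k $ 2)) * c k))
      \<le> ennreal ((42 * (4 * A * (12 * B * (norm h / 2 ^ 0))) * (2 * B)) ^ 3) * N3 L (trig S c)"
    proof (intro multiplier_N3[where m = "\<lambda>x y. r x y * e 0 x y"] S dbounded_mult r e)
      have "2 * pi / L \<le> 2 * pi / 1" using L by (intro divide_left_mono) auto
      then show "1 * (2 * pi / L) \<le> 2 * B" using B B1 by linarith
    qed (use L e0 in auto)
    also have "\<dots> \<le> ennreal ((C * (1 / 2) ^ i) ^ 3) * N3 L (trig S c)"
    proof (intro mult_right_mono ennreal_leI)
      have "42 * (4 * A * (12 * B * (norm h / 2 ^ 0))) * (2 * B) = C / 20"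
        by (simp add: C_def power2_eq_square)
      moreover have "(C / 20) ^ 3 \<le> C ^ 3" using C by (intro power_mono) auto
      ultimately show "(42 * (4 * A * (12 * B * (norm h / 2 ^ 0))) * (2 * B)) ^ 3 \<le> (C * (1 / 2) ^ i) ^ 3"
        using 0 by (simp only: power_0 mult_1_right)
    qed auto
    finally show ?thesis using 0 by (simp add: v_def y_def)
  next
    case (Suc j)
    have "N3 L (trig S (\<lambda>k. (D (2 ^ j * k $ 1) (2 ^ j * k $ 2) * e j (2 ^ j * k $ 1) (2 ^ j * k $ 2)) * c k))
      \<le> ennreal ((42 * (4 * (8 * A) * (12 * B * (norm h / 2 ^ j))) * (2 * B)) ^ 3) * N3 L (trig S c)"
    proof (intro multiplier_N3[where m = "\<lambda>x y. D x y * e j x y"] S dbounded_mult D e)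
      show "2 ^ j * (2 * pi / L) \<le> 2 * B" using less_n[of j] i Suc B1 by linarith
    qed (use L e0 in auto)
    also have "\<dots> \<le> ennreal ((C * (1 / 2) ^ i) ^ 3) * N3 L (trig S c)"
    proof (intro mult_right_mono ennreal_leI)
      have "42 * (4 * (8 * A) * (12 * B * (norm h / 2 ^ j))) * (2 * B) = 4 / 5 * (C * (1 / 2) ^ i)"
        using Suc by (simp add: C_def power2_eq_square power_divide)
      moreover have "(4 / 5 * (C * (1 / 2) ^ i)) ^ 3 \<le> (C * (1 / 2) ^ i) ^ 3"
        using C by (intro power_mono) auto
      ultimately show "(42 * (4 * (8 * A) * (12 * B * (norm h / 2 ^ j))) * (2 * B)) ^ 3 \<le> (C * (1 / 2) ^ i) ^ 3"
        by (simp only:)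
    qed auto
    finally show ?thesis using Suc by (simp add: v_def y_def)
  qed
  have "incr h (trig S (tmul t c)) = (\<lambda>x. \<Sum>i\<le>n. v i x)"
  proof -
    have "(ew k h - 1) * (t (k $ 1) (k $ 2) * c k) = (\<Sum>i\<le>n. y i k * c k)" if kS: "k \<in> S" for k
    proof -
      have ph: "h $ 1 / 2 ^ j * (2 ^ j * k $ 1) + h $ 2 / 2 ^ j * (2 ^ j * k $ 2) = k \<bullet> h" for j :: nat
        by (simp add: inner_vec_def sum_2 mult.commute)
      have E0: "e 0 (k $ 1) (k $ 2) = ew k h - 1"
      proof -
        have "\<bar>k $ i\<bar> \<le> B" for i using component_le_norm_cart[of k i] k[OF kS] B by linarith
        then have "cutoff_symbol B (k $ 1) (k $ 2) = 1" using B1 by (intro cutoff_symbol_1) auto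
        then show ?thesis using ph[of 0] unfolding e_def incr_symbol_def ew_def by simp
      qed
      \<comment> \<open>Either the point lies outside the unit disc and \<open>D\<close> vanishes,
        or it lies inside, where the cutoff equals 1.\<close>
      have ED: "D (2 ^ j * k $ 1) (2 ^ j * k $ 2) * e j (2 ^ j * k $ 1) (2 ^ j * k $ 2)
         = D (2 ^ j * k $ 1) (2 ^ j * k $ 2) * (ew k h - 1)" for j
      proof (cases "(2 ^ j * k $ 1)\<^sup>2 + (2 ^ j * k $ 2)\<^sup>2 \<ge> 1")
        case True then show ?thesis by (simp add: D0)
      next
        case False
        then have "(2 ^ j * k $ 1)\<^sup>2 \<le> 1" "(2 ^ j * k $ 2)\<^sup>2 \<le> 1"
          using zero_le_power2[of "2 ^ j * k $ 1"] zero_le_power2[of "2 ^ j * k $ 2"] by linarith+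
        then have "\<bar>2 ^ j * k $ 1\<bar> \<le> 1" "\<bar>2 ^ j * k $ 2\<bar> \<le> 1" by (simp_all only: abs_square_le_1)
        then have "cutoff_symbol B (2 ^ j * k $ 1) (2 ^ j * k $ 2) = 1" using B1 by (intro cutoff_symbol_1) linarith+
        then show ?thesis using ph[of j] unfolding e_def incr_symbol_def ew_def by simp
      qed
      define R' where "R' j = r (2 ^ j * k $ 1) (2 ^ j * k $ 2)" for j :: nat
      have DR: "D (2 ^ j * k $ 1) (2 ^ j * k $ 2) = R' (Suc j) - R' j" for j
        by (simp add: D_def R'_def mult.assoc)
      have "(\<Sum>i\<le>n. y i k * c k)
        = (R' 0 + (\<Sum>j<n. R' (Suc j) - R' j)) * (ew k h - 1) * c k"
      proof -
        have "(\<Sum>i<n. D (2 ^ i * k $ 1) (2 ^ i * k $ 2) * e i (2 ^ i * k $ 1) (2 ^ i * k $ 2) * c k)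
          = (\<Sum>j<n. R' (Suc j) - R' j) * (ew k h - 1) * c k"
          unfolding ED unfolding DR by (simp only: sum_distrib_right)
        moreover have "r (k $ 1) (k $ 2) = R' 0" by (simp add: R'_def)
        ultimately show ?thesis
          unfolding lessThan_Suc_atMost[symmetric] sum.lessThan_Suc_shift by (simp add: y_def E0 distrib_right)
      qed
      also have "\<dots> = R' n * (ew k h - 1) * c k"
        by (simp add: sum_lessThan_telescope)
      also have "\<dots> = (ew k h - 1) * (t (k $ 1) (k $ 2) * c k)"
      \<comment> \<open>At the zero frequency the factor \<open>ew k h - 1\<close> vanishes, so the
        value of \<open>t\<close> there is immaterial.\<close>
      proof (cases "k = 0")
        case False
        have "(2 ^ n * k $ 1)\<^sup>2 + (2 ^ n * k $ 2)\<^sup>2 = (2 ^ n * norm k)\<^sup>2"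
          by (simp add: norm_vec2 power_mult_distrib distrib_left)
        also have "\<dots> \<ge> 1"
        proof (rule one_le_power)
          have "2 ^ n * (2 * pi / L) \<le> 2 ^ n * norm k"
            using norm_freq_ge[of L k] False kS S(2) L by (intro mult_left_mono) auto
          then show "1 \<le> 2 ^ n * norm k" using n by linarith
        qed
        finally have "R' n = t (k $ 1) (k $ 2)" using t unfolding R'_def hsymbol_def by simp
        then show ?thesis by (simp add: mult_ac)
      qed simp
      finally show ?thesis by simp
    qed
    then have "incr h (trig S (tmul t c)) = trig S (\<lambda>k. \<Sum>i\<le>n. y i k * c k)"
      unfolding incr_trig by (rule trig_cong)
    also have "\<dots> = (\<lambda>x. \<Sum>i\<le>n. v i x)"
      unfolding v_def trig_def by (subst sum.swap) (simp add: sum_distrib_right)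
    finally show ?thesis .
  qed
  then have "N3 L (incr h (trig S (tmul t c))) = N3 L (\<lambda>x. \<Sum>i\<le>n. v i x)" by simp
  \<comment> \<open>With weights 2^(-i) the cubes of order 8^(-i) are multiplied by 4^i, which
    leaves a convergent geometric sum.\<close>
  also have "\<dots> \<le> ennreal ((\<Sum>i\<le>n. (1 / 2) ^ i)\<^sup>2) * (\<Sum>i\<le>n. ennreal (1 / ((1 / 2) ^ i)\<^sup>2) * N3 L (v i))"
    by (rule N3_sum_le) (auto simp: v_def)
  also have "\<dots> \<le> ennreal (2\<^sup>2) * (\<Sum>i\<le>n. ennreal (C ^ 3 * (1 / 2) ^ i) * N3 L (trig S c))"
  proof (rule mult_mono[OF _ sum_mono])
    show "ennreal ((\<Sum>i\<le>n. (1 / 2) ^ i)\<^sup>2) \<le> ennreal (2\<^sup>2)"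
      by (intro ennreal_leI power_mono sum_half_powers_le sum_nonneg) auto
    fix i assume "i \<in> {..n}"
    then have "ennreal (1 / ((1 / 2) ^ i)\<^sup>2) * N3 L (v i)
      \<le> ennreal (1 / ((1 / 2) ^ i)\<^sup>2) * (ennreal ((C * (1 / 2) ^ i) ^ 3) * N3 L (trig S c))"
      by (intro mult_left_mono v) auto
    also have "\<dots> = ennreal (1 / ((1 / 2) ^ i)\<^sup>2 * ((C * (1 / 2) ^ i) ^ 3)) * N3 L (trig S c)"
      using C by (subst ennreal_mult) (auto simp: mult.assoc)
    also have "1 / ((1 / 2) ^ i)\<^sup>2 * ((C * (1 / 2) ^ i) ^ 3) = C ^ 3 * (1 / 2) ^ i"
      by (simp add: power_mult_distrib power2_eq_square power3_eq_cube)
    finally show "ennreal (1 / ((1 / 2) ^ i)\<^sup>2) * N3 L (v i) \<le> ennreal (C ^ 3 * (1 / 2) ^ i) * N3 L (trig S c)" .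
  qed (auto intro!: sum_nonneg)
  also have "\<dots> = ennreal (4 * (C ^ 3 * (\<Sum>i\<le>n. (1 / 2) ^ i))) * N3 L (trig S c)"
    using C by (simp add: sum_distrib_right[symmetric] sum_ennreal sum_distrib_left[symmetric] ennreal_mult sum_nonneg mult.assoc)
  also have "\<dots> \<le> ennreal ((2 * C) ^ 3) * N3 L (trig S c)"
  proof (intro mult_right_mono ennreal_leI)
    have "(\<Sum>i\<le>n. (1 / 2) ^ i) \<le> (2::real)"
      by (rule sum_half_powers_le)
    then have "C ^ 3 * (\<Sum>i\<le>n. (1 / 2) ^ i) \<le> C ^ 3 * 2" using C by (intro mult_left_mono) auto
    then show "4 * (C ^ 3 * (\<Sum>i\<le>n. (1 / 2) ^ i)) \<le> (2 * C) ^ 3" by (simp add: power_mult_distrib)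
  qed auto
  also have "2 * C = 161280 * A * B\<^sup>2 * norm h" by (simp add: C_def)
  finally show ?thesis .
qed

section \<open>Weighted series of functions\<close>

text \<open>The right-hand side of Hoelder's inequality with geometric weights. It controls the cube
  of the sum of absolute values pointwise and can be integrated termwise, so finiteness of
  \<open>wN3\<close> yields both convergence almost everywhere and an integrable majorant.\<close>

definition wcubes :: "real \<Rightarrow> (nat \<Rightarrow> real^2 \<Rightarrow> complex) \<Rightarrow> real^2 \<Rightarrow> ennreal" where
  "wcubes w Q x = (\<Sum>i. ennreal (1 / (w ^ i)\<^sup>2) * ennreal (norm (Q i x) ^ 3))"

lemma borel_measurable_wcubes [measurable]:
  assumes [measurable]: "\<And>i. Q i \<in> borel_measurable borel"
  shows "wcubes w Q \<in> borel_measurable borel"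
  unfolding wcubes_def by measurable

abbreviation wN3 :: "real \<Rightarrow> real \<Rightarrow> (nat \<Rightarrow> real^2 \<Rightarrow> complex) \<Rightarrow> ennreal" where
  "wN3 w L Q \<equiv> (\<Sum>i. ennreal (1 / (w ^ i)\<^sup>2) * N3 L (Q i))"

lemma nn_integral_wcubes:
  assumes [measurable]: "\<And>i. Q i \<in> borel_measurable borel"
  shows "(\<integral>\<^sup>+x. wcubes w Q x \<partial>tm L) = wN3 w L Q"
  unfolding wcubes_def N3_def by (subst nn_integral_suminf) (auto simp: nn_integral_cmult)

lemma sum_norm_cube_le_wcubes:
  assumes w: "0 < w" "w < 1"
  shows "ennreal ((\<Sum>i<n. norm (Q i x)) ^ 3) \<le> ennreal (1 / (1 - w)\<^sup>2) * wcubes w Q x"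
proof -
  have geo: "(\<Sum>i<n. w ^ i) \<le> 1 / (1 - w)"
  proof -
    have "(\<Sum>i<n. w ^ i) \<le> (\<Sum>i. w ^ i)" using w by (intro sum_le_suminf) (auto intro: summable_geometric)
    then show ?thesis using w by (simp add: suminf_geometric)
  qed
  have "(\<Sum>i<n. norm (Q i x)) ^ 3 = (\<Sum>i<n. w ^ i * (norm (Q i x) / w ^ i)) ^ 3" using w by simp
  also have "\<dots> \<le> (\<Sum>i<n. w ^ i)\<^sup>2 * (\<Sum>i<n. w ^ i * (norm (Q i x) / w ^ i) ^ 3)"
    using w by (intro sum_weighted_cube_le) auto
  also have "(\<Sum>i<n. w ^ i * (norm (Q i x) / w ^ i) ^ 3) = (\<Sum>i<n. 1 / (w ^ i)\<^sup>2 * norm (Q i x) ^ 3)"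
    using w by (intro sum.cong) (auto simp: power_divide power3_eq_cube power2_eq_square)
  also have "(\<Sum>i<n. w ^ i)\<^sup>2 * \<dots> \<le> (1 / (1 - w))\<^sup>2 * \<dots>"
    using w geo by (intro mult_right_mono power_mono sum_nonneg) auto
  finally have "ennreal ((\<Sum>i<n. norm (Q i x)) ^ 3) \<le> ennreal (1 / (1 - w)\<^sup>2) * (\<Sum>i<n. ennreal (1 / (w ^ i)\<^sup>2) * ennreal (norm (Q i x) ^ 3))"
    by (simp add: ennreal_mult[symmetric] sum_nonneg ennreal_leI power_divide)
  also have "\<dots> \<le> ennreal (1 / (1 - w)\<^sup>2) * wcubes w Q x"
    unfolding wcubes_def by (intro mult_left_mono sum_le_suminf) auto
  finally show ?thesis .
qed

lemma wcubes_finite: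
  assumes w: "0 < w" "w < 1" and fin: "wcubes w Q x < \<infinity>"
  shows "summable (\<lambda>i. norm (Q i x))"
    and "(\<Sum>i<n. norm (Q i x)) ^ 3 \<le> 1 / (1 - w)\<^sup>2 * enn2real (wcubes w Q x)"
    and "norm (\<Sum>i. Q i x) ^ 3 \<le> 1 / (1 - w)\<^sup>2 * enn2real (wcubes w Q x)"
proof -
  let ?K = "1 / (1 - w)\<^sup>2 * enn2real (wcubes w Q x)"
  have K: "?K \<ge> 0" by simp
  have "ennreal (1 / (1 - w)\<^sup>2) * wcubes w Q x = ennreal ?K"
    using fin w by (subst ennreal_mult) auto
  then have b: "(\<Sum>i<n. norm (Q i x)) ^ 3 \<le> ?K" for n
    using sum_norm_cube_le_wcubes[OF w, of Q x n] K by (simp add: ennreal_le_iff)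
  then show "(\<Sum>i<n. norm (Q i x)) ^ 3 \<le> ?K" .
  \<comment> \<open>Cube roots are avoided: a number above 1 is at most its cube.\<close>
  have b1: "(\<Sum>i<n. norm (Q i x)) \<le> 1 + ?K" for n
  proof (rule ccontr)
    assume "\<not> ?thesis"
    then have "(\<Sum>i<n. norm (Q i x)) > 1 + ?K" by simp
    moreover from this have "(\<Sum>i<n. norm (Q i x)) ^ 1 \<le> (\<Sum>i<n. norm (Q i x)) ^ 3"
      using K by (intro power_increasing) linarith+
    ultimately show False using b[of n] by simp
  qed
  show s: "summable (\<lambda>i. norm (Q i x))"
    by (rule summableI_nonneg_bounded[where x = "1 + ?K"]) (use b1 in auto)
  have "(\<lambda>n. norm (\<Sum>i<n. Q i x) ^ 3) \<longlonglongrightarrow> norm (\<Sum>i. Q i x) ^ 3"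
    by (intro tendsto_intros summable_LIMSEQ summable_norm_cancel[OF s])
  then show "norm (\<Sum>i. Q i x) ^ 3 \<le> ?K"
  proof (rule LIMSEQ_le_const2, intro exI allI impI)
    fix n show "norm (\<Sum>i<n. Q i x) ^ 3 \<le> ?K"
      by (rule order_trans[OF power_mono[OF norm_sum] b]) simp
  qed
qed

lemma N3_suminf_le:
  fixes Q :: "nat \<Rightarrow> real^2 \<Rightarrow> complex"
  assumes w: "0 < w" "w < 1" and [measurable]: "\<And>i. Q i \<in> borel_measurable borel"
  shows "N3 L (\<lambda>x. \<Sum>i. Q i x) \<le> ennreal (1 / (1 - w)\<^sup>2) * wN3 w L Q"
proof -
  have "N3 L (\<lambda>x. \<Sum>i. Q i x) \<le> (\<integral>\<^sup>+x. ennreal (1 / (1 - w)\<^sup>2) * wcubes w Q x \<partial>tm L)"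
    unfolding N3_def
  proof (rule nn_integral_mono)
    fix x
    show "ennreal (norm (\<Sum>i. Q i x) ^ 3) \<le> ennreal (1 / (1 - w)\<^sup>2) * wcubes w Q x"
    proof (cases "wcubes w Q x < \<infinity>")
      case True
      have "ennreal (norm (\<Sum>i. Q i x) ^ 3) \<le> ennreal (1 / (1 - w)\<^sup>2 * enn2real (wcubes w Q x))"
        by (intro ennreal_leI wcubes_finite(3)[OF w True])
      also have "\<dots> = ennreal (1 / (1 - w)\<^sup>2) * wcubes w Q x"
        using True w by (subst ennreal_mult) auto
      finally show ?thesis .
    next
      \<comment> \<open>Where the weighted sum is infinite the series may diverge and
        \<open>suminf\<close> is unspecified, but the right-hand side is infinite.\<close>
      case False
      then show ?thesis using w by (simp add: top.not_eq_extremum[symmetric] ennreal_mult_top)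
    qed
  qed
  then show ?thesis by (simp add: nn_integral_cmult nn_integral_wcubes)
qed

text \<open>Dominated convergence with majorant \<open>D\<close>, one plus a multiple of
  \<open>wcubes\<close>; the added 1, integrable since the total mass is 1, lets a cubic bound serve
  as a linear one.\<close>

lemma wcubes_integral_limit:
  assumes L: "L > 0" and w: "0 < w" "w < 1" and [measurable]: "\<And>i. Q i \<in> borel_measurable borel"
    and fin: "wN3 w L Q < \<infinity>"
    and [measurable]: "e \<in> borel_measurable borel" and e: "\<And>x. norm (e x :: complex) \<le> 1"
  shows "AE x in tm L. wcubes w Q x < \<infinity>"
    and "integrable (tm L) (\<lambda>x. \<Sum>i. Q i x)"
    and "(\<lambda>n. \<integral>x. (\<Sum>i<n. Q i x) * e x \<partial>tm L) \<longlonglongrightarrow> (\<integral>x. (\<Sum>i. Q i x) * e x \<partial>tm L)"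
proof -
  interpret prob_space "tm L" by (rule prob_space_tm[OF L])
  have nn: "(\<integral>\<^sup>+x. wcubes w Q x \<partial>tm L) < \<infinity>" using fin by (simp add: nn_integral_wcubes)
  show AE: "AE x in tm L. wcubes w Q x < \<infinity>"
    using nn_integral_PInf_AE[of "wcubes w Q" "tm L"] nn by (auto simp: less_top)
  define D where "D x = 1 + 1 / (1 - w)\<^sup>2 * enn2real (wcubes w Q x)" for x
  have "integrable (tm L) (\<lambda>x. enn2real (wcubes w Q x))"
  proof (rule integrableI_bounded)
    have "(\<integral>\<^sup>+x. ennreal (norm (enn2real (wcubes w Q x))) \<partial>tm L) \<le> (\<integral>\<^sup>+x. wcubes w Q x \<partial>tm L)"
      by (intro nn_integral_mono) (auto simp: ennreal_enn2real_if)
    then show "(\<integral>\<^sup>+x. ennreal (norm (enn2real (wcubes w Q x))) \<partial>tm L) < \<infinity>" using nn by (rule le_less_trans)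
  qed auto
  then have D: "integrable (tm L) D" unfolding D_def by auto
  have le: "c \<le> D x" if "c ^ 3 \<le> 1 / (1 - w)\<^sup>2 * enn2real (wcubes w Q x)" for c x
  proof (cases "c \<le> 1")
    case True then show ?thesis unfolding D_def by (intro add_increasing2) auto
  next
    case False
    then have "c ^ 1 \<le> c ^ 3" by (intro power_increasing) auto
    then show ?thesis using that unfolding D_def by simp
  qed
  show "integrable (tm L) (\<lambda>x. \<Sum>i. Q i x)"
  proof (rule Bochner_Integration.integrable_bound[OF D])
    show "AE x in tm L. norm (\<Sum>i. Q i x) \<le> norm (D x)"
      using AE
    proof eventually_elim
      case (elim x)
      have "norm (\<Sum>i. Q i x) \<le> D x" by (rule le[OF wcubes_finite(3)[OF w elim]])
      then show ?case by simp
    qed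
  qed measurable
  show "(\<lambda>n. \<integral>x. (\<Sum>i<n. Q i x) * e x \<partial>tm L) \<longlonglongrightarrow> (\<integral>x. (\<Sum>i. Q i x) * e x \<partial>tm L)"
  proof (rule integral_dominated_convergence[OF _ _ D])
    show "AE x in tm L. (\<lambda>n. (\<Sum>i<n. Q i x) * e x) \<longlonglongrightarrow> (\<Sum>i. Q i x) * e x"
      using AE
    proof eventually_elim
      case (elim x)
      then show ?case
        by (intro tendsto_mult_right summable_LIMSEQ summable_norm_cancel[OF wcubes_finite(1)[OF w]])
    qed
    show "AE x in tm L. norm ((\<Sum>i<n. Q i x) * e x) \<le> D x" for n
      using AE
    proof eventually_elim
      case (elim x)
      have "norm ((\<Sum>i<n. Q i x) * e x) \<le> norm (\<Sum>i<n. Q i x)"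
        using e[of x] by (simp add: norm_mult mult_left_le)
      also have "\<dots> \<le> (\<Sum>i<n. norm (Q i x))" by (rule norm_sum)
      also have "\<dots> \<le> D x" by (rule le[OF wcubes_finite(2)[OF w elim]])
      finally show ?case .
    qed
  qed measurable
qed

lemma AE_tm_shift:
  assumes L: "L > 0" and [measurable]: "Measurable.pred borel P" and per: "torus_periodic L P" and P: "AE x in tm L. P x"
  shows "AE x in tm L. P (x + h)"
proof -
  let ?i = "\<lambda>x. indicator {x. \<not> P x} x :: ennreal"
  have "(\<integral>\<^sup>+x. ?i (x + h) \<partial>tm L) = (\<integral>\<^sup>+x. ?i x \<partial>tm L)"
    using per by (intro nn_integral_tm_shift[OF L]) (auto simp: torus_periodic_def indicator_def)
  also have "\<dots> = 0"
    using P by (subst nn_integral_0_iff_AE) (auto elim!: eventually_mono)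
  finally have "AE x in tm L. ?i (x + h) = 0"
    by (subst (asm) nn_integral_0_iff_AE) auto
  then show ?thesis by eventually_elim (auto simp: indicator_def split: if_splits)
qed

section \<open>Increments of functions of finite Besov norm\<close>

locale lp_decomposition =
  fixes \<eta> \<phi> :: "real \<Rightarrow> real" and a b R :: real
  assumes ab: "0 < a" "a < b" and R: "R > 0"
    and eta0: "\<And>r. r > R \<Longrightarrow> \<eta> r = 0"
    and phi0: "\<And>r. r \<ge> 0 \<Longrightarrow> r \<notin> {a..b} \<Longrightarrow> \<phi> r = 0"
    and part: "\<And>r. r \<ge> 0 \<Longrightarrow> \<eta> r + (\<Sum>j. \<phi> (r / 2 ^ j)) = 1"
begin

abbreviation besov :: "real \<Rightarrow> real \<Rightarrow> (real^2 \<Rightarrow> real) \<Rightarrow> ennreal" where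
  "besov \<equiv> besov_norm \<eta> \<phi>"

text \<open>Indices are shifted by one: 0 stands for the low-frequency block and
  \<open>Suc j\<close> for the j-th annular block.\<close>

definition bfreqs :: "real \<Rightarrow> nat \<Rightarrow> (real^2) set" where
  "bfreqs L i = (case i of 0 \<Rightarrow> {k \<in> freq L. norm k \<le> R}
     | Suc j \<Rightarrow> {k \<in> freq L. a * 2 ^ j \<le> norm k \<and> norm k \<le> b * 2 ^ j})"

definition bsymbol :: "nat \<Rightarrow> real^2 \<Rightarrow> real" where
  "bsymbol i k = (case i of 0 \<Rightarrow> \<eta> (norm k) | Suc j \<Rightarrow> \<phi> (norm k / 2 ^ j))"

definition block :: "(real \<Rightarrow> real \<Rightarrow> complex) \<Rightarrow> real \<Rightarrow> (real^2 \<Rightarrow> real) \<Rightarrow> nat \<Rightarrow> real^2 \<Rightarrow> complex" where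
  "block t L f i = trig (bfreqs L i) (\<lambda>k. t (k $ 1) (k $ 2) * (complex_of_real (bsymbol i k) * fcoeff L f k))"

lemma bfreqs:
  assumes "L > 0" shows "finite (bfreqs L i)" "bfreqs L i \<subseteq> freq L"
proof -
  show "finite (bfreqs L i)"
  proof (cases i)
    case (Suc j)
    have "bfreqs L i \<subseteq> {k \<in> freq L. norm k \<le> b * 2 ^ j}" using Suc by (auto simp: bfreqs_def)
    then show ?thesis by (rule finite_subset) (rule finite_freq_ball[OF assms])
  qed (simp add: bfreqs_def finite_freq_ball[OF assms])
  show "bfreqs L i \<subseteq> freq L" by (auto simp: bfreqs_def split: nat.splits)
qed

lemma bsymbol_0: "k \<in> freq L - bfreqs L i \<Longrightarrow> bsymbol i k = 0"
proof -
  assume k: "k \<in> freq L - bfreqs L i"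
  show ?thesis
  proof (cases i)
    case (Suc j)
    then have "norm k / 2 ^ j \<notin> {a..b}" using k by (auto simp: bfreqs_def field_simps)
    then show ?thesis using Suc by (simp add: bsymbol_def phi0)
  qed (use k eta0 in \<open>auto simp: bfreqs_def bsymbol_def\<close>)
qed

text \<open>The equation \<open>part\<close> uses \<open>suminf\<close> and asserts no convergence.
  For fixed \<open>k\<close> the quotient \<open>norm k / 2 ^ j\<close> eventually falls below
  \<open>a\<close>, so only finitely many terms are nonzero.\<close>

lemma bsymbol_sums: "(\<lambda>i. bsymbol i k) sums 1"
proof -
  obtain N where N: "norm k / a < 2 ^ N" using real_arch_pow[of 2 "norm k / a"] by auto
  have z: "\<phi> (norm k / 2 ^ j) = 0" if "j \<notin> {..<N}" for j
  proof -
    have "norm k / a < 2 ^ j"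
      by (rule less_le_trans[OF N power_increasing]) (use that in auto)
    then have "norm k / 2 ^ j < a" using ab by (simp add: field_simps)
    then show ?thesis by (intro phi0) auto
  qed
  have "(\<lambda>j. \<phi> (norm k / 2 ^ j)) sums (\<Sum>j<N. \<phi> (norm k / 2 ^ j))"
    using z by (intro sums_finite) auto
  then have "(\<lambda>j. \<phi> (norm k / 2 ^ j)) sums (\<Sum>j. \<phi> (norm k / 2 ^ j))" by (metis sums_unique)
  then have "(\<lambda>j. bsymbol (Suc j) k) sums (1 - bsymbol 0 k)"
  proof -
    have "(\<Sum>j. \<phi> (norm k / 2 ^ j)) = 1 - \<eta> (norm k)" using part[of "norm k"] by simp
    then show ?thesis using \<open>(\<lambda>j. \<phi> (norm k / 2 ^ j)) sums (\<Sum>j. \<phi> (norm k / 2 ^ j))\<close>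
      by (simp add: bsymbol_def)
  qed
  from sums_Suc[OF this] show ?thesis by simp
qed

lemma block_one:
  assumes "L > 0"
  shows "block (\<lambda>x y. 1) L f 0 = freq_cut L (\<lambda>k. \<eta> (norm k)) f"
    "block (\<lambda>x y. 1) L f (Suc j) = freq_cut L (\<lambda>k. \<phi> (norm k / 2 ^ j)) f"
proof -
  have "block (\<lambda>x y. 1) L f i = freq_cut L (bsymbol i) f" for i
    using freq_cut_eq_trig[OF bfreqs[OF assms] bsymbol_0] by (simp add: block_def)
  moreover have "bsymbol 0 = (\<lambda>k. \<eta> (norm k))" "bsymbol (Suc j) = (\<lambda>k. \<phi> (norm k / 2 ^ j))"
    by (simp_all add: bsymbol_def fun_eq_iff)
  ultimately show "block (\<lambda>x y. 1) L f 0 = freq_cut L (\<lambda>k. \<eta> (norm k)) f"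
    "block (\<lambda>x y. 1) L f (Suc j) = freq_cut L (\<lambda>k. \<phi> (norm k / 2 ^ j)) f"
    by simp_all
qed

lemma borel_measurable_block [measurable]: "block t L f i \<in> borel_measurable borel"
  unfolding block_def by measurable

lemma N3_block_one_le:
  assumes L: "L > 0"
  shows "N3 L (block (\<lambda>x y. 1) L f 0) \<le> besov L s f ^ 3"
    and "N3 L (block (\<lambda>x y. 1) L f (Suc j)) \<le> ennreal ((2 powr - s) ^ (3 * j)) * besov L s f ^ 3"
proof -
  define T where "T i = torus_norm L 3 (block (\<lambda>x y. 1) L f i)" for i
  have T0: "T i \<ge> 0" for i unfolding T_def torus_norm_def by simp
  have N: "N3 L (block (\<lambda>x y. 1) L f i) = ennreal (T i) ^ 3" for i
    unfolding T_def block_def N3_trig_torus_norm[OF L] using T0[of i]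
    by (simp add: ennreal_power T_def block_def)
  have B: "besov L s f = ennreal (T 0) + (SUP j. ennreal (2 powr (real j * s) * T (Suc j)))"
    unfolding besov_norm_def T_def block_one[OF L] ..
  have "ennreal (T 0) \<le> besov L s f" unfolding B by simp
  then show "N3 L (block (\<lambda>x y. 1) L f 0) \<le> besov L s f ^ 3"
    unfolding N by (rule power_mono) simp
  have "ennreal (2 powr (real j * s) * T (Suc j)) \<le> besov L s f"
    unfolding B by (intro add_increasing SUP_upper) auto
  then have "ennreal (2 powr - (real j * s)) * ennreal (2 powr (real j * s) * T (Suc j)) \<le> ennreal (2 powr - (real j * s)) * besov L s f"
    by (rule mult_left_mono) simp
  moreover have "ennreal (2 powr - (real j * s)) * ennreal (2 powr (real j * s) * T (Suc j)) = ennreal (T (Suc j))"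
    using T0 by (simp add: ennreal_mult[symmetric] mult.assoc[symmetric] powr_add[symmetric])
  moreover have "2 powr - (real j * s) = (2 powr - s) ^ j"
    by (simp add: powr_realpow[symmetric] powr_powr mult.commute)
  ultimately have "ennreal (T (Suc j)) \<le> ennreal ((2 powr - s) ^ j) * besov L s f" by simp
  then have "ennreal (T (Suc j)) ^ 3 \<le> (ennreal ((2 powr - s) ^ j) * besov L s f) ^ 3"
    by (rule power_mono) simp
  also have "\<dots> = ennreal ((2 powr - s) ^ (3 * j)) * besov L s f ^ 3"
    by (simp add: power_mult_distrib ennreal_power power_mult[symmetric] mult.commute)
  finally show "N3 L (block (\<lambda>x y. 1) L f (Suc j)) \<le> ennreal ((2 powr - s) ^ (3 * j)) * besov L s f ^ 3"
    unfolding N .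
qed

text \<open>A sum of nonnegative terms, so that one radius satisfies all the lower bounds demanded
  of \<open>B\<close> in the block estimates.\<close>

definition bradius :: real where
  "bradius = 1 + R + 2 * pi + b / a + 2 * pi / a"

lemma bradius: "bradius \<ge> 1" "bradius \<ge> R" "bradius \<ge> 2 * pi" "bradius \<ge> b / a" "bradius \<ge> 2 * pi / a"
proof -
  have "b / a \<ge> 0" "2 * pi / a \<ge> 0" using ab by auto
  then show "bradius \<ge> 1" "bradius \<ge> R" "bradius \<ge> 2 * pi" "bradius \<ge> b / a" "bradius \<ge> 2 * pi / a"
    unfolding bradius_def using R pi_gt_zero by linarith+
qed

lemma bfreqs_Suc_bounds:
  assumes "k \<in> bfreqs L (Suc j)"
  shows "a * 2 ^ j \<le> norm k \<and> norm k \<le> b / a * (a * 2 ^ j)"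
  using assms ab by (auto simp: bfreqs_def)

lemma block_one_trig: "trig (bfreqs L i) (\<lambda>k. complex_of_real (bsymbol i k) * fcoeff L f k) = block (\<lambda>x y. 1) L f i"
  by (simp add: block_def)

text \<open>For the j-th annulus the cube is of order (2^j |h|)^(3p) 2^(-3sj), that is |h|^(3p)
  \<open>w ^ (3 * j)\<close> with \<open>w = 2 powr (p - s)\<close>. The Hoelder weight removes
  \<open>w ^ (2 * i)\<close> and one summable factor \<open>w ^ i\<close> survives. \<open>K\<close>
  covers the low block and the annuli together.\<close>

lemma weighted_incr_block_le:
  assumes t: "hsymbol A t r" and p: "0 \<le> p" "p \<le> 1" and w: "w = 2 powr (p - s)" "w < 1"
    and L: "L \<ge> 1" and h: "h \<noteq> 0" "norm h \<le> 1"
  defines "K \<equiv> 161280 * A * bradius\<^sup>2 * (1 + a powr p)"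
  shows "ennreal (1 / (w ^ i)\<^sup>2) * N3 L (incr h (block t L f i))
    \<le> ennreal (K ^ 3 * norm h powr (3 * p) / w ^ 3 * w ^ i) * besov L s f ^ 3"
proof -
  let ?Bn = "besov L s f"
  have A: "A \<ge> 0" using hsymbol_nonneg[OF t] .
  have w0: "w > 0" using w by simp
  have L0: "L > 0" using L by simp
  have h0: "norm h > 0" using h by simp
  have cube: "(norm h powr p) ^ 3 = norm h powr (3 * p)"
    using h0 by (simp add: powr_realpow[symmetric] powr_powr mult.commute)
  have AB: "A * bradius\<^sup>2 \<ge> 0" using A by simp
  have K0: "K \<ge> 0" unfolding K_def using A by auto
  show ?thesis
  proof (cases i)
    case 0
    have "norm h powr 1 \<le> norm h powr p" using h h0 p by (intro powr_mono') auto
    then have hp: "norm h \<le> norm h powr p" using h0 by simp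
    have "N3 L (incr h (block t L f 0)) \<le> ennreal ((161280 * A * bradius\<^sup>2 * norm h) ^ 3) * N3 L (block (\<lambda>x y. 1) L f 0)"
      unfolding block_one_trig[symmetric] unfolding block_def[of t]
      by (rule low_block_increment[OF t L bradius(3,2) bfreqs[OF L0] _ h(2)]) (auto simp: bfreqs_def)
    also have "\<dots> \<le> ennreal (K ^ 3 * norm h powr (3 * p) / w ^ 3) * ?Bn ^ 3"
    proof (intro mult_mono ennreal_leI N3_block_one_le L0)
      have "norm h \<le> (1 + a powr p) * norm h powr p" using hp by (simp add: distrib_right add_increasing2)
      then have "161280 * (A * bradius\<^sup>2) * norm h \<le> 161280 * (A * bradius\<^sup>2) * ((1 + a powr p) * norm h powr p)"
        using AB by (intro mult_left_mono) auto
      then have "161280 * A * bradius\<^sup>2 * norm h \<le> 161280 * A * bradius\<^sup>2 * (1 + a powr p) * norm h powr p"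
        by (simp only: mult.assoc)
      then have "(161280 * A * bradius\<^sup>2 * norm h) ^ 3 \<le> (K * norm h powr p) ^ 3"
        unfolding K_def using AB h0 by (intro power_mono) auto
      also have "\<dots> = K ^ 3 * norm h powr (3 * p)" by (simp only: power_mult_distrib cube)
      also have "\<dots> \<le> K ^ 3 * norm h powr (3 * p) / w ^ 3"
        using w w0 K0 power_le_one[of w 3] by (simp add: le_divide_eq mult_left_le)
      finally show "(161280 * A * bradius\<^sup>2 * norm h) ^ 3 \<le> K ^ 3 * norm h powr (3 * p) / w ^ 3" .
    qed auto
    finally show ?thesis using 0 by simp
  next
    case (Suc j)
    have p2: "(a * 2 ^ j * norm h) powr p = a powr p * (2 powr p) ^ j * norm h powr p"
      using ab h0 by (simp add: powr_mult powr_realpow[symmetric] powr_powr mult.commute)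
    have "N3 L (incr h (block t L f (Suc j)))
      \<le> ennreal ((4032 * A * bradius\<^sup>2 * (a * 2 ^ j * norm h) powr p) ^ 3) * N3 L (block (\<lambda>x y. 1) L f (Suc j))"
      unfolding block_one_trig[symmetric] unfolding block_def[of t]
      using ab by (intro block_increment[OF t L _ _ bradius(1) _ bradius(5) bfreqs[OF L0] bfreqs_Suc_bounds p h(1)] bradius(4)) auto
    also have "\<dots> \<le> ennreal ((4032 * A * bradius\<^sup>2 * (a * 2 ^ j * norm h) powr p) ^ 3) * (ennreal ((2 powr - s) ^ (3 * j)) * ?Bn ^ 3)"
      by (intro mult_left_mono N3_block_one_le(2)[OF L0]) auto
    also have "\<dots> = ennreal ((4032 * A * bradius\<^sup>2 * (a * 2 ^ j * norm h) powr p) ^ 3 * (2 powr - s) ^ (3 * j)) * ?Bn ^ 3"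
      using A by (subst ennreal_mult) (auto simp: mult.assoc)
    also have "(4032 * A * bradius\<^sup>2 * (a * 2 ^ j * norm h) powr p) ^ 3 * (2 powr - s) ^ (3 * j)
      = (4032 * A * bradius\<^sup>2 * a powr p) ^ 3 * norm h powr (3 * p) * w ^ (3 * j)"
    proof -
      have "w ^ (3 * j) = ((2 powr p) ^ j) ^ 3 * (2 powr - s) ^ (3 * j)"
        unfolding w(1) by (simp add: powr_realpow[symmetric] powr_powr powr_add[symmetric] algebra_simps power_mult[symmetric])
      then show ?thesis unfolding p2 by (simp only: power_mult_distrib cube mult_ac)
    qed
    finally have N: "N3 L (incr h (block t L f (Suc j)))
      \<le> ennreal ((4032 * A * bradius\<^sup>2 * a powr p) ^ 3 * norm h powr (3 * p) * w ^ (3 * j)) * ?Bn ^ 3" .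
    have "ennreal (1 / (w ^ i)\<^sup>2) * N3 L (incr h (block t L f i))
      \<le> ennreal (1 / (w ^ i)\<^sup>2) * (ennreal ((4032 * A * bradius\<^sup>2 * a powr p) ^ 3 * norm h powr (3 * p) * w ^ (3 * j)) * ?Bn ^ 3)"
      using N Suc by (intro mult_left_mono) auto
    also have "\<dots> = ennreal (1 / (w ^ i)\<^sup>2 * ((4032 * A * bradius\<^sup>2 * a powr p) ^ 3 * norm h powr (3 * p) * w ^ (3 * j))) * ?Bn ^ 3"
      using A w0 by (subst ennreal_mult) (auto simp: mult.assoc)
    also have "\<dots> \<le> ennreal (K ^ 3 * norm h powr (3 * p) / w ^ 3 * w ^ i) * ?Bn ^ 3"
    proof (intro mult_right_mono ennreal_leI)
      \<comment> \<open>The division by \<open>w ^ 3\<close> is the price of the index shift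
        \<open>i = Suc j\<close>.\<close>
      have "1 / (w ^ i)\<^sup>2 * w ^ (3 * j) = w ^ i / w ^ 3"
      proof -
        have "w ^ (3 * j) * w ^ 3 = w ^ (3 * j + 3)" by (simp only: power_add)
        also have "3 * j + 3 = i + (i + i)" using Suc by simp
        also have "w ^ (i + (i + i)) = w ^ i * (w ^ i)\<^sup>2" by (simp only: power_add power2_eq_square)
        finally have "w ^ (3 * j) * w ^ 3 = w ^ i * (w ^ i)\<^sup>2" .
        then show ?thesis using w0 by (simp add: field_simps)
      qed
      then have "1 / (w ^ i)\<^sup>2 * ((4032 * A * bradius\<^sup>2 * a powr p) ^ 3 * norm h powr (3 * p) * w ^ (3 * j))
        = (4032 * A * bradius\<^sup>2 * a powr p) ^ 3 * norm h powr (3 * p) * (w ^ i / w ^ 3)"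
        by (subst mult.left_commute) (simp only:)
      also have "\<dots> \<le> K ^ 3 * norm h powr (3 * p) * (w ^ i / w ^ 3)"
      proof (intro mult_right_mono power_mono)
        have "4032 * (A * bradius\<^sup>2) * a powr p \<le> 161280 * (A * bradius\<^sup>2) * (1 + a powr p)"
          using A AB by (intro mult_mono) auto
        then show "4032 * A * bradius\<^sup>2 * a powr p \<le> K" unfolding K_def by (simp only: mult.assoc)
      qed (use A w0 in auto)
      finally show "1 / (w ^ i)\<^sup>2 * ((4032 * A * bradius\<^sup>2 * a powr p) ^ 3 * norm h powr (3 * p) * w ^ (3 * j))
        \<le> K ^ 3 * norm h powr (3 * p) / w ^ 3 * w ^ i" by simp
    qed auto
    finally show ?thesis .
  qed
qed

lemma weighted_series_incr_le:
  assumes t: "hsymbol A t r" and p: "0 \<le> p" "p \<le> 1" and w: "w = 2 powr (p - s)" "w < 1"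
    and L: "L \<ge> 1" and h: "h \<noteq> 0" "norm h \<le> 1"
  defines "K \<equiv> 161280 * A * bradius\<^sup>2 * (1 + a powr p)"
  shows "wN3 w L (\<lambda>i. incr h (block t L f i))
    \<le> ennreal (K ^ 3 / (w ^ 3 * (1 - w)) * norm h powr (3 * p)) * besov L s f ^ 3"
proof -
  have A: "A \<ge> 0" using hsymbol_nonneg[OF t] .
  have w0: "w > 0" using w by simp
  have K0: "K \<ge> 0" unfolding K_def using A by auto
  let ?c = "K ^ 3 * norm h powr (3 * p) / w ^ 3"
  have "wN3 w L (\<lambda>i. incr h (block t L f i)) \<le> (\<Sum>i. ennreal (?c * w ^ i) * besov L s f ^ 3)"
    unfolding K_def by (intro suminf_le weighted_incr_block_le[OF t p w L h]) auto
  also have "\<dots> = (\<Sum>i. ennreal (?c * w ^ i)) * besov L s f ^ 3" by (rule ennreal_suminf_multc)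
  also have "(\<Sum>i. ennreal (?c * w ^ i)) = ennreal (\<Sum>i. ?c * w ^ i)"
    using K0 w0 w by (intro suminf_ennreal2 summable_mult summable_geometric) auto
  also have "(\<Sum>i. ?c * w ^ i) = ?c * (1 / (1 - w))"
    using w0 w by (subst suminf_mult) (auto simp: suminf_geometric summable_geometric)
  also have "\<dots> = K ^ 3 / (w ^ 3 * (1 - w)) * norm h powr (3 * p)" by simp
  finally show ?thesis .
qed

text \<open>A qualitative statement: the low block is a trigonometric polynomial, so
  \<open>E0\<close> is finite, but no bound on it uniform in \<open>L\<close> is sought. Finiteness
  is all that the convergence of the series needs.\<close>

lemma weighted_series_finite:
  assumes t: "hsymbol A t r" and p: "0 \<le> p" and w: "w = 2 powr (p - s)" "w < 1"
    and L: "L \<ge> 1" and Bn: "besov L s f < \<infinity>"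
  shows "wN3 w L (block t L f) < \<infinity>"
proof -
  have A: "A \<ge> 0" using hsymbol_nonneg[OF t] .
  have w0: "w > 0" using w by simp
  have L0: "L > 0" using L by simp
  define \<beta> where "\<beta> = enn2real (besov L s f)"
  have \<beta>: "besov L s f = ennreal \<beta>" "\<beta> \<ge> 0" using Bn by (auto simp: \<beta>_def)
  define E0 where "E0 = torus_norm L 3 (block t L f 0) ^ 3"
  have E0: "N3 L (block t L f 0) = ennreal E0" "E0 \<ge> 0"
    unfolding E0_def block_def using N3_trig_torus_norm[OF L0] by (auto simp: torus_norm_def)
  define E where "E = E0 + (336 * A * bradius) ^ 3 * \<beta> ^ 3 / w\<^sup>2 / w"
  have E: "E \<ge> 0" "E0 \<le> E" "(336 * A * bradius) ^ 3 * \<beta> ^ 3 / w\<^sup>2 / w \<le> E"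
    unfolding E_def using E0 A \<beta> bradius(1) w0 by auto
  have "ennreal (1 / (w ^ i)\<^sup>2) * N3 L (block t L f i) \<le> ennreal (E * w ^ i)" for i
  proof (cases i)
    case 0 then show ?thesis using E0 E by (simp add: ennreal_leI)
  next
    case (Suc j)
    have "N3 L (block t L f (Suc j)) \<le> ennreal ((336 * A * bradius) ^ 3) * N3 L (block (\<lambda>x y. 1) L f (Suc j))"
      unfolding block_one_trig[symmetric] unfolding block_def[of t]
      using ab by (intro block_multiplier(1)[OF t L _ _ bradius(1) _ bradius(5) bfreqs[OF L0] bfreqs_Suc_bounds] bradius(4)) auto
    also have "\<dots> \<le> ennreal ((336 * A * bradius) ^ 3) * (ennreal ((2 powr - s) ^ (3 * j)) * ennreal \<beta> ^ 3)"
      unfolding \<beta>(1)[symmetric] by (intro mult_left_mono N3_block_one_le(2)[OF L0]) auto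
    also have "\<dots> = ennreal ((336 * A * bradius) ^ 3 * ((2 powr - s) ^ (3 * j) * \<beta> ^ 3))"
      using A \<beta> bradius(1) by (simp add: ennreal_power ennreal_mult)
    finally have N: "N3 L (block t L f (Suc j)) \<le> ennreal ((336 * A * bradius) ^ 3 * ((2 powr - s) ^ (3 * j) * \<beta> ^ 3))" .
    have "ennreal (1 / (w ^ i)\<^sup>2) * N3 L (block t L f i)
      \<le> ennreal (1 / (w ^ i)\<^sup>2) * ennreal ((336 * A * bradius) ^ 3 * ((2 powr - s) ^ (3 * j) * \<beta> ^ 3))"
      using N Suc by (intro mult_left_mono) auto
    also have "\<dots> = ennreal (1 / (w ^ i)\<^sup>2 * ((336 * A * bradius) ^ 3 * ((2 powr - s) ^ (3 * j) * \<beta> ^ 3)))"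
      using A \<beta> bradius(1) w0 by (subst ennreal_mult) auto
    also have "\<dots> \<le> ennreal (E * w ^ i)"
    proof (rule ennreal_leI)
      have "2 powr - s \<le> w" unfolding w(1) using p by (intro powr_mono) auto
      then have "(2 powr - s) ^ (3 * j) \<le> w ^ (3 * j)" by (intro power_mono) auto
      then have "1 / (w ^ i)\<^sup>2 * ((336 * A * bradius) ^ 3 * ((2 powr - s) ^ (3 * j) * \<beta> ^ 3))
        \<le> 1 / (w ^ i)\<^sup>2 * ((336 * A * bradius) ^ 3 * (w ^ (3 * j) * \<beta> ^ 3))"
        using A \<beta> bradius(1) w0 by (intro mult_left_mono mult_right_mono) auto
      also have "\<dots> = (336 * A * bradius) ^ 3 * \<beta> ^ 3 * (w ^ (3 * j) / (w ^ i)\<^sup>2)" by simp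
      also have "w ^ (3 * j) / (w ^ i)\<^sup>2 = w ^ i / w\<^sup>2 / w"
      proof -
        have "w ^ (3 * j) * (w\<^sup>2 * w) = w ^ (3 * j + 3)"
          by (simp only: power_add power3_eq_cube power2_eq_square)
        also have "3 * j + 3 = i + (i + i)" using Suc by simp
        also have "w ^ (i + (i + i)) = w ^ i * (w ^ i)\<^sup>2" by (simp only: power_add power2_eq_square)
        finally have "w ^ (3 * j) * (w\<^sup>2 * w) = w ^ i * (w ^ i)\<^sup>2" .
        then show ?thesis using w0 by (simp add: field_simps)
      qed
      also have "(336 * A * bradius) ^ 3 * \<beta> ^ 3 * (w ^ i / w\<^sup>2 / w) = (336 * A * bradius) ^ 3 * \<beta> ^ 3 / w\<^sup>2 / w * w ^ i" by simp
      also have "\<dots> \<le> E * w ^ i" using E(3) w0 by (intro mult_right_mono) auto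
      finally show "1 / (w ^ i)\<^sup>2 * ((336 * A * bradius) ^ 3 * ((2 powr - s) ^ (3 * j) * \<beta> ^ 3)) \<le> E * w ^ i" .
    qed
    finally show ?thesis .
  qed
  then have "wN3 w L (block t L f) \<le> (\<Sum>i. ennreal (E * w ^ i))"
    by (intro suminf_le) auto
  also have "\<dots> = ennreal (\<Sum>i. E * w ^ i)"
    using E w0 w by (intro suminf_ennreal2 summable_mult summable_geometric) auto
  also have "\<dots> < \<infinity>" by simp
  finally show ?thesis .
qed

lemma torus_L2_integrable:
  assumes L: "L > 0" and f: "f \<in> torus_L2 L"
  shows "integrable (tm L) f"
proof -
  interpret prob_space "tm L" by (rule prob_space_tm[OF L])
  have [measurable]: "f \<in> borel_measurable borel" using f by (simp add: torus_L2_def)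
  have i: "integrable (tm L) (\<lambda>x. (f x)\<^sup>2)" using f set_integrable_tm[OF L, of "\<lambda>x. (f x)\<^sup>2"] by (simp add: torus_L2_def)
  show ?thesis
  proof (rule Bochner_Integration.integrable_bound[where f = "\<lambda>x. 1 + (f x)\<^sup>2"])
    have "\<bar>y\<bar> \<le> 1 + y\<^sup>2" for y :: real
      using zero_le_power2[of "\<bar>y\<bar> - 1"] by (simp add: power2_diff)
    then show "AE x in tm L. norm (f x) \<le> norm (1 + (f x)\<^sup>2)" by (auto simp: abs_of_nonneg add_nonneg_nonneg)
  qed (use i in auto)
qed

section \<open>The sum of the blocks, its Fourier coefficients and its increments\<close>

definition bseries :: "(real \<Rightarrow> real \<Rightarrow> complex) \<Rightarrow> real \<Rightarrow> (real^2 \<Rightarrow> real) \<Rightarrow> real^2 \<Rightarrow> complex" where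
  "bseries t L f x = (\<Sum>i. block t L f i x)"

lemma borel_measurable_bseries [measurable]: "bseries t L f \<in> borel_measurable borel"
  unfolding bseries_def by measurable

lemma torus_periodic_block:
  assumes L: "L > 0" shows "torus_periodic L (block t L f i)"
  unfolding block_def by (rule torus_periodic_trig[OF L bfreqs(2)[OF L]])

lemma torus_periodic_bseries:
  assumes L: "L > 0" shows "torus_periodic L (bseries t L f)"
  using torus_periodic_block[OF L] unfolding torus_periodic_def bseries_def by simp

text \<open>The coefficients of the partial sums are those of the limit times partial sums of
  \<open>bsymbol\<close>, which tend to 1; dominated convergence handles the integrals.\<close>

lemma integral_bseries:
  assumes L: "L > 0" and w: "0 < w" "w < 1"
    and fin: "wN3 w L (block t L f) < \<infinity>" and k: "k \<in> freq L"
  shows "(\<integral>x. bseries t L f x * ew (- k) x \<partial>tm L) = t (k $ 1) (k $ 2) * fcoeff L f k"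
proof (rule LIMSEQ_unique)
  show "(\<lambda>n. \<integral>x. (\<Sum>i<n. block t L f i x) * ew (- k) x \<partial>tm L) \<longlonglongrightarrow> (\<integral>x. bseries t L f x * ew (- k) x \<partial>tm L)"
    unfolding bseries_def by (rule wcubes_integral_limit(3)[OF L w _ fin]) auto
  have int: "integrable (tm L) (\<lambda>x. block t L f i x * ew (- k) x)" for i
    unfolding block_def using L
    by (intro integrable_tm_mult_bounded[where B = 1] integrable_tm_bounded[OF L _ norm_trig_le]) auto
  have "(\<integral>x. (\<Sum>i<n. block t L f i x) * ew (- k) x \<partial>tm L) = t (k $ 1) (k $ 2) * fcoeff L f k * complex_of_real (\<Sum>i<n. bsymbol i k)" for n
  proof -
    have "(\<integral>x. (\<Sum>i<n. block t L f i x) * ew (- k) x \<partial>tm L) = (\<Sum>i<n. \<integral>x. block t L f i x * ew (- k) x \<partial>tm L)"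
      unfolding sum_distrib_right using int by (subst Bochner_Integration.integral_sum) auto
    also have "\<dots> = (\<Sum>i<n. t (k $ 1) (k $ 2) * fcoeff L f k * complex_of_real (bsymbol i k))"
    proof (rule sum.cong)
      fix i
      show "(\<integral>x. block t L f i x * ew (- k) x \<partial>tm L) = t (k $ 1) (k $ 2) * fcoeff L f k * complex_of_real (bsymbol i k)"
        unfolding block_def integral_trig_ew[OF L bfreqs[OF L] k] using bsymbol_0[of k L i] k by auto
    qed simp
    finally show ?thesis by (simp add: sum_distrib_left)
  qed
  moreover have "(\<lambda>n. t (k $ 1) (k $ 2) * fcoeff L f k * complex_of_real (\<Sum>i<n. bsymbol i k)) \<longlonglongrightarrow> t (k $ 1) (k $ 2) * fcoeff L f k * complex_of_real 1"
    using bsymbol_sums[of k] unfolding sums_def by (intro tendsto_intros)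
  ultimately show "(\<lambda>n. \<integral>x. (\<Sum>i<n. block t L f i x) * ew (- k) x \<partial>tm L) \<longlonglongrightarrow> t (k $ 1) (k $ 2) * fcoeff L f k"
    by simp
qed

lemma AE_eq_bseries:
  assumes L: "L > 0" and w: "0 < w" "w < 1"
    and fin: "wN3 w L (block t L f) < \<infinity>"
    and g: "g \<in> torus_L2 L" and gk: "\<And>k. k \<in> freq L \<Longrightarrow> fcoeff L g k = t (k $ 1) (k $ 2) * fcoeff L f k"
  shows "AE x in tm L. complex_of_real (g x) = bseries t L f x"
proof -
  have [measurable]: "g \<in> borel_measurable borel" using g by (simp add: torus_L2_def)
  have ig: "integrable (tm L) (\<lambda>x. complex_of_real (g x))" using torus_L2_integrable[OF L g] by simp
  have iG: "integrable (tm L) (bseries t L f)"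
    unfolding bseries_def by (rule wcubes_integral_limit(2)[OF L w _ fin, where e = "\<lambda>_. 1"]) auto
  have "(\<lambda>x. complex_of_real (g x) - bseries t L f x) \<in> null_coeffs L"
    unfolding null_coeffs_def
  proof (intro CollectI conjI ballI)
    fix k assume k: "k \<in> freq L"
    then have mk: "- k \<in> freq L" by (rule freq_minus)
    have i: "integrable (tm L) (\<lambda>x. complex_of_real (g x) * ew k x)" "integrable (tm L) (\<lambda>x. bseries t L f x * ew k x)"
      using ig iG by (auto intro!: integrable_tm_mult_bounded[where B = 1])
    have "(\<integral>x. complex_of_real (g x) * ew k x \<partial>tm L) = fcoeff L g (- k)"
      using fcoeff_tm[OF L, of g "- k"] by simp
    also have "\<dots> = (\<integral>x. bseries t L f x * ew k x \<partial>tm L)"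
      using gk[OF mk] integral_bseries[OF L w fin mk] by simp
    finally show "(\<integral>x. (complex_of_real (g x) - bseries t L f x) * ew k x \<partial>tm L) = 0"
      using i by (simp add: left_diff_distrib)
  qed (use ig iG in auto)
  from null_coeffs_AE_zero[OF L this] show ?thesis by eventually_elim simp
qed

text \<open>An increment involves two points, so the almost everywhere identity with the series, and
  its summability, are transported by the shift and used at \<open>x\<close> and
  \<open>x + h\<close> simultaneously.\<close>

lemma N3_incr_le_series:
  assumes L: "L > 0" and w: "0 < w" "w < 1"
    and fin: "wN3 w L (block t L f) < \<infinity>"
    and g: "g \<in> torus_L2 L" and gk: "\<And>k. k \<in> freq L \<Longrightarrow> fcoeff L g k = t (k $ 1) (k $ 2) * fcoeff L f k"
  shows "N3 L (incr h g) \<le> ennreal (1 / (1 - w)\<^sup>2) * wN3 w L (\<lambda>i. incr h (block t L f i))"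
proof -
  have [measurable]: "g \<in> borel_measurable borel" and gp: "torus_periodic L g" using g by (auto simp: torus_L2_def)
  define P where "P x \<longleftrightarrow> complex_of_real (g x) = bseries t L f x \<and> wcubes w (block t L f) x < \<infinity>" for x
  have [measurable]: "Measurable.pred borel P" unfolding P_def by measurable
  have per: "torus_periodic L P"
    using gp torus_periodic_bseries[OF L, of t f] torus_periodic_block[OF L, of t f]
    unfolding torus_periodic_def P_def wcubes_def by simp
  have P: "AE x in tm L. P x"
    using AE_eq_bseries[OF L w fin g gk] wcubes_integral_limit(1)[OF L w _ fin, of "\<lambda>_. 1"]
    unfolding P_def by auto
  have Ph: "AE x in tm L. P (x + h)" by (rule AE_tm_shift[OF L _ per P]) simp
  have "N3 L (incr h g) = N3 L (\<lambda>x. \<Sum>i. incr h (block t L f i) x)"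
    unfolding N3_def
  proof (rule nn_integral_cong_AE)
    show "AE x in tm L. ennreal (norm (incr h g x) ^ 3) = ennreal (norm (\<Sum>i. incr h (block t L f i) x) ^ 3)"
      using P Ph
    proof eventually_elim
      case (elim x)
      have s: "summable (\<lambda>i. block t L f i y)" if "P y" for y
        using that unfolding P_def by (intro summable_norm_cancel[OF wcubes_finite(1)[OF w]]) auto
      have "complex_of_real (incr h g x) = (\<Sum>i. block t L f i (x + h)) - (\<Sum>i. block t L f i x)"
        using elim by (simp add: incr_def P_def bseries_def)
      also have "\<dots> = (\<Sum>i. incr h (block t L f i) x)"
        using suminf_diff[OF s[OF elim(2)] s[OF elim(1)]] by (simp add: incr_def)
      finally have "norm (complex_of_real (incr h g x)) = norm (\<Sum>i. incr h (block t L f i) x)" by simp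
      then show ?case by simp
    qed
  qed
  also have "\<dots> \<le> ennreal (1 / (1 - w)\<^sup>2) * wN3 w L (\<lambda>i. incr h (block t L f i))"
    by (rule N3_suminf_le[OF w]) (simp add: incr_def[abs_def])
  finally show ?thesis .
qed

text \<open>The constant is fixed before \<open>L\<close>, \<open>f\<close>, \<open>g\<close> and
  \<open>h\<close>; this order of quantifiers makes the final bound uniform over the family.\<close>

lemma N3_incr_multiplier_le:
  assumes t: "hsymbol A t r" and p: "0 \<le> p" "p \<le> 1" "p < s"
  obtains C where "C > 0" "\<And>L f g h. L \<ge> 1 \<Longrightarrow> (h :: real^2) \<noteq> 0 \<Longrightarrow> norm h \<le> 1 \<Longrightarrow> besov L s f < \<infinity> \<Longrightarrow> g \<in> torus_L2 L \<Longrightarrow>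
     (\<And>k. k \<in> freq L \<Longrightarrow> fcoeff L g k = t (k $ 1) (k $ 2) * fcoeff L f k) \<Longrightarrow>
     N3 L (incr h g) \<le> ennreal (C * norm h powr (3 * p)) * besov L s f ^ 3"
proof -
  have A: "A \<ge> 0" using hsymbol_nonneg[OF t] .
  define w where "w = 2 powr (p - s)"
  have w: "0 < w" "w < 1" unfolding w_def using p by (auto simp: powr_less_one)
  define K where "K = 161280 * A * bradius\<^sup>2 * (1 + a powr p)"
  have K0: "K \<ge> 0" unfolding K_def using A by auto
  define C where "C = 1 / (1 - w)\<^sup>2 * (K ^ 3 / (w ^ 3 * (1 - w)))"
  have C: "C \<ge> 0" unfolding C_def using K0 w by auto
  show ?thesis
  \<comment> \<open>The added 1 makes the constant strictly positive.\<close>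
  proof (rule that[of "C + 1"])
    fix L :: real and f g and h :: "real^2"
    assume *: "L \<ge> 1" "h \<noteq> 0" "norm h \<le> 1" "besov L s f < \<infinity>" "g \<in> torus_L2 L"
      "\<And>k. k \<in> freq L \<Longrightarrow> fcoeff L g k = t (k $ 1) (k $ 2) * fcoeff L f k"
    have L: "L > 0" using * by simp
    have "N3 L (incr h g) \<le> ennreal (1 / (1 - w)\<^sup>2) * wN3 w L (\<lambda>i. incr h (block t L f i))"
      by (rule N3_incr_le_series[OF L w weighted_series_finite[OF t p(1) w_def w(2) *(1,4)] *(5,6)])
    also have "\<dots> \<le> ennreal (1 / (1 - w)\<^sup>2) * (ennreal (K ^ 3 / (w ^ 3 * (1 - w)) * norm h powr (3 * p)) * besov L s f ^ 3)"
      unfolding K_def by (intro mult_left_mono weighted_series_incr_le[OF t p(1,2) w_def w(2) *(1-3)]) auto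
    also have "\<dots> = ennreal (C * norm h powr (3 * p)) * besov L s f ^ 3"
      unfolding C_def using K0 w by (simp add: mult.assoc[symmetric] ennreal_mult[symmetric])
    also have "\<dots> \<le> ennreal ((C + 1) * norm h powr (3 * p)) * besov L s f ^ 3"
      by (intro mult_right_mono ennreal_leI) auto
    finally show "N3 L (incr h g) \<le> ennreal ((C + 1) * norm h powr (3 * p)) * besov L s f ^ 3" .
  qed (use C in auto)
qed

text \<open>The candidate is the real part of the block series. The symmetry \<open>herm\<close>
  makes each block real, so nothing is lost almost everywhere.\<close>

lemma exists_multiplier:
  assumes t: "hsymbol A t r" and s: "s > 0" and herm: "\<And>x y. t (- x) (- y) = cnj (t x y)"
    and L: "L \<ge> 1" and Bn: "besov L s f < \<infinity>" and f: "f \<in> torus_L2 L"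
  shows "\<exists>g\<in>torus_L2 L. \<forall>k\<in>freq L. fcoeff L g k = t (k $ 1) (k $ 2) * fcoeff L f k"
proof -
  have L0: "L > 0" using L by simp
  have [measurable]: "f \<in> borel_measurable borel" using f by (simp add: torus_L2_def)
  \<comment> \<open>The exponent \<open>p = 0\<close>: convergence of the series itself asks for no
    power of the increment, and \<open>s > 0\<close> suffices for \<open>w < 1\<close>.\<close>
  define w where "w = 2 powr (0 - s)"
  have w: "0 < w" "w < 1" unfolding w_def using s by (auto simp: powr_less_one)
  have fin: "wN3 w L (block t L f) < \<infinity>"
    by (rule weighted_series_finite[OF t _ w_def w(2) L Bn]) simp
  have fc: "fcoeff L f (- k) = cnj (fcoeff L f k)" for k
  proof -
    have "cnj (\<integral>x. complex_of_real (f x) * ew (- k) x \<partial>tm L) = (\<integral>x. cnj (complex_of_real (f x) * ew (- k) x) \<partial>tm L)"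
      by (rule Bochner_Integration.integral_cnj[symmetric])
    then show ?thesis
      unfolding fcoeff_tm[OF L0 \<open>f \<in> borel_measurable borel\<close>] by (simp add: cnj_ew)
  qed
  \<comment> \<open>The frequency sets are symmetric and \<open>bsymbol\<close> is even, so
    conjugation merely exchanges the terms at \<open>k\<close> and \<open>- k\<close>.\<close>
  have real: "cnj (block t L f i x) = block t L f i x" for i x
  proof -
    have "uminus ` bfreqs L i = bfreqs L i"
    proof -
      have "uminus ` bfreqs L i \<subseteq> bfreqs L i" by (auto simp: bfreqs_def freq_minus split: nat.splits)
      moreover from this have "uminus ` (uminus ` bfreqs L i) \<subseteq> uminus ` bfreqs L i" by (rule image_mono)
      ultimately show ?thesis by (auto simp: image_image)
    qed
    then have "block t L f i x = (\<Sum>k\<in>uminus ` bfreqs L i. t (k $ 1) (k $ 2) * (complex_of_real (bsymbol i k) * fcoeff L f k) * ew k x)"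
      unfolding block_def trig_def by simp
    also have "\<dots> = (\<Sum>k\<in>bfreqs L i. cnj (t (k $ 1) (k $ 2) * (complex_of_real (bsymbol i k) * fcoeff L f k) * ew k x))"
    proof -
      have "bsymbol i (- k) = bsymbol i k" for k by (cases i) (simp_all add: bsymbol_def)
      then show ?thesis by (subst sum.reindex) (auto simp: herm fc cnj_ew)
    qed
    finally show ?thesis unfolding block_def trig_def by simp
  qed
  define g where "g x = Re (bseries t L f x)" for x
  have AE: "AE x in tm L. wcubes w (block t L f) x < \<infinity>"
    by (rule wcubes_integral_limit(1)[OF L0 w _ fin, where e = "\<lambda>_. 1"]) auto
  have gG: "AE x in tm L. complex_of_real (g x) = bseries t L f x"
    using AE
  proof eventually_elim
    case (elim x)
    then have "summable (\<lambda>i. block t L f i x)" by (intro summable_norm_cancel[OF wcubes_finite(1)[OF w]])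
    then have "(\<lambda>i. block t L f i x) sums bseries t L f x" unfolding bseries_def by (rule summable_sums)
    then have "(\<lambda>i. cnj (block t L f i x)) sums cnj (bseries t L f x)" by (simp only: sums_cnj)
    then have "(\<lambda>i. block t L f i x) sums cnj (bseries t L f x)" by (simp only: real)
    then have "cnj (bseries t L f x) = bseries t L f x"
      using \<open>(\<lambda>i. block t L f i x) sums bseries t L f x\<close> sums_unique2 by blast
    then show ?case unfolding g_def by (simp add: complex_eq_iff)
  qed
  have [measurable]: "g \<in> borel_measurable borel" unfolding g_def by measurable
  have "g \<in> torus_L2 L"
  proof -
    interpret prob_space "tm L" by (rule prob_space_tm[OF L0])
    have "N3 L (bseries t L f) \<le> ennreal (1 / (1 - w)\<^sup>2) * wN3 w L (block t L f)"
      unfolding bseries_def by (rule N3_suminf_le[OF w]) auto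
    also have "\<dots> < \<infinity>" using fin by (simp add: ennreal_mult_less_top)
    finally have "integrable (tm L) (\<lambda>x. norm (bseries t L f x) ^ 3)"
      unfolding N3_def by (intro integrableI_bounded) auto
    then have i: "integrable (tm L) (\<lambda>x. 1 + norm (bseries t L f x) ^ 3)" by auto
    have "integrable (tm L) (\<lambda>x. (g x)\<^sup>2)"
    proof (rule Bochner_Integration.integrable_bound[OF i])
      have "(g x)\<^sup>2 \<le> 1 + norm (bseries t L f x) ^ 3" for x
      proof -
        let ?n = "norm (bseries t L f x)"
        have "(g x)\<^sup>2 = \<bar>g x\<bar>\<^sup>2" by simp
        also have "\<dots> \<le> ?n\<^sup>2" unfolding g_def by (intro power_mono abs_Re_le_cmod) auto
        also have "\<dots> \<le> 1 + ?n ^ 3"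
        proof (cases "?n \<le> 1")
          case True
          then have "?n\<^sup>2 \<le> 1" by (simp add: power_le_one)
          then show ?thesis by (intro add_increasing2) auto
        next
          case False
          then have "?n\<^sup>2 \<le> ?n ^ 3" by (intro power_increasing) auto
          then show ?thesis by simp
        qed
        finally show ?thesis .
      qed
      then show "AE x in tm L. norm ((g x)\<^sup>2) \<le> norm (1 + norm (bseries t L f x) ^ 3)"
        by (auto simp: abs_of_nonneg)
    qed auto
    moreover have "torus_periodic L g"
      using torus_periodic_bseries[OF L0, of t f] unfolding g_def torus_periodic_def by simp
    ultimately show ?thesis
      using set_integrable_tm[OF L0, of "\<lambda>x. (g x)\<^sup>2"] by (simp add: torus_L2_def)
  qed
  moreover have "fcoeff L g k = t (k $ 1) (k $ 2) * fcoeff L f k" if k: "k \<in> freq L" for k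
  proof -
    have "fcoeff L g k = (\<integral>x. complex_of_real (g x) * ew (- k) x \<partial>tm L)" by (rule fcoeff_tm[OF L0]) simp
    also have "\<dots> = (\<integral>x. bseries t L f x * ew (- k) x \<partial>tm L)"
      using gG by (intro integral_cong_AE) auto
    also have "\<dots> = t (k $ 1) (k $ 2) * fcoeff L f k" by (rule integral_bseries[OF L0 w fin k])
    finally show ?thesis .
  qed
  ultimately show ?thesis by blast
qed

end

section \<open>From increments to the flux\<close>

lemma ennreal_norm_integral_le:
  fixes f :: "'a \<Rightarrow> 'b::{banach,second_countable_topology}"
  shows "ennreal (norm (integral\<^sup>L M f)) \<le> (\<integral>\<^sup>+x. ennreal (norm (f x)) \<partial>M)"
  by (cases "integrable M f") (auto simp: integral_norm_bound_ennreal not_integrable_integral_eq)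

text \<open>Passing through the nonnegative integral also covers an \<open>f\<close> that is not
  integrable in the angle, since its Bochner integral is then 0 by convention.\<close>

lemma circle_avg_le:
  assumes "\<And>n. norm n = 1 \<Longrightarrow> \<bar>f n\<bar> \<le> B"
  shows "\<bar>circle_avg f\<bar> \<le> B"
proof -
  have n: "norm (vector [cos x, sin x] :: real^2) = 1" for x
    by (simp add: norm_vec2)
  have B: "B \<ge> 0" using assms[OF n[of 0]] by linarith
  let ?F = "\<lambda>x. indicator {0..2*pi} x *\<^sub>R f (vector [cos x, sin x])"
  have "ennreal (norm (integral\<^sup>L lborel ?F)) \<le> (\<integral>\<^sup>+x. ennreal (norm (?F x)) \<partial>lborel)"
    by (rule ennreal_norm_integral_le)
  also have "\<dots> \<le> (\<integral>\<^sup>+x. ennreal B * indicator {0..2*pi} x \<partial>lborel)"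
    using assms[OF n] by (intro nn_integral_mono) (auto simp: indicator_def ennreal_leI)
  also have "\<dots> = ennreal (B * (2 * pi))"
    using B by (simp add: nn_integral_cmult ennreal_mult)
  finally have "norm (integral\<^sup>L lborel ?F) \<le> B * (2 * pi)" using B by (simp add: ennreal_le_iff)
  then show ?thesis
    unfolding circle_avg_def set_lebesgue_integral_def by (simp add: divide_le_eq)
qed

context lp_decomposition
begin

lemma riesz_properties:
  assumes s: "s > 0" and L: "L \<ge> 1" and Bn: "besov L s f < \<infinity>" and f: "f \<in> torus_L2 L"
  shows "riesz L j f \<in> torus_L2 L"
    and "k \<in> freq L \<Longrightarrow> fcoeff L (riesz L j f) k = \<i> * complex_of_real (k $ j / norm k) * fcoeff L f k"
proof -
  have "\<exists>g. g \<in> torus_L2 L \<and> (\<forall>k\<in>freq L. fcoeff L g k = \<i> * complex_of_real (k $ j / norm k) * fcoeff L f k)"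
    using exists_multiplier[OF hsymbol_riesz_1 s _ L Bn f] exists_multiplier[OF hsymbol_riesz_2 s _ L Bn f] exhaust_2[of j]
    unfolding Bex_def by (auto simp: norm_vec2 simp del: of_real_divide)
  from someI_ex[OF this] have "riesz L j f \<in> torus_L2 L \<and> (\<forall>k\<in>freq L. fcoeff L (riesz L j f) k = \<i> * complex_of_real (k $ j / norm k) * fcoeff L f k)"
    unfolding riesz_def fmult_def .
  then show "riesz L j f \<in> torus_L2 L"
    "k \<in> freq L \<Longrightarrow> fcoeff L (riesz L j f) k = \<i> * complex_of_real (k $ j / norm k) * fcoeff L f k"
    by auto
qed

lemma flux_integrand_le:
  fixes d d1 d2 :: real and n :: "real^2"
  assumes "norm n = 1"
  shows "\<bar>d\<^sup>2 * (vector [- d2, d1] \<bullet> n)\<bar> \<le> 2 * \<bar>d\<bar> ^ 3 + \<bar>d1\<bar> ^ 3 + \<bar>d2\<bar> ^ 3"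
proof -
  have cub: "x\<^sup>2 * y \<le> x ^ 3 + y ^ 3" if "x \<ge> 0" "y \<ge> 0" for x y :: real
  proof (cases "y \<le> x")
    case True
    then have "x\<^sup>2 * y \<le> x\<^sup>2 * x" by (intro mult_left_mono) auto
    also have "\<dots> \<le> x ^ 3 + y ^ 3" using that by (simp add: power3_eq_cube power2_eq_square)
    finally show ?thesis .
  next
    case False
    then have "x\<^sup>2 * y \<le> y\<^sup>2 * y" using that by (intro mult_right_mono power_mono) auto
    also have "\<dots> \<le> x ^ 3 + y ^ 3" using that by (simp add: power3_eq_cube power2_eq_square)
    finally show ?thesis .
  qed
  have "\<bar>n $ 1\<bar> \<le> 1" "\<bar>n $ 2\<bar> \<le> 1" using component_le_norm_cart[of n] assms by metis+
  then have "\<bar>d2\<bar> * \<bar>n $ 1\<bar> \<le> \<bar>d2\<bar>" "\<bar>d1\<bar> * \<bar>n $ 2\<bar> \<le> \<bar>d1\<bar>" by (simp_all add: mult_left_le)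
  moreover have "vector [- d2, d1] \<bullet> n = - (d2 * n $ 1) + d1 * n $ 2"
    by (simp add: inner_vec_def sum_2)
  ultimately have "\<bar>vector [- d2, d1] \<bullet> n\<bar> \<le> \<bar>d1\<bar> + \<bar>d2\<bar>"
    using abs_triangle_ineq[of "- (d2 * n $ 1)" "d1 * n $ 2"] by (simp add: abs_mult)
  then have "\<bar>d\<^sup>2 * (vector [- d2, d1] \<bullet> n)\<bar> \<le> d\<^sup>2 * (\<bar>d1\<bar> + \<bar>d2\<bar>)"
    unfolding abs_mult by (intro mult_mono) auto
  also have "\<dots> = \<bar>d\<bar>\<^sup>2 * \<bar>d1\<bar> + \<bar>d\<bar>\<^sup>2 * \<bar>d2\<bar>" by (simp add: distrib_left)
  also have "\<dots> \<le> (\<bar>d\<bar> ^ 3 + \<bar>d1\<bar> ^ 3) + (\<bar>d\<bar> ^ 3 + \<bar>d2\<bar> ^ 3)"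
    by (intro add_mono cub) auto
  finally show ?thesis by simp
qed

lemma flux_le:
  assumes s: "s > 1 / 3"
  obtains C p where "C > 0" "p > 1"
    "\<And>L f l. L \<ge> 1 \<Longrightarrow> f \<in> torus_L2 L \<Longrightarrow> 0 < l \<Longrightarrow> l \<le> 1 \<Longrightarrow>
       ennreal \<bar>circle_avg (\<lambda>n. torus_avg L (\<lambda>x. (incr (l *\<^sub>R n) f x)\<^sup>2 * (incr (l *\<^sub>R n) (riesz_perp L f) x \<bullet> n)))\<bar>
         \<le> ennreal (C * l powr p) * besov L s f ^ 3"
proof -
  \<comment> \<open>The midpoint between 1/3 and \<open>min s 1\<close>: below \<open>s\<close> for
    summability, at most 1 for the increment bounds, above 1/3 so that \<open>3 * p\<close> exceeds
    1.\<close>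
  define p where "p = (1 / 3 + min s 1) / 2"
  have p: "0 \<le> p" "p \<le> 1" "p < s" "3 * p > 1" using s unfolding p_def by (auto simp: min_def)
  have s0: "s > 0" using s by simp
  obtain C0 where C0: "C0 > 0" "\<And>L f g h. L \<ge> 1 \<Longrightarrow> (h :: real^2) \<noteq> 0 \<Longrightarrow> norm h \<le> 1 \<Longrightarrow> besov L s f < \<infinity> \<Longrightarrow> g \<in> torus_L2 L \<Longrightarrow>
     (\<And>k. k \<in> freq L \<Longrightarrow> fcoeff L g k = 1 * fcoeff L f k) \<Longrightarrow>
     N3 L (incr h g) \<le> ennreal (C0 * norm h powr (3 * p)) * besov L s f ^ 3"
    by (rule N3_incr_multiplier_le[OF hsymbol_one p(1-3)]) blast
  obtain C1 where C1: "C1 > 0" "\<And>L f g h. L \<ge> 1 \<Longrightarrow> (h :: real^2) \<noteq> 0 \<Longrightarrow> norm h \<le> 1 \<Longrightarrow> besov L s f < \<infinity> \<Longrightarrow> g \<in> torus_L2 L \<Longrightarrow>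
     (\<And>k. k \<in> freq L \<Longrightarrow> fcoeff L g k = \<i> * complex_of_real (k $ 1 / sqrt ((k $ 1)\<^sup>2 + (k $ 2)\<^sup>2)) * fcoeff L f k) \<Longrightarrow>
     N3 L (incr h g) \<le> ennreal (C1 * norm h powr (3 * p)) * besov L s f ^ 3"
    by (rule N3_incr_multiplier_le[OF hsymbol_riesz_1 p(1-3)]) blast
  obtain C2 where C2: "C2 > 0" "\<And>L f g h. L \<ge> 1 \<Longrightarrow> (h :: real^2) \<noteq> 0 \<Longrightarrow> norm h \<le> 1 \<Longrightarrow> besov L s f < \<infinity> \<Longrightarrow> g \<in> torus_L2 L \<Longrightarrow>
     (\<And>k. k \<in> freq L \<Longrightarrow> fcoeff L g k = \<i> * complex_of_real (k $ 2 / sqrt ((k $ 1)\<^sup>2 + (k $ 2)\<^sup>2)) * fcoeff L f k) \<Longrightarrow>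
     N3 L (incr h g) \<le> ennreal (C2 * norm h powr (3 * p)) * besov L s f ^ 3"
    by (rule N3_incr_multiplier_le[OF hsymbol_riesz_2 p(1-3)]) blast
  define C where "C = 2 * C0 + C1 + C2"
  have C: "C > 0" unfolding C_def using C0(1) C1(1) C2(1) by simp
  show ?thesis
  proof (rule that[OF C p(4)])
    fix L f l assume L: "L \<ge> 1" and f: "f \<in> torus_L2 L" and l: "0 < l" "l \<le> (1::real)"
    let ?Bn = "besov L s f"
    let ?S = "\<lambda>n. torus_avg L (\<lambda>x. (incr (l *\<^sub>R n) f x)\<^sup>2 * (incr (l *\<^sub>R n) (riesz_perp L f) x \<bullet> n))"
    have L0: "L > 0" using L by simp
    show "ennreal \<bar>circle_avg ?S\<bar> \<le> ennreal (C * l powr (3 * p)) * ?Bn ^ 3"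
    proof (cases "?Bn < \<infinity>")
      \<comment> \<open>With infinite Besov norm the Riesz transforms may be unspecified, but the
        right-hand side is infinite because its coefficient is positive.\<close>
      case False
      then have "?Bn ^ 3 = \<top>" by (simp add: top.not_eq_extremum[symmetric] power_eq_top_ennreal)
      then show ?thesis using C l by (simp add: ennreal_mult_top)
    next
      case True
      note R = riesz_properties[OF s0 L True f]
      have [measurable]: "f \<in> borel_measurable borel" "riesz L j f \<in> borel_measurable borel" for j
        using f R(1)[of j] by (auto simp: torus_L2_def)
      have "ennreal \<bar>?S n\<bar> \<le> ennreal (C * l powr (3 * p)) * ?Bn ^ 3" if n: "norm n = 1" for n
      proof -
        define h where "h = l *\<^sub>R n"
        have h: "h \<noteq> 0" "norm h \<le> 1" "norm h = l" unfolding h_def using l n by auto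
        define d where "d = incr h f"
        define d1 where "d1 = incr h (riesz L 1 f)"
        define d2 where "d2 = incr h (riesz L 2 f)"
        have [measurable]: "d \<in> borel_measurable borel" "d1 \<in> borel_measurable borel" "d2 \<in> borel_measurable borel"
          unfolding d_def d1_def d2_def incr_def[abs_def] by measurable
        have rp: "incr h (riesz_perp L f) x = vector [- d2 x, d1 x]" for x
          by (simp add: incr_def riesz_perp_def d1_def d2_def vec_eq_iff forall_2)
        have inner: "vector [- d2 x, d1 x] \<bullet> n = - (d2 x * n $ 1) + d1 x * n $ 2" for x
          by (simp add: inner_vec_def sum_2)
        have "?S n = (\<integral>x. (d x)\<^sup>2 * (vector [- d2 x, d1 x] \<bullet> n) \<partial>tm L)"
          unfolding h_def[symmetric] d_def[symmetric] rp inner by (rule torus_avg_tm[OF L0]) measurable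
        then have "ennreal \<bar>?S n\<bar> \<le> (\<integral>\<^sup>+x. ennreal \<bar>(d x)\<^sup>2 * (vector [- d2 x, d1 x] \<bullet> n)\<bar> \<partial>tm L)"
          using ennreal_norm_integral_le[of "tm L" "\<lambda>x. (d x)\<^sup>2 * (vector [- d2 x, d1 x] \<bullet> n)"] by simp
        also have "\<dots> \<le> (\<integral>\<^sup>+x. 2 * ennreal (norm (d x) ^ 3) + ennreal (norm (d1 x) ^ 3) + ennreal (norm (d2 x) ^ 3) \<partial>tm L)"
        proof (rule nn_integral_mono)
          fix x
          have "ennreal \<bar>(d x)\<^sup>2 * (vector [- d2 x, d1 x] \<bullet> n)\<bar> \<le> ennreal (2 * \<bar>d x\<bar> ^ 3 + \<bar>d1 x\<bar> ^ 3 + \<bar>d2 x\<bar> ^ 3)"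
            by (intro ennreal_leI flux_integrand_le n)
          then show "ennreal \<bar>(d x)\<^sup>2 * (vector [- d2 x, d1 x] \<bullet> n)\<bar> \<le> 2 * ennreal (norm (d x) ^ 3) + ennreal (norm (d1 x) ^ 3) + ennreal (norm (d2 x) ^ 3)"
            by (simp add: ennreal_mult' ennreal_plus)
        qed
        also have "\<dots> = 2 * N3 L d + N3 L d1 + N3 L d2"
          unfolding N3_def by (simp add: nn_integral_add nn_integral_cmult)
        also have "\<dots> \<le> 2 * (ennreal (C0 * norm h powr (3 * p)) * ?Bn ^ 3) + ennreal (C1 * norm h powr (3 * p)) * ?Bn ^ 3
            + ennreal (C2 * norm h powr (3 * p)) * ?Bn ^ 3"
          unfolding d_def d1_def d2_def
        proof (intro add_mono mult_left_mono)
          show "N3 L (incr h f) \<le> ennreal (C0 * norm h powr (3 * p)) * ?Bn ^ 3"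
            by (rule C0(2)[OF L h(1,2) True f]) simp
          show "N3 L (incr h (riesz L 1 f)) \<le> ennreal (C1 * norm h powr (3 * p)) * ?Bn ^ 3"
            by (rule C1(2)[OF L h(1,2) True R(1)]) (simp add: R(2) norm_vec2)
          show "N3 L (incr h (riesz L 2 f)) \<le> ennreal (C2 * norm h powr (3 * p)) * ?Bn ^ 3"
            by (rule C2(2)[OF L h(1,2) True R(1)]) (simp add: R(2) norm_vec2)
        qed simp
        also have "\<dots> = ennreal (C * l powr (3 * p)) * ?Bn ^ 3"
          unfolding h(3) C_def using C0(1) C1(1) C2(1)
          by (simp add: distrib_right ennreal_plus ennreal_mult' mult.assoc)
        finally show ?thesis .
      qed
      moreover have "ennreal (C * l powr (3 * p)) * ?Bn ^ 3 = ennreal (C * l powr (3 * p) * enn2real ?Bn ^ 3)"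
        using True C by (simp add: ennreal_mult ennreal_power[symmetric])
      ultimately have "\<bar>?S n\<bar> \<le> C * l powr (3 * p) * enn2real ?Bn ^ 3" if "norm n = 1" for n
        using that C by (simp add: ennreal_le_iff)
      then have "\<bar>circle_avg ?S\<bar> \<le> C * l powr (3 * p) * enn2real ?Bn ^ 3" by (rule circle_avg_le)
      then show ?thesis
        unfolding \<open>ennreal (C * l powr (3 * p)) * ?Bn ^ 3 = ennreal (C * l powr (3 * p) * enn2real ?Bn ^ 3)\<close>
        by (rule ennreal_leI)
    qed
  qed
qed

end

text \<open>\<open>B\<close> carries no measurability assumption, so the constant cannot be pulled
  out of its integral directly. It is divided into the measurable \<open>X\<close> first and
  cancelled under the integral. If \<open>X\<close> is not integrable, \<open>S_E\<close> is 0 by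
  convention.\<close>

lemma S_E_le:
  assumes X: "AE \<omega> in M. ennreal \<bar>circle_avg (\<lambda>n. torus_avg L (\<lambda>x. (incr (l *\<^sub>R n) (\<theta> \<omega>) x)\<^sup>2 * (incr (l *\<^sub>R n) (riesz_perp L (\<theta> \<omega>)) x \<bullet> n)))\<bar>
       \<le> ennreal c * B \<omega>"
    and c: "c > 0"
  shows "ennreal \<bar>S_E M L \<theta> l\<bar> \<le> ennreal c * (\<integral>\<^sup>+\<omega>. B \<omega> \<partial>M)"
proof -
  define X where "X \<omega> = circle_avg (\<lambda>n. torus_avg L (\<lambda>x. (incr (l *\<^sub>R n) (\<theta> \<omega>) x)\<^sup>2 * (incr (l *\<^sub>R n) (riesz_perp L (\<theta> \<omega>)) x \<bullet> n)))" for \<omega>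
  have SE: "S_E M L \<theta> l = integral\<^sup>L M X" unfolding S_E_def X_def ..
  have b: "AE \<omega> in M. ennreal \<bar>X \<omega>\<bar> \<le> ennreal c * B \<omega>" using X unfolding X_def .
  show ?thesis
  proof (cases "integrable M X")
    case True
    then have [measurable]: "X \<in> borel_measurable M" by simp
    have "ennreal \<bar>integral\<^sup>L M X\<bar> \<le> (\<integral>\<^sup>+\<omega>. ennreal \<bar>X \<omega>\<bar> \<partial>M)"
      using ennreal_norm_integral_le[of M X] by simp
    also have "\<dots> = (\<integral>\<^sup>+\<omega>. ennreal c * ennreal (\<bar>X \<omega>\<bar> / c) \<partial>M)"
      using c by (intro nn_integral_cong) (simp add: ennreal_mult[symmetric])
    also have "\<dots> = ennreal c * (\<integral>\<^sup>+\<omega>. ennreal (\<bar>X \<omega>\<bar> / c) \<partial>M)" by (rule nn_integral_cmult) measurable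
    also have "\<dots> \<le> ennreal c * (\<integral>\<^sup>+\<omega>. B \<omega> \<partial>M)"
    proof (intro mult_left_mono nn_integral_mono_AE)
      show "AE \<omega> in M. ennreal (\<bar>X \<omega>\<bar> / c) \<le> B \<omega>"
        using b
      proof eventually_elim
        case (elim \<omega>)
        have "ennreal (\<bar>X \<omega>\<bar> / c) = ennreal (1 / c) * ennreal \<bar>X \<omega>\<bar>" using c by (simp add: ennreal_mult[symmetric])
        also have "\<dots> \<le> ennreal (1 / c) * (ennreal c * B \<omega>)" using elim by (rule mult_left_mono) simp
        also have "\<dots> = B \<omega>" using c by (simp add: mult.assoc[symmetric] ennreal_mult[symmetric])
        finally show ?case .
      qed
    qed simp
    finally show ?thesis unfolding SE .
  qed (simp add: SE not_integrable_integral_eq)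
qed

lemma uniform_structure_function_bound:
  fixes \<theta> :: "real \<Rightarrow> real \<Rightarrow> real \<Rightarrow> 'w \<Rightarrow> real^2 \<Rightarrow> real"
  assumes "lp_cutoffs \<eta> \<phi>" and t: "t \<ge> 0" and s: "s > 1/3"
    and lam: "\<And>\<nu> \<alpha>. \<nu> > 0 \<Longrightarrow> \<alpha> > 0 \<Longrightarrow> lam \<nu> \<alpha> \<ge> 1"
    and sol: "\<And>\<nu> \<alpha>. \<nu> > 0 \<Longrightarrow> \<alpha> > 0 \<Longrightarrow>
           stationary_strong_solution M F W (g (lam \<nu> \<alpha>)) \<nu> \<alpha> \<gamma> (lam \<nu> \<alpha>) (\<theta> \<nu> \<alpha>)"
    and bes: "(SUP (\<nu>, \<alpha>)\<in>{0<..} \<times> {0<..}.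
           \<integral>\<^sup>+\<omega>. (besov_norm \<eta> \<phi> (lam \<nu> \<alpha>) s (\<theta> \<nu> \<alpha> t \<omega>)) ^ 3 \<partial>M) < \<infinity>"
  shows "\<exists>D q. D \<ge> 0 \<and> q > 0 \<and> (\<forall>\<nu> \<alpha> l. \<nu> > 0 \<longrightarrow> \<alpha> > 0 \<longrightarrow> 0 < l \<longrightarrow> l \<le> 1 \<longrightarrow>
    \<bar>S_E M (lam \<nu> \<alpha>) (\<theta> \<nu> \<alpha> t) l / l\<bar> \<le> D * l powr q)"
proof -
  obtain R a b where "R > 0" "\<forall>r>R. \<eta> r = 0" "0 < a" "a < b" "\<forall>r\<ge>0. r \<notin> {a..b} \<longrightarrow> \<phi> r = 0"
    "\<forall>r\<ge>0. \<eta> r + (\<Sum>j. \<phi> (r / 2 ^ j)) = 1"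
    using assms(1) unfolding lp_cutoffs_def by blast
  then interpret lp_decomposition \<eta> \<phi> a b R by unfold_locales auto
  obtain C p where C: "C > 0" "p > 1"
    "\<And>L f l. L \<ge> 1 \<Longrightarrow> f \<in> torus_L2 L \<Longrightarrow> 0 < l \<Longrightarrow> l \<le> 1 \<Longrightarrow>
       ennreal \<bar>circle_avg (\<lambda>n. torus_avg L (\<lambda>x. (incr (l *\<^sub>R n) f x)\<^sup>2 * (incr (l *\<^sub>R n) (riesz_perp L f) x \<bullet> n)))\<bar>
         \<le> ennreal (C * l powr p) * besov_norm \<eta> \<phi> L s f ^ 3"
    by (rule flux_le[OF s]) blast
  define K where "K = enn2real (SUP (\<nu>, \<alpha>)\<in>{0<..} \<times> {0<..}. \<integral>\<^sup>+\<omega>. (besov_norm \<eta> \<phi> (lam \<nu> \<alpha>) s (\<theta> \<nu> \<alpha> t \<omega>)) ^ 3 \<partial>M)"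
  have K: "K \<ge> 0" by (simp add: K_def)
  show ?thesis
  \<comment> \<open>The flux is of order \<open>l powr p\<close> with \<open>p > 1\<close>; dividing
    by \<open>l\<close> leaves the positive exponent \<open>p - 1\<close>.\<close>
  proof (rule exI[of _ "C * K"], rule exI[of _ "p - 1"], intro conjI allI impI)
    fix \<nu> \<alpha> l :: real assume nu: "\<nu> > 0" "\<alpha> > 0" and l: "0 < l" "l \<le> 1"
    let ?L = "lam \<nu> \<alpha>"
    have "AE \<omega> in M. (\<lambda>t. \<theta> \<nu> \<alpha> t \<omega>) \<in> C_H1 ?L \<inter> L2loc_H2 ?L"
      using sol[OF nu] unfolding stationary_strong_solution_def by blast
    then have "AE \<omega> in M. \<theta> \<nu> \<alpha> t \<omega> \<in> torus_L2 ?L"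
      by eventually_elim (use t in \<open>auto simp: C_H1_def sobolev_def\<close>)
    then have "AE \<omega> in M. ennreal \<bar>circle_avg (\<lambda>n. torus_avg ?L (\<lambda>x. (incr (l *\<^sub>R n) (\<theta> \<nu> \<alpha> t \<omega>) x)\<^sup>2 * (incr (l *\<^sub>R n) (riesz_perp ?L (\<theta> \<nu> \<alpha> t \<omega>)) x \<bullet> n)))\<bar>
       \<le> ennreal (C * l powr p) * besov_norm \<eta> \<phi> ?L s (\<theta> \<nu> \<alpha> t \<omega>) ^ 3"
      by eventually_elim (intro C(3) lam nu l)
    then have "ennreal \<bar>S_E M ?L (\<theta> \<nu> \<alpha> t) l\<bar> \<le> ennreal (C * l powr p) * (\<integral>\<^sup>+\<omega>. besov_norm \<eta> \<phi> ?L s (\<theta> \<nu> \<alpha> t \<omega>) ^ 3 \<partial>M)"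
      using C l by (intro S_E_le) auto
    also have "(\<integral>\<^sup>+\<omega>. besov_norm \<eta> \<phi> ?L s (\<theta> \<nu> \<alpha> t \<omega>) ^ 3 \<partial>M) \<le> ennreal K"
    proof -
      have "(\<integral>\<^sup>+\<omega>. besov_norm \<eta> \<phi> ?L s (\<theta> \<nu> \<alpha> t \<omega>) ^ 3 \<partial>M)
        \<le> (SUP (\<nu>, \<alpha>)\<in>{0<..} \<times> {0<..}. \<integral>\<^sup>+\<omega>. (besov_norm \<eta> \<phi> (lam \<nu> \<alpha>) s (\<theta> \<nu> \<alpha> t \<omega>)) ^ 3 \<partial>M)"
        using nu by (intro SUP_upper2[of "(\<nu>, \<alpha>)"]) auto
      also have "\<dots> = ennreal K" using bes by (simp add: K_def)
      finally show ?thesis .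
    qed
    finally have "ennreal \<bar>S_E M ?L (\<theta> \<nu> \<alpha> t) l\<bar> \<le> ennreal (C * l powr p) * ennreal K"
      by (simp add: mult_left_mono)
    also have "\<dots> = ennreal (C * l powr p * K)" using C K by (simp add: ennreal_mult)
    finally have "\<bar>S_E M ?L (\<theta> \<nu> \<alpha> t) l\<bar> \<le> C * l powr p * K"
      using C K by (simp add: ennreal_le_iff)
    then have "\<bar>S_E M ?L (\<theta> \<nu> \<alpha> t) l / l\<bar> \<le> C * l powr p * K / l"
      using l by (simp add: divide_right_mono)
    also have "\<dots> = C * K * l powr (p - 1)" using l by (simp add: powr_diff)
    finally show "\<bar>S_E M ?L (\<theta> \<nu> \<alpha> t) l / l\<bar> \<le> C * K * l powr (p - 1)" .
  qed (use C K in auto)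
qed

section \<open>Passage to the limit in the viscosity, the damping and the scale\<close>

lemma Limsup_flux:
  fixes S :: "real \<Rightarrow> real \<Rightarrow> real \<Rightarrow> real"
  assumes D: "D \<ge> 0" and q: "q > 0"
    and b: "\<And>\<nu> \<alpha> l. \<nu> > 0 \<Longrightarrow> \<alpha> > 0 \<Longrightarrow> 0 < l \<Longrightarrow> l \<le> 1 \<Longrightarrow> \<bar>S \<nu> \<alpha> l / l\<bar> \<le> D * l powr q"
  shows "((\<lambda>lI. Limsup (at_right 0 \<times>\<^sub>F at_right 0) (\<lambda>(\<nu>, \<alpha>).
             SUP l\<in>{0<..lI}. ereal \<bar>S \<nu> \<alpha> l / l\<bar>)) \<longlongrightarrow> 0) (at_right 0)"
    and "c \<noteq> 0 \<Longrightarrow> \<forall>\<nu>>0. \<forall>\<alpha>>0. lmin \<nu> \<alpha> > 0 \<Longrightarrow>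
      ((\<lambda>(\<nu>, \<alpha>). lmin \<nu> \<alpha>) \<longlongrightarrow> 0) (at_right 0 \<times>\<^sub>F at_right 0) \<Longrightarrow>
      \<not> ((\<lambda>lI. Limsup (at_right 0 \<times>\<^sub>F at_right 0) (\<lambda>(\<nu>, \<alpha>).
                SUP l\<in>{lmin \<nu> \<alpha>..lI}. ereal \<bar>S \<nu> \<alpha> l / l - c\<bar>)) \<longlongrightarrow> 0) (at_right 0)"
proof -
  let ?F = "at_right 0 \<times>\<^sub>F at_right 0 :: (real \<times> real) filter"
  have F: "?F \<noteq> bot" by (simp add: prod_filter_eq_bot)
  have pos: "eventually (\<lambda>x. fst x > 0 \<and> snd x > 0) ?F"
    by (intro eventually_prodI eventually_at_right_less)
  have Dq: "((\<lambda>x. D * x powr q) \<longlongrightarrow> 0) (at_right 0)"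
  proof -
    have "((\<lambda>x::real. x powr q) \<longlongrightarrow> 0) (at_right 0)"
      using q by (intro tendsto_zero_powrI[where b = q]) (auto simp: eventually_at_filter intro!: tendsto_ident_at)
    from tendsto_mult_right_zero[OF this, of D] show ?thesis by simp
  qed
  have ev1: "eventually (\<lambda>x::real. 0 < x \<and> x < 1) (at_right 0)"
    using eventually_at_right_real[of 0 1] by simp
  show "((\<lambda>lI. Limsup ?F (\<lambda>(\<nu>, \<alpha>). SUP l\<in>{0<..lI}. ereal \<bar>S \<nu> \<alpha> l / l\<bar>)) \<longlongrightarrow> 0) (at_right 0)"
  proof (rule tendsto_sandwich[where f = "\<lambda>_. 0" and h = "\<lambda>x. ereal (D * x powr q)"])
    show "eventually (\<lambda>lI. 0 \<le> Limsup ?F (\<lambda>(\<nu>, \<alpha>). SUP l\<in>{0<..lI}. ereal \<bar>S \<nu> \<alpha> l / l\<bar>)) (at_right 0)"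
      using ev1
    proof eventually_elim
      case (elim lI)
      \<comment> \<open>The supremum in \<open>ereal\<close> over an empty set would be minus
        infinity; \<open>lI > 0\<close> puts \<open>lI\<close> itself in the range.\<close>
      have "0 \<le> (SUP l\<in>{0<..lI}. ereal \<bar>S \<nu> \<alpha> l / l\<bar>)" for \<nu> \<alpha>
        using elim by (intro SUP_upper2[of lI]) auto
      then show ?case by (intro le_Limsup[OF F] always_eventually) (auto simp: case_prod_beta)
    qed
    show "eventually (\<lambda>lI. Limsup ?F (\<lambda>(\<nu>, \<alpha>). SUP l\<in>{0<..lI}. ereal \<bar>S \<nu> \<alpha> l / l\<bar>) \<le> ereal (D * lI powr q)) (at_right 0)"
      using ev1
    proof eventually_elim
      case (elim lI)
      show ?case
      proof (rule Limsup_bounded)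
        show "eventually (\<lambda>x. (case x of (\<nu>, \<alpha>) \<Rightarrow> SUP l\<in>{0<..lI}. ereal \<bar>S \<nu> \<alpha> l / l\<bar>) \<le> ereal (D * lI powr q)) ?F"
          using pos
        proof eventually_elim
          case (elim x)
          have "(SUP l\<in>{0<..lI}. ereal \<bar>S (fst x) (snd x) l / l\<bar>) \<le> ereal (D * lI powr q)"
          proof (rule SUP_least)
            fix l assume l: "l \<in> {0<..lI}"
            have "\<bar>S (fst x) (snd x) l / l\<bar> \<le> D * l powr q"
              using l elim \<open>0 < lI \<and> lI < 1\<close> by (intro b) auto
            also have "\<dots> \<le> D * lI powr q" using l D q by (intro mult_left_mono powr_mono2) auto
            finally show "ereal \<bar>S (fst x) (snd x) l / l\<bar> \<le> ereal (D * lI powr q)" by simp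
          qed
          then show ?case by (simp add: case_prod_beta)
        qed
      qed
    qed
    show "((\<lambda>x. ereal (D * x powr q)) \<longlongrightarrow> 0) (at_right 0)"
      using Dq by (simp add: zero_ereal_def)
  qed simp
  assume c: "c \<noteq> 0" and lmin: "\<forall>\<nu>>0. \<forall>\<alpha>>0. lmin \<nu> \<alpha> > 0" and lim: "((\<lambda>(\<nu>, \<alpha>). lmin \<nu> \<alpha>) \<longlongrightarrow> 0) ?F"
  show "\<not> ((\<lambda>lI. Limsup ?F (\<lambda>(\<nu>, \<alpha>). SUP l\<in>{lmin \<nu> \<alpha>..lI}. ereal \<bar>S \<nu> \<alpha> l / l - c\<bar>)) \<longlongrightarrow> 0) (at_right 0)"
  proof
    assume A: "((\<lambda>lI. Limsup ?F (\<lambda>(\<nu>, \<alpha>). SUP l\<in>{lmin \<nu> \<alpha>..lI}. ereal \<bar>S \<nu> \<alpha> l / l - c\<bar>)) \<longlongrightarrow> 0) (at_right 0)"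
    \<comment> \<open>The single scale \<open>l = lI\<close> suffices: there the flux is at most
      \<open>D * lI powr q\<close>, so its distance from \<open>c\<close> is at least
      \<open>\<bar>c\<bar> - D * lI powr q\<close>, and both sides are compared in the limit
      \<open>lI\<close> to 0.\<close>
    have "ereal \<bar>c\<bar> \<le> 0"
    proof (rule tendsto_le[OF _ A])
      have "((\<lambda>x. \<bar>c\<bar> - D * x powr q) \<longlongrightarrow> \<bar>c\<bar> - 0) (at_right 0)" by (intro tendsto_intros Dq)
      then show "((\<lambda>x. ereal (\<bar>c\<bar> - D * x powr q)) \<longlongrightarrow> ereal \<bar>c\<bar>) (at_right 0)" by simp
      show "eventually (\<lambda>lI. ereal (\<bar>c\<bar> - D * lI powr q) \<le> Limsup ?F (\<lambda>(\<nu>, \<alpha>). SUP l\<in>{lmin \<nu> \<alpha>..lI}. ereal \<bar>S \<nu> \<alpha> l / l - c\<bar>)) (at_right 0)"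
        using ev1
      proof eventually_elim
        case (elim lI)
        \<comment> \<open>Since \<open>lmin\<close> tends to 0, the scale \<open>lI\<close>
          eventually belongs to the interval of the supremum.\<close>
        have small: "eventually (\<lambda>x. (case x of (\<nu>, \<alpha>) \<Rightarrow> lmin \<nu> \<alpha>) < lI) ?F"
          using order_tendstoD(2)[OF lim] elim by simp
        show ?case
        proof (rule le_Limsup[OF F])
          show "eventually (\<lambda>x. ereal (\<bar>c\<bar> - D * lI powr q) \<le> (case x of (\<nu>, \<alpha>) \<Rightarrow> SUP l\<in>{lmin \<nu> \<alpha>..lI}. ereal \<bar>S \<nu> \<alpha> l / l - c\<bar>)) ?F"
            using pos small
          proof eventually_elim
            case (elim x)
            have "\<bar>S (fst x) (snd x) lI / lI\<bar> \<le> D * lI powr q"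
              using elim \<open>0 < lI \<and> lI < 1\<close> by (intro b) auto
            then have "ereal (\<bar>c\<bar> - D * lI powr q) \<le> ereal \<bar>S (fst x) (snd x) lI / lI - c\<bar>"
              unfolding ereal_less_eq by linarith
            also have "\<dots> \<le> (SUP l\<in>{lmin (fst x) (snd x)..lI}. ereal \<bar>S (fst x) (snd x) l / l - c\<bar>)"
              using elim by (intro SUP_upper) (auto simp: case_prod_beta)
            finally show ?case by (simp add: case_prod_beta)
          qed
        qed
      qed
    qed simp
    then show False using c by (simp add: zero_ereal_def)
  qed
qed

theorem theorem2p9:
  fixes M :: "'w measure" and F :: "real \<Rightarrow> 'w measure"
    and W :: "nat \<Rightarrow> real \<Rightarrow> 'w \<Rightarrow> real"
    and g :: "real \<Rightarrow> nat \<Rightarrow> real^2 \<Rightarrow> real"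
    and \<eta> \<phi> :: "real \<Rightarrow> real"
    and \<gamma> s t :: real
    and lam :: "real \<Rightarrow> real \<Rightarrow> real"
    and \<theta> :: "real \<Rightarrow> real \<Rightarrow> real \<Rightarrow> 'w \<Rightarrow> real^2 \<Rightarrow> real"
  assumes "stochastic_basis M F"
    and "iid_brownian_motions M F W"
    and "admissible_forcing g"
    and "lp_cutoffs \<eta> \<phi>"
    and "\<gamma> \<ge> 0" and "t \<ge> 0" and "s > 1/3"
    and "\<And>\<nu> \<alpha>. \<nu> > 0 \<Longrightarrow> \<alpha> > 0 \<Longrightarrow> lam \<nu> \<alpha> \<ge> 1"
    and "filterlim (\<lambda>(\<nu>, \<alpha>). lam \<nu> \<alpha>) at_top (at_right 0 \<times>\<^sub>F at_right 0)"
    and "\<And>\<nu> \<alpha>. \<nu> > 0 \<Longrightarrow> \<alpha> > 0 \<Longrightarrow>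
           stationary_strong_solution M F W (g (lam \<nu> \<alpha>)) \<nu> \<alpha> \<gamma> (lam \<nu> \<alpha>) (\<theta> \<nu> \<alpha>)"
    and "(SUP (\<nu>, \<alpha>)\<in>{0<..} \<times> {0<..}.
           \<integral>\<^sup>+\<omega>. (besov_norm \<eta> \<phi> (lam \<nu> \<alpha>) s (\<theta> \<nu> \<alpha> t \<omega>)) ^ 3 \<partial>M) < \<infinity>"
  shows "((\<lambda>lI. Limsup (at_right 0 \<times>\<^sub>F at_right 0) (\<lambda>(\<nu>, \<alpha>).
             SUP l\<in>{0<..lI}. ereal \<bar>S_E M (lam \<nu> \<alpha>) (\<theta> \<nu> \<alpha> t) l / l\<bar>)) \<longlongrightarrow> 0) (at_right 0)
       \<and> \<not> (\<exists>(c::real) (lmin :: real \<Rightarrow> real \<Rightarrow> real). c \<noteq> 0 \<and>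
             (\<forall>\<nu>>0. \<forall>\<alpha>>0. lmin \<nu> \<alpha> > 0) \<and>
             ((\<lambda>(\<nu>, \<alpha>). lmin \<nu> \<alpha>) \<longlongrightarrow> 0) (at_right 0 \<times>\<^sub>F at_right 0) \<and>
             ((\<lambda>lI. Limsup (at_right 0 \<times>\<^sub>F at_right 0) (\<lambda>(\<nu>, \<alpha>).
                SUP l\<in>{lmin \<nu> \<alpha>..lI}. ereal \<bar>S_E M (lam \<nu> \<alpha>) (\<theta> \<nu> \<alpha> t) l / l - c\<bar>))
               \<longlongrightarrow> 0) (at_right 0))"
proof -
  obtain D q where "D \<ge> 0" "q > 0"
    "\<And>\<nu> \<alpha> l. \<nu> > 0 \<Longrightarrow> \<alpha> > 0 \<Longrightarrow> 0 < l \<Longrightarrow> l \<le> 1 \<Longrightarrow>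
       \<bar>S_E M (lam \<nu> \<alpha>) (\<theta> \<nu> \<alpha> t) l / l\<bar> \<le> D * l powr q"
    using uniform_structure_function_bound[OF assms(4,6,7,8,10,11)] by blast
  note * = Limsup_flux[where S = "\<lambda>\<nu> \<alpha>. S_E M (lam \<nu> \<alpha>) (\<theta> \<nu> \<alpha> t)", OF this]
  show ?thesis using *(1) *(2) by blast
qed

end
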